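(* Let $d\ge4$, let $h>0$, and let $\mathbb V=(V_x)_{x\in\mathbb Z^d}$ be i.i.d. random variables with $\operatorname{ess\,inf}V_x=0$, $\mathbb E V_x^d<\infty$ and $\mathbb P[V_x=0]<1$. Then there are $\beta_0>0$ and $K_{\mathrm{s.m.}}<\infty$ such that $$\mathbb E\big(Z^{\mathrm{qu}}_{\mathbb V,h,\beta,N}\big)^2\le K_{\mathrm{s.m.}}\big(Z^{\mathrm{an}}_{h,\beta,N}\big)^2$$ for all $N\in\mathbb N$ and $0\le\beta\le\beta_0$.
   Context: $\mathbb N=\{1,2,\dots\}$. For $h\ge0$, $P_h$ (expectation $E_h$) is the law of the nearest-neighbor random walk $S=(S(n))_{n\ge0}$ on $\mathbb Z^d$ with $S(0)=0$ and i.i.d. increments satisfying $P_h[S(1)=e]=e^{h e_1}/\sum_{e'}e^{he'_1}$ for each of the $2d$ unit vectors $e$ (sum over the same unit vectors; $e_1$ is the first coordinate of $e$). The potential $\mathbb V$ (probability $\mathbb P$, expectation $\mathbb E$) is independent of the walk. Quenched partition function: $Z^{\mathrm{qu}}_{\mathbb V,h,\beta,N}=E_h\big[\exp\big(-\beta\sum_{n=1}^N V_{S(n)}\big)\big]$, a random variable depending on $\mathbb V$. Annealed partition function: $Z^{\mathrm{an}}_{h,\beta,N}=\mathbb E Z^{\mathrm{qu}}_{\mathbb V,h,\beta,N}$. *)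

theory Defs
  imports "HOL-Probability.Probability"
begin

definition unit_vectors :: "(int ^ 'd) set" where
  "unit_vectors = (\<Union>i. {axis i 1, - axis i 1})"

(* The site lattice is int ^ 'd. As the index type carries no order, the coordinate playing the
   role of the first one is passed as the parameter i1. *)
definition step_weight :: "'d::finite \<Rightarrow> real \<Rightarrow> int ^ 'd \<Rightarrow> real" where
  "step_weight i1 h e =
     (if e \<in> unit_vectors
      then exp (h * of_int (e $ i1)) / (\<Sum>e'\<in>unit_vectors. exp (h * of_int (e' $ i1)))
      else 0)"

definition step_pmf :: "'d::finite \<Rightarrow> real \<Rightarrow> (int ^ 'd) pmf" where
  "step_pmf i1 h = embed_pmf (step_weight i1 h)"

definition partial_sums :: "(nat \<Rightarrow> int ^ 'd) \<Rightarrow> nat \<Rightarrow> int ^ 'd" where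
  "partial_sums X n = (\<Sum>k<n. X k)"

definition walk_law :: "'d::finite \<Rightarrow> real \<Rightarrow> (nat \<Rightarrow> int ^ 'd) measure" where
  "walk_law i1 h =
     distr (\<Pi>\<^sub>M k\<in>UNIV. measure_pmf (step_pmf i1 h)) (\<Pi>\<^sub>M n\<in>UNIV. count_space UNIV) partial_sums"

(* v is a fixed realization of the potential; averaging over the walk alone encodes the
   independence of the walk and the potential. *)
definition quenched_Z :: "'d::finite \<Rightarrow> real \<Rightarrow> real \<Rightarrow> nat \<Rightarrow> (int ^ 'd \<Rightarrow> real) \<Rightarrow> real" where
  "quenched_Z i1 h \<beta> N v = (\<integral>S. exp (- \<beta> * (\<Sum>n=1..N. v (S n))) \<partial>walk_law i1 h)"

definition annealed_Z ::
  "'d::finite \<Rightarrow> real \<Rightarrow> real \<Rightarrow> nat \<Rightarrow> 'a measure \<Rightarrow> (int ^ 'd \<Rightarrow> 'a \<Rightarrow> real) \<Rightarrow> real" where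
  "annealed_Z i1 h \<beta> N M V = (\<integral>\<omega>. quenched_Z i1 h \<beta> N (\<lambda>x. V x \<omega>) \<partial>M)"

definition essinf :: "'a measure \<Rightarrow> ('a \<Rightarrow> real) \<Rightarrow> ereal" where
  "essinf M f = Sup {c. AE \<omega> in M. c \<le> ereal (f \<omega>)}"


lemma finite_unit_vectors: "finite (unit_vectors :: (int ^ 'd::finite) set)"
  by (auto simp: unit_vectors_def)

lemma card_unit_vectors: "card (unit_vectors :: (int ^ 'd::finite) set) = 2 * CARD('d)"
proof -
  have ne: "axis i 1 \<noteq> - (axis j 1 :: int ^ 'd)" for i j
  proof
    assume "axis i 1 = - (axis j 1 :: int ^ 'd)"
    then have "(axis i 1 :: int ^ 'd) $ i = (- axis j 1) $ i" by simp
    then show False by (simp add: axis_def split: if_splits)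
  qed
  have "card (unit_vectors :: (int ^ 'd) set) = (\<Sum>i\<in>(UNIV :: 'd set). card {axis i 1, - axis i (1::int)})"
    unfolding unit_vectors_def
    by (rule card_UN_disjoint) (use ne ne[symmetric] in \<open>auto simp: axis_eq_axis\<close>)
  also have "\<dots> = (\<Sum>i\<in>(UNIV :: 'd set). 2)"
    by (intro sum.cong refl) (use ne in \<open>simp add: card_insert_if\<close>)
  finally show ?thesis by simp
qed

lemma pmf_step: "pmf (step_pmf i1 h) e = step_weight i1 h e"
proof -
  let ?u = "unit_vectors :: (int ^ 'a) set"
  let ?Z = "\<Sum>e'\<in>?u. exp (h * of_int (e' $ i1))"
  have "?u \<noteq> {}" by (auto simp: unit_vectors_def)
  then have Z: "?Z > 0" by (intro sum_pos finite_unit_vectors) auto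
  have nonneg: "step_weight i1 h x \<ge> 0" for x
    using Z by (auto simp: step_weight_def)
  have "(\<integral>\<^sup>+x. ennreal (step_weight i1 h x) \<partial>count_space UNIV) =
        (\<Sum>x\<in>?u. ennreal (step_weight i1 h x))"
    by (rule nn_integral_count_space'[OF finite_unit_vectors]) (auto simp: step_weight_def)
  also have "\<dots> = ennreal (\<Sum>x\<in>?u. step_weight i1 h x)"
    using nonneg by (intro sum_ennreal) auto
  also have "(\<Sum>x\<in>?u. step_weight i1 h x) = (\<Sum>x\<in>?u. exp (h * of_int (x $ i1)) / ?Z)"
    by (intro sum.cong) (auto simp: step_weight_def)
  also have "\<dots> = 1"
    using Z by (simp add: sum_divide_distrib[symmetric])
  finally show ?thesis
    unfolding step_pmf_def using nonneg by (intro pmf_embed_pmf) auto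
qed

lemma measurable_partial_sums:
  "partial_sums \<in> (\<Pi>\<^sub>M k\<in>UNIV. measure_pmf (step_pmf i1 h)) \<rightarrow>\<^sub>M (\<Pi>\<^sub>M n\<in>UNIV. count_space UNIV)"
proof -
  let ?P = "\<Pi>\<^sub>M k\<in>(UNIV::nat set). measure_pmf (step_pmf i1 h)"
  have m: "(\<lambda>X. partial_sums X n) \<in> ?P \<rightarrow>\<^sub>M count_space UNIV" for n
  proof (induction n)
    case 0
    show ?case by (simp add: partial_sums_def)
  next
    case (Suc n)
    have c: "(\<lambda>X. X n) \<in> ?P \<rightarrow>\<^sub>M count_space UNIV"
    proof -
      have "(\<lambda>X. X n) \<in> ?P \<rightarrow>\<^sub>M measure_pmf (step_pmf i1 h)" by (rule measurable_component_singleton) simp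
      then show ?thesis by simp
    qed
    have "(\<lambda>X. partial_sums X n + X n) \<in> ?P \<rightarrow>\<^sub>M count_space UNIV"
      by (rule measurable_compose_countable[where f = "\<lambda>s X. s + X n", OF _ Suc])
         (rule measurable_compose[OF c], simp)
    then show ?case by (simp add: partial_sums_def)
  qed
  show ?thesis
    using m by (intro measurable_PiM_single') (auto simp: space_PiM)
qed

lemma prob_space_walk_law: "prob_space (walk_law i1 h)"
  unfolding walk_law_def
  by (intro prob_space.prob_space_distr measurable_partial_sums prob_space_PiM
        measure_pmf.prob_space_axioms)

lemma quenched_Z_increments:
  "quenched_Z i1 h \<beta> N v =
     (\<integral>X. exp (- \<beta> * (\<Sum>n=1..N. v (\<Sum>k<n. X k))) \<partial>(\<Pi>\<^sub>M k\<in>UNIV. measure_pmf (step_pmf i1 h)))"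
  unfolding quenched_Z_def walk_law_def
proof (subst integral_distr[OF measurable_partial_sums])
  have "(\<lambda>S. v (S n)) \<in> borel_measurable (\<Pi>\<^sub>M n\<in>UNIV. count_space UNIV)" for n :: nat
    by (rule measurable_compose[OF measurable_component_singleton]) auto
  then show "(\<lambda>S. exp (- \<beta> * (\<Sum>n=1..N. v (S n)))) \<in> borel_measurable (\<Pi>\<^sub>M n\<in>UNIV. count_space UNIV)"
    by (intro borel_measurable_exp[THEN measurable_compose[rotated]] borel_measurable_times
          borel_measurable_sum) auto
qed (simp add: partial_sums_def)

end

theory Submission
  imports Defs
begin

text \<open>
  Averaging over the potential turns both moments into sums over words in the unit vectors, in which
  each site \<open>x\<close> visited \<open>k\<close> times contributes the Laplace transform \<open>m k = E exp (- \<beta> k V\<^sub>x)\<close>. Only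
  \<open>exp (- \<epsilon> k) \<le> m k\<close> with \<open>\<epsilon> = \<beta> E V\<^sub>x\<close> (Jensen) and the monotonicity of \<open>m\<close> matter. They bound the weight
  of a pair of words by the product of the two weights times \<open>exp (\<epsilon> O)\<close>, where \<open>O\<close> is the overlap of the
  two multisets of visited sites.

  Cutting a word wherever its past stays weakly below and its future strictly above the current level
  decomposes it into irreducible bridges and two end pieces. The drift makes pieces without cuts
  exponentially unlikely, with a rate that does not depend on \<open>\<beta>\<close>. The weights factorize over the pieces,
  so for a suitable \<open>t \<le> exp \<epsilon>\<close> the weights of the irreducible bridges times \<open>t ^ length\<close> form a
  probability distribution, and the annealed partition function is at least a constant times \<open>t ^ (- N)\<close>
  by a renewal argument.

  For the upper bound, expand \<open>exp (\<epsilon> O)\<close> of two independent sequences of bridges at their meetings. A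
  sequence visits each level at most once, and a positive fraction of the bridges makes independent
  symmetric steps in three directions orthogonal to the drift (this is where \<open>d \<ge> 4\<close> enters), so the
  expected number of meetings is bounded by a multiple of \<open>\<Sum>g. (g + 1) powr (- 3 / 2)\<close>. Hence for small \<open>\<epsilon>\<close> the
  expectation of \<open>exp (\<epsilon> O)\<close> is at most \<open>2\<close>.
\<close>

section \<open>Words and the sites they visit\<close>

text \<open>The obstacle is uniformity: \<open>K\<close> may depend neither on \<open>N\<close> nor
  on \<beta>, while the law of the irreducible bridges changes with \<beta>. So every constant is
  built from the step weights, the tail constants of the plain walk and \<epsilon> \<le> 1, and the
  renewal theorem is replaced by an explicit bound that holds for a whole family of laws.

  The two sequences of bridges are tied to a common total length and are not synchronized in any
  other way. Before a meeting the length constraint is dropped and all prefixes are summed, as in a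
  Green function; the level then plays the part of time. The exponent - 3 / 2 is a local limit
  bound: \<open>g\<close> symmetric signs have a prescribed sum with probability at most (g + 1)
  powr (- 1 / 2), and three directions multiply. Two directions would leave the divergent sum of 1 /
  (g + 1).

  A meeting carries a factor exp (\<epsilon> * length) - 1, which is of order \<epsilon>. With a
  bounded expected number of meetings, the expectation x of the exponential satisfies x \<le> 1 + x
  / 2 for small \<epsilon>, whence the bound 2.\<close>

definition words :: "nat \<Rightarrow> (int ^ 'd::finite) list set" where
  "words n = {w. set w \<subseteq> unit_vectors \<and> length w = n}"

lemma finite_words: "finite (words n)"
  unfolding words_def by (rule finite_lists_length_eq[OF finite_unit_vectors])

lemma words_0 [simp]: "words 0 = {[]}"
  by (auto simp: words_def)

lemma sum_words_Suc:
  "sum f (words (Suc n)) = (\<Sum>e\<in>unit_vectors. \<Sum>w\<in>words n. f (e # w))"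
proof -
  have eq: "words (Suc n) = (\<lambda>(e, w). e # w) ` (unit_vectors \<times> words n)"
    by (auto simp: words_def image_iff length_Suc_conv)
  show ?thesis
    unfolding eq by (subst sum.reindex) (auto simp: inj_on_def sum.cartesian_product intro: sum.cong)
qed

text \<open>The starting point is not counted as visited, in accordance with the Hamiltonian, which starts at time \<open>1\<close>.\<close>

primrec sites :: "'a::ab_group_add list \<Rightarrow> 'a multiset" where
  "sites [] = {#}"
| "sites (e # w) = add_mset e (image_mset ((+) e) (sites w))"

lemma size_sites [simp]: "size (sites w) = length w"
  by (induction w) auto

lemma sum_list_in_sites: "w \<noteq> [] \<Longrightarrow> sum_list w \<in># sites w"
proof (induction w)
  case (Cons e w)
  then show ?case by (cases "w = []") auto
qed simp

section \<open>Translation of multisets of sites\<close>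

definition translate :: "'a::ab_group_add \<Rightarrow> 'a multiset \<Rightarrow> 'a multiset" where
  "translate y A = image_mset ((+) y) A"

lemma translate_simps [simp]:
  "translate y {#} = {#}" "translate y (add_mset x A) = add_mset (y + x) (translate y A)"
  "translate y (A + B) = translate y A + translate y B"
  "size (translate y A) = size A"
  by (auto simp: translate_def multiset.map_comp o_def add.assoc)

lemma translate_translate [simp]: "translate x (translate y A) = translate (x + y) A"
  by (induction A) (auto simp: add.assoc)

lemma translate_0 [simp]: "translate 0 A = A"
  by (induction A) auto

lemma set_translate [simp]: "set_mset (translate y A) = (+) y ` set_mset A"
  by (simp add: translate_def)

lemma count_translate: "count (translate y A) x = count A (x - y)"
  by (induction A) auto

lemma size_translate_inter: "size (translate y A \<inter># translate z B) = size (A \<inter># translate (z - y) B)"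
proof -
  have "translate y A \<inter># translate z B = translate y (A \<inter># translate (z - y) B)"
    by (rule multiset_eqI) (simp add: count_translate algebra_simps)
  then show ?thesis by simp
qed

lemma sites_append: "sites (u @ v) = sites u + translate (sum_list u) (sites v)"
  by (induction u) (simp_all flip: translate_def)

lemma size_add_inter_le: "size ((A + B) \<inter># C) \<le> size (A \<inter># C) + size (B \<inter># C)"
proof -
  have "(A + B) \<inter># C \<subseteq># (A \<inter># C) + (B \<inter># C)"
    by (rule mset_subset_eqI) simp
  then show ?thesis using size_mset_mono by fastforce
qed

lemma size_inter_le: "size (A \<inter># B) \<le> size A" "size (A \<inter># B) \<le> size B"
  by (auto intro: size_mset_mono)

lemma size_inter_add_le: "size (C \<inter># (A + B)) \<le> size (C \<inter># A) + size (C \<inter># B)"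
  using size_add_inter_le[of A B C] by (metis subset_mset.inf_commute)

section \<open>Product weights of multisets of sites\<close>

definition site_weight :: "(nat \<Rightarrow> real) \<Rightarrow> 'a multiset \<Rightarrow> real" where
  "site_weight m A = (\<Prod>x\<in>set_mset A. m (count A x))"

lemma site_weight_superset:
  assumes "m 0 = 1" "finite F" "set_mset A \<subseteq> F"
  shows "site_weight m A = (\<Prod>x\<in>F. m (count A x))"
  unfolding site_weight_def
  using assms by (intro prod.mono_neutral_left) (auto simp: not_in_iff)

lemma site_weight_translate [simp]: "site_weight m (translate y A) = site_weight m A"
  unfolding site_weight_def
  by (simp add: prod.reindex count_translate)

lemma site_weight_add_disjoint:
  assumes "m 0 = 1" "set_mset A \<inter> set_mset B = {}"
  shows "site_weight m (A + B) = site_weight m A * site_weight m B"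
proof -
  have "site_weight m (A + B) = (\<Prod>x\<in>set_mset A. m (count (A + B) x)) * (\<Prod>x\<in>set_mset B. m (count (A + B) x))"
    unfolding site_weight_def set_mset_union using assms(2) by (intro prod.union_disjoint) auto
  also have "(\<Prod>x\<in>set_mset A. m (count (A + B) x)) = site_weight m A"
    unfolding site_weight_def using assms(2) by (intro prod.cong refl arg_cong[of _ _ m]) (force simp: count_eq_zero_iff)
  also have "(\<Prod>x\<in>set_mset B. m (count (A + B) x)) = site_weight m B"
    unfolding site_weight_def using assms(2) by (intro prod.cong refl arg_cong[of _ _ m]) (force simp: count_eq_zero_iff)
  finally show ?thesis .
qed

lemma size_eq_sum_superset:
  "finite F \<Longrightarrow> set_mset A \<subseteq> F \<Longrightarrow> size A = (\<Sum>x\<in>F. count A x)"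
  unfolding size_multiset_overloaded_eq
  by (intro sum.mono_neutral_left) (auto simp: not_in_iff)

locale site_interaction =
  fixes m :: "nat \<Rightarrow> real" and \<epsilon> :: real
  assumes m_0: "m 0 = 1"
    and m_antimono: "j \<le> k \<Longrightarrow> m k \<le> m j"
    and m_lower: "exp (- \<epsilon> * real k) \<le> m k"
begin

lemma m_pos: "0 < m k"
  using m_lower[of k] by (rule less_le_trans[rotated]) simp

lemma m_le_1: "m k \<le> 1"
  using m_antimono[of 0 k] m_0 by simp

lemma site_weight_pos: "0 < site_weight m A"
  unfolding site_weight_def by (intro prod_pos) (simp add: m_pos)

lemma site_weight_le_1: "site_weight m A \<le> 1"
  unfolding site_weight_def by (intro prod_le_1) (simp add: m_le_1 m_pos less_imp_le)

lemma site_weight_lower: "exp (- \<epsilon> * real (size A)) \<le> site_weight m A"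
proof -
  have "exp (- \<epsilon> * real (size A)) = (\<Prod>x\<in>set_mset A. exp (- \<epsilon> * real (count A x)))"
    by (simp add: size_multiset_overloaded_eq sum_distrib_left flip: exp_sum)
  also have "\<dots> \<le> site_weight m A"
    unfolding site_weight_def by (intro prod_mono) (use m_lower in auto)
  finally show ?thesis .
qed

text \<open>By monotonicity the smaller of the two visit counts is forgotten; putting its factor
  back costs at most exp (\<epsilon> * j) by \<open>m_lower\<close>. The minimum matters because
  over all sites it sums to the size of the intersection of the multisets.\<close>

lemma m_add_le: "m (j + k) \<le> m j * m k * exp (\<epsilon> * real (min j k))"
proof -
  have *: "m (j + k) \<le> m j * m k * exp (\<epsilon> * real j)" if "j \<le> k" for j k
  proof -
    have "m (j + k) \<le> m k" by (intro m_antimono) simp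
    moreover have "1 \<le> m j * exp (\<epsilon> * real j)"
    proof -
      have "exp (- \<epsilon> * real j) * exp (\<epsilon> * real j) \<le> m j * exp (\<epsilon> * real j)"
        by (intro mult_right_mono m_lower) simp
      then show ?thesis by (simp flip: exp_add)
    qed
    then have "m k * 1 \<le> m k * (m j * exp (\<epsilon> * real j))"
      by (intro mult_left_mono) (use m_pos[of k] in auto)
    ultimately show ?thesis by (simp add: mult.assoc mult.left_commute)
  qed
  show ?thesis
    using *[of j k] *[of k j] by (cases "j \<le> k") (auto simp: min_def add.commute mult.commute)
qed

lemma site_weight_add_le:
  "site_weight m (A + B) \<le> site_weight m A * site_weight m B * exp (\<epsilon> * real (size (A \<inter># B)))"
proof -
  let ?F = "set_mset (A + B)"
  have "site_weight m (A + B) \<le>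
      (\<Prod>x\<in>?F. m (count A x) * m (count B x) * exp (\<epsilon> * real (min (count A x) (count B x))))"
    unfolding site_weight_def
    by (intro prod_mono) (use m_add_le m_pos in \<open>auto intro: less_imp_le\<close>)
  also have "\<dots> = (\<Prod>x\<in>?F. m (count A x)) * (\<Prod>x\<in>?F. m (count B x))
      * exp (\<epsilon> * real (\<Sum>x\<in>?F. count (A \<inter># B) x))"
    by (simp add: prod.distrib sum_distrib_left flip: exp_sum)
  also have "\<dots> = site_weight m A * site_weight m B * exp (\<epsilon> * real (size (A \<inter># B)))"
    using site_weight_superset[of m ?F A] site_weight_superset[of m ?F B]
      size_eq_sum_superset[of ?F "A \<inter># B"] m_0 by (simp add: le_infI1)
  finally show ?thesis .
qed

end

section \<open>Cuts and bridges\<close>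

text \<open>
  A cut of \<open>u @ v\<close> after \<open>u\<close> means \<open>below_end u\<close> (including the starting point, hence \<open>0 \<le> sum_list u $ i\<close>)
  and \<open>stays_above v\<close>.
\<close>

definition below_end :: "'d::finite \<Rightarrow> (int ^ 'd) list \<Rightarrow> bool" where
  "below_end i w \<longleftrightarrow> 0 \<le> sum_list w $ i \<and> (\<forall>x\<in>#sites w. x $ i \<le> sum_list w $ i)"

definition stays_above :: "'d::finite \<Rightarrow> (int ^ 'd) list \<Rightarrow> bool" where
  "stays_above i w \<longleftrightarrow> (\<forall>x\<in>#sites w. 0 < x $ i)"

definition no_cut :: "'d::finite \<Rightarrow> (int ^ 'd) list \<Rightarrow> bool" where
  "no_cut i w \<longleftrightarrow> (\<forall>u v. w = u @ v \<longrightarrow> u \<noteq> [] \<longrightarrow> v \<noteq> [] \<longrightarrow> below_end i u \<longrightarrow> \<not> stays_above i v)"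

definition irred_bridge :: "'d::finite \<Rightarrow> (int ^ 'd) list \<Rightarrow> bool" where
  "irred_bridge i b \<longleftrightarrow> b \<noteq> [] \<and> stays_above i b \<and> below_end i b \<and> no_cut i b"

lemma stays_above_Nil [simp]: "stays_above i []"
  by (simp add: stays_above_def)

lemma no_cut_Nil [simp]: "no_cut i []"
  by (simp add: no_cut_def)

lemma below_end_Nil [simp]: "below_end i []"
  by (simp add: below_end_def)

lemma stays_above_append: "stays_above i u \<Longrightarrow> stays_above i v \<Longrightarrow> stays_above i (u @ v)"
  using sum_list_in_sites[of u] by (cases "u = []") (auto simp: stays_above_def sites_append intro!: add_pos_pos)

lemma stays_above_prefix: "stays_above i (u @ v) \<Longrightarrow> stays_above i u"
  by (simp add: stays_above_def sites_append)

lemma stays_above_sum_list: "stays_above i w \<Longrightarrow> w \<noteq> [] \<Longrightarrow> 0 < sum_list w $ i"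
  using sum_list_in_sites[of w] by (auto simp: stays_above_def)

lemma below_end_append: "below_end i u \<Longrightarrow> below_end i v \<Longrightarrow> below_end i (u @ v)"
  by (auto simp: below_end_def sites_append intro: order_trans)

text \<open>Levels up to the cut belong to the past, levels strictly above it to the future. The
  weak and the strict inequality in the two notions are paired for this.\<close>

lemma sites_append_disjoint:
  "below_end i u \<Longrightarrow> stays_above i v \<Longrightarrow> set_mset (sites u) \<inter> set_mset (translate (sum_list u) (sites v)) = {}"
  by (auto simp: below_end_def stays_above_def)
     (metis add_le_same_cancel1 not_le vector_add_component)

lemma irred_concat:
  assumes "\<forall>b\<in>set bs. irred_bridge i b"
  shows "stays_above i (concat bs)" "below_end i (concat bs)"
  using assms by (induction bs) (auto simp: irred_bridge_def intro: stays_above_append below_end_append)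

text \<open>A cut inside \<open>u\<close> would be a shorter cut of \<open>w\<close>, because the
  rest of \<open>u\<close> followed by \<open>v\<close> still stays above.\<close>

lemma shortest_cut:
  assumes "\<not> no_cut i w"
  obtains u v where "w = u @ v" "u \<noteq> []" "v \<noteq> []" "below_end i u" "stays_above i v" "no_cut i u"
proof -
  define P where "P = (\<lambda>n. \<exists>u v. w = u @ v \<and> u \<noteq> [] \<and> v \<noteq> [] \<and> below_end i u \<and> stays_above i v \<and> length u = n)"
  have "\<exists>n. P n" using assms by (auto simp: no_cut_def P_def)
  then have "P (LEAST n. P n)" by (meson LeastI_ex)
  then obtain u v where uv: "w = u @ v" "u \<noteq> []" "v \<noteq> []" "below_end i u" "stays_above i v"
    "length u = (LEAST n. P n)" by (auto simp: P_def)
  have "no_cut i u"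
    unfolding no_cut_def
  proof (intro allI impI notI)
    fix u1 u2
    assume u: "u = u1 @ u2" "u1 \<noteq> []" "u2 \<noteq> []" "below_end i u1" "stays_above i u2"
    have "P (length u1)"
      unfolding P_def using u uv(1-5)
      by (intro exI[of _ u1] exI[of _ "u2 @ v"]) (simp add: stays_above_append)
    moreover have "length u1 < (LEAST n. P n)" using u uv(6)[symmetric] by simp
    ultimately show False using not_less_Least by blast
  qed
  then show thesis using that[OF uv(1-5)] by blast
qed

text \<open>Peel off the piece before the shortest cut repeatedly. This piece is a bridge because,
  as a prefix, it inherits \<open>stays_above\<close>.\<close>

lemma stays_above_decomp:
  "stays_above i w \<Longrightarrow> \<exists>bs v. w = concat bs @ v \<and> (\<forall>b\<in>set bs. irred_bridge i b) \<and> stays_above i v \<and> no_cut i v"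
proof (induction "length w" arbitrary: w rule: less_induct)
  case less
  show ?case
  proof (cases "no_cut i w")
    case True
    with less.prems show ?thesis by (intro exI[of _ "[]"] exI[of _ w]) auto
  next
    case False
    then obtain b v where b: "w = b @ v" "b \<noteq> []" "v \<noteq> []" "below_end i b" "stays_above i v" "no_cut i b"
      by (rule shortest_cut)
    then obtain bs v' where v: "v = concat bs @ v'" "\<forall>b\<in>set bs. irred_bridge i b" "stays_above i v'" "no_cut i v'"
      using less.hyps[of v] by auto
    have "irred_bridge i b"
      using b less.prems stays_above_prefix by (auto simp: irred_bridge_def)
    then show ?thesis
      using b v by (intro exI[of _ "b # bs"] exI[of _ v']) auto
  qed
qed

text \<open>If there is no cut, the whole word becomes \<open>u\<close>, and it need not end at its
  maximum. Therefore disjointness of sites is recorded instead of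
  \<open>below_end i u\<close>.\<close>

lemma cut_decomp:
  "\<exists>u bs v. w = u @ concat bs @ v \<and> no_cut i u \<and> (\<forall>b\<in>set bs. irred_bridge i b) \<and> no_cut i v \<and>
     (set_mset (sites u) \<inter> set_mset (translate (sum_list u) (sites (concat bs @ v))) = {}) \<and> stays_above i v"
proof (cases "no_cut i w")
  case True
  then show ?thesis by (intro exI[of _ w] exI[of _ "[]"]) auto
next
  case False
  then obtain u v where u: "w = u @ v" "below_end i u" "stays_above i v" "no_cut i u"
    by (rule shortest_cut)
  then obtain bs v' where "v = concat bs @ v'" "\<forall>b\<in>set bs. irred_bridge i b" "stays_above i v'" "no_cut i v'"
    using stays_above_decomp by blast
  then show ?thesis
    using u sites_append_disjoint[OF u(2,3)]
    by (intro exI[of _ u] exI[of _ bs] exI[of _ v']) (simp add: sites_append)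
qed

text \<open>If \<open>b\<close> were a proper prefix of \<open>b'\<close>, the rest of
  \<open>b'\<close> would be a prefix of \<open>r\<close> and stay above, so \<open>b'\<close> would
  have a cut after \<open>b\<close>.\<close>

lemma irred_prefix_eq:
  assumes "irred_bridge i b" "irred_bridge i b'" "stays_above i r" "b @ r = b' @ r'" "length b \<le> length b'"
  shows "b = b'"
proof -
  obtain s where s: "b' = b @ s" "r = s @ r'"
    using assms(4,5) by (metis append_eq_append_conv_if append_eq_conv_conj append_take_drop_id le_iff_add)
  have "stays_above i s" using assms(3) s stays_above_prefix by auto
  moreover have "no_cut i b'" "b \<noteq> []" "below_end i b"
    using assms(1,2) by (auto simp: irred_bridge_def)
  ultimately have "s = []"
    using s(1) unfolding no_cut_def by blast
  then show ?thesis using s by simp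
qed

text \<open>Irreducible bridges form a uniquely readable code. This allows sums over sequences of
  bridges to be read as sums over words.\<close>

lemma inj_on_concat_irred: "inj_on concat {bs. \<forall>b\<in>set bs. irred_bridge i b}"
proof (rule inj_onI)
  fix bs cs :: "(int ^ 'a) list list"
  assume "bs \<in> {bs. \<forall>b\<in>set bs. irred_bridge i b}" "cs \<in> {bs. \<forall>b\<in>set bs. irred_bridge i b}"
    "concat bs = concat cs"
  then show "bs = cs"
  proof (induction bs arbitrary: cs)
    case Nil
    then have "\<forall>c\<in>set cs. c = []" "\<forall>c\<in>set cs. irred_bridge i c" by simp_all
    moreover have "\<not> irred_bridge i []" by (simp add: irred_bridge_def)
    ultimately show ?case by (cases cs) auto
  next
    case (Cons b bs)
    have b: "irred_bridge i b" "b \<noteq> []" "\<forall>b\<in>set bs. irred_bridge i b"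
      using Cons.prems(1) by (simp_all add: irred_bridge_def)
    then obtain c cs' where cs: "cs = c # cs'"
      using Cons.prems(3) by (cases cs) simp_all
    have c: "irred_bridge i c" "\<forall>b\<in>set cs'. irred_bridge i b" "b @ concat bs = c @ concat cs'"
      using Cons.prems(2,3) by (simp_all add: cs)
    note * = b(1) c(1) irred_concat(1)[OF b(3)] irred_concat(1)[OF c(2)] c(3)
    have "b = c"
    proof (cases "length b \<le> length c")
      case True
      show ?thesis by (rule irred_prefix_eq[OF *(1,2,3,5) True])
    next
      case False
      then show ?thesis using irred_prefix_eq[OF *(2,1,4) *(5)[symmetric]] by simp
    qed
    moreover have "bs = cs'"
      using b(3) c(2,3) \<open>b = c\<close> by (intro Cons.IH) simp_all
    ultimately show ?case by (simp add: cs)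
  qed
qed

context site_interaction
begin

lemma site_weight_append:
  "below_end i u \<Longrightarrow> stays_above i v \<Longrightarrow>
     site_weight m (sites (u @ v)) = site_weight m (sites u) * site_weight m (sites v)"
  unfolding sites_append
  by (subst site_weight_add_disjoint[of m, OF m_0 sites_append_disjoint]) simp_all

lemma site_weight_concat:
  assumes "\<forall>b\<in>set bs. irred_bridge i b" "stays_above i v"
  shows "site_weight m (sites (concat bs @ v)) =
    (\<Prod>b\<leftarrow>bs. site_weight m (sites b)) * site_weight m (sites v)"
  using assms
proof (induction bs)
  case (Cons b bs)
  have "site_weight m (sites (b @ concat bs @ v)) = site_weight m (sites b) * site_weight m (sites (concat bs @ v))"
    using Cons.prems irred_concat(1)[of bs i]
    by (intro site_weight_append) (auto simp: irred_bridge_def intro: stays_above_append)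
  with Cons show ?case by simp
qed simp

end

section \<open>Exponential tail of words without cuts\<close>

definition word_weight :: "'d::finite \<Rightarrow> real \<Rightarrow> (int ^ 'd) list \<Rightarrow> real" where
  "word_weight i h w = (\<Prod>e\<leftarrow>w. step_weight i h e)"

text \<open>The probability that the first \<open>n\<close> increments of the walk satisfy
  \<open>P\<close>.\<close>

definition word_mass :: "'d::finite \<Rightarrow> real \<Rightarrow> nat \<Rightarrow> ((int ^ 'd) list \<Rightarrow> bool) \<Rightarrow> real" where
  "word_mass i h n P = (\<Sum>w\<in>words n. word_weight i h w * of_bool (P w))"

lemma sum_unit_vectors:
  fixes g :: "int ^ 'd::finite \<Rightarrow> real"
  shows "sum g unit_vectors = (\<Sum>j\<in>UNIV. g (axis j 1) + g (- axis j 1))"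
proof -
  have ne: "axis i 1 \<noteq> - (axis j 1 :: int ^ 'd)" for i j
  proof
    assume "axis i 1 = - (axis j 1 :: int ^ 'd)"
    then have "(axis i 1 :: int ^ 'd) $ i = (- axis j 1) $ i" by simp
    then show False by (simp add: axis_def split: if_splits)
  qed
  have "sum g unit_vectors = (\<Sum>j\<in>UNIV. sum g {axis j 1, - axis j 1})"
    unfolding unit_vectors_def
    by (rule sum.UNION_disjoint) (use ne ne[symmetric] in \<open>auto simp: axis_eq_axis\<close>)
  also have "\<dots> = (\<Sum>j\<in>UNIV. g (axis j 1) + g (- axis j 1))"
    by (intro sum.cong refl) (use ne in auto)
  finally show ?thesis .
qed

lemma sum_unit_vectors_level:
  fixes F :: "int \<Rightarrow> real" and i :: "'d::finite"
  shows "(\<Sum>e\<in>unit_vectors. F (e $ i)) = F 1 + F (- 1) + 2 * (real CARD('d) - 1) * F 0"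
proof -
  have "(\<Sum>e\<in>unit_vectors. F (e $ i)) = (\<Sum>j\<in>UNIV. F (axis j 1 $ i) + F (- (axis j 1 $ i)))"
    by (simp add: sum_unit_vectors)
  also have "\<dots> = (F 1 + F (- 1)) + (\<Sum>j\<in>UNIV - {i}. F (axis j 1 $ i) + F (- (axis j 1 $ i)))"
    by (subst sum.remove[of _ i]) (auto simp: axis_def)
  also have "(\<Sum>j\<in>UNIV - {i}. F (axis j 1 $ i) + F (- (axis j 1 $ i))) = (\<Sum>j\<in>UNIV - {i}. 2 * F 0)"
    by (intro sum.cong) (auto simp: axis_def)
  also have "\<dots> = 2 * (real CARD('d) - 1) * F 0"
    by (simp add: card_Diff_subset of_nat_diff)
  finally show ?thesis by simp
qed

lemma step_normalizer:
  fixes i :: "'d::finite"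
  shows "(\<Sum>e\<in>unit_vectors. exp (h * of_int (e $ i))) = exp h + exp (- h) + 2 * (real CARD('d) - 1)"
  using sum_unit_vectors_level[of "\<lambda>l. exp (h * of_int l)" i] by simp

lemma step_normalizer_pos: "0 < exp h + exp (- h) + 2 * (real CARD('d::finite) - 1)"
proof -
  have "1 \<le> real CARD('d)" by (simp add: Suc_leI)
  then show ?thesis by (intro add_pos_nonneg add_pos_pos) auto
qed

lemma step_weight_eq:
  fixes i :: "'d::finite"
  shows "step_weight i h e =
    (if e \<in> unit_vectors then exp (h * of_int (e $ i)) / (exp h + exp (- h) + 2 * (real CARD('d) - 1)) else 0)"
  by (simp add: step_weight_def step_normalizer)

lemma step_weight_nonneg: "0 \<le> step_weight i h e"
  unfolding step_weight_eq using step_normalizer_pos[of h, where 'd = 'a] by simp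

lemma sum_step_weight_level:
  fixes F :: "int \<Rightarrow> real" and i :: "'d::finite"
  shows "(\<Sum>e\<in>unit_vectors. step_weight i h e * F (e $ i)) =
    (exp h * F 1 + exp (- h) * F (- 1) + 2 * (real CARD('d) - 1) * F 0) /
      (exp h + exp (- h) + 2 * (real CARD('d) - 1))"
  using sum_unit_vectors_level[of "\<lambda>l. exp (h * of_int l) * F l" i]
  by (simp add: step_weight_eq flip: sum_divide_distrib)

lemma sum_step_weight: "(\<Sum>e\<in>unit_vectors. step_weight i h e) = 1"
  using sum_step_weight_level[of i h "\<lambda>_. 1"] step_normalizer_pos[of h, where 'd = 'a] by simp

lemma word_weight_simps [simp]:
  "word_weight i h [] = 1" "word_weight i h (e # w) = step_weight i h e * word_weight i h w"
  "word_weight i h (u @ v) = word_weight i h u * word_weight i h v"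
  by (auto simp: word_weight_def)

lemma word_weight_nonneg: "0 \<le> word_weight i h w"
  by (induction w) (auto simp: step_weight_nonneg)

lemma sum_word_weight: "(\<Sum>w\<in>words n. word_weight i h w) = 1"
  by (induction n) (auto simp: sum_words_Suc sum_step_weight simp flip: sum_distrib_left)

lemma word_mass_0: "word_mass i h 0 P = of_bool (P [])"
  by (simp add: word_mass_def)

lemma word_mass_Suc:
  "word_mass i h (Suc n) P = (\<Sum>e\<in>unit_vectors. step_weight i h e * word_mass i h n (\<lambda>w. P (e # w)))"
  by (simp add: word_mass_def sum_words_Suc sum_distrib_left mult.assoc)

lemma word_mass_mono: "(\<And>w. P w \<Longrightarrow> Q w) \<Longrightarrow> word_mass i h n P \<le> word_mass i h n Q"
  unfolding word_mass_def by (intro sum_mono mult_left_mono) (auto simp: word_weight_nonneg)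

lemma word_mass_nonneg: "0 \<le> word_mass i h n P"
  unfolding word_mass_def by (intro sum_nonneg) (simp add: word_weight_nonneg)

lemma word_mass_le_1: "word_mass i h n P \<le> 1"
  using word_mass_mono[of P "\<lambda>_. True" i h n] by (simp add: word_mass_def sum_word_weight)

section \<open>Surviving without a cut: trials at running maxima\<close>

lemma unit_vectors_level: "e \<in> unit_vectors \<Longrightarrow> e $ i \<in> {1, 0, - 1}"
  by (auto simp: unit_vectors_def axis_def)

text \<open>The requirement on the rest of a word after a prefix has been read: \<open>k\<close> is
  the distance from the current height up to the maximum of the prefix. The current time itself may
  be a cut, so \<open>u\<close> may be empty here.\<close>

definition no_cut_above :: "'d::finite \<Rightarrow> int \<Rightarrow> (int ^ 'd) list \<Rightarrow> bool" where
  "no_cut_above i k w \<longleftrightarrow>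
     (\<forall>u v. w = u @ v \<longrightarrow> v \<noteq> [] \<longrightarrow> below_end i u \<longrightarrow> k \<le> sum_list u $ i \<longrightarrow> \<not> stays_above i v)"

lemma no_cut_above_Cons:
  assumes "no_cut_above i k (e # w)" "0 \<le> k" "k - e $ i \<le> k'"
  shows "no_cut_above i k' w"
  unfolding no_cut_above_def
proof (intro allI impI notI)
  fix u v
  assume uv: "w = u @ v" "v \<noteq> []" "below_end i u" "k' \<le> sum_list u $ i" "stays_above i v"
  have "below_end i (e # u)" "k \<le> sum_list (e # u) $ i"
    using uv(3,4) assms(2,3) by (auto simp: below_end_def)
  then show False
    using assms(1) uv(1,2,5) unfolding no_cut_above_def by (metis append_Cons)
qed

text \<open>A first step down leaves the starting point one level above the walk, hence the
  threshold 1; for the other steps it is merely generous.\<close>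

lemma no_cut_imp_no_cut_above:
  assumes "no_cut i (e # w)" "e \<in> unit_vectors"
  shows "no_cut_above i 1 w"
  unfolding no_cut_above_def
proof (intro allI impI notI)
  fix u v
  assume uv: "w = u @ v" "v \<noteq> []" "below_end i u" "1 \<le> sum_list u $ i" "stays_above i v"
  have "below_end i (e # u)"
    using uv(3,4) unit_vectors_level[OF assms(2), of i] by (auto simp: below_end_def)
  then show False
    using assms(1) uv(1,2,5) unfolding no_cut_def by (metis append_Cons list.distinct(1))
qed

text \<open>\<open>y\<close> is the current height above the start of the running trial and
  \<open>m\<close> the maximum above that start so far. The first conjunct is the later return to
  the starting level, which ruins the candidate cut.\<close>

definition failing_trial :: "'d::finite \<Rightarrow> nat \<Rightarrow> nat \<Rightarrow> (int ^ 'd) list \<Rightarrow> bool" where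
  "failing_trial i y m w \<longleftrightarrow> (\<exists>x\<in>#sites w. x $ i \<le> - int y) \<and> no_cut_above i (int m - int y) w"

lemma sites_Cons_level:
  "x \<in># sites (e # w) \<Longrightarrow> x $ i = e $ i \<or> (\<exists>x'\<in>#sites w. x $ i = e $ i + x' $ i)"
  by auto

text \<open>The current time lies at the maximum and must not be a cut, so the walk returns to its
  level. A step up cannot be that return.\<close>

lemma failing_trial_start:
  assumes "no_cut_above i 0 (e # w)" "e $ i = 1"
  shows "failing_trial i 1 1 w"
proof -
  have "\<not> stays_above i (e # w)"
    using assms(1) unfolding no_cut_above_def by (auto dest: spec[of _ "[]"])
  then obtain x where x: "x \<in># sites (e # w)" "x $ i \<le> 0"
    unfolding stays_above_def by (meson not_le)
  then obtain x' where "x' \<in># sites w" "x $ i = e $ i + x' $ i"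
    using sites_Cons_level[OF x(1), of i] assms(2) by auto
  moreover have "no_cut_above i 0 w"
    using no_cut_above_Cons[OF assms(1), of 0] assms(2) by simp
  ultimately show ?thesis
    using x(2) assms(2) unfolding failing_trial_def by (intro conjI bexI[of _ x']) simp_all
qed

lemma failing_trial_step:
  assumes "failing_trial i y m (e # w)" "1 \<le> y" "y \<le> m" "int y' = int y + e $ i" "1 \<le> y'" "m \<le> m'" "y' \<le> m'"
  shows "failing_trial i y' m' w"
proof -
  obtain x where x: "x \<in># sites (e # w)" "x $ i \<le> - int y"
    using assms(1) unfolding failing_trial_def by blast
  then obtain x' where "x' \<in># sites w" "x $ i = e $ i + x' $ i"
    using sites_Cons_level[OF x(1), of i] assms(4,5) by auto
  moreover have "no_cut_above i (int m - int y) (e # w)"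
    using assms(1) by (simp add: failing_trial_def)
  then have "no_cut_above i (int m' - int y') w"
    by (rule no_cut_above_Cons) (use assms in linarith)+
  ultimately show ?thesis
    using x(2) assms(4) unfolding failing_trial_def by (intro conjI bexI[of _ x']) simp_all
qed

text \<open>The trial ends with the return to its starting level, which lies \<open>m\<close> below
  the maximum.\<close>

lemma failing_trial_end:
  assumes "failing_trial i 1 m (e # w)" "1 \<le> m" "e $ i = - 1"
  shows "no_cut_above i (int m) w"
proof -
  have "no_cut_above i (int m - int 1) (e # w)"
    using assms(1) unfolding failing_trial_def by blast
  then show ?thesis
    by (rule no_cut_above_Cons) (use assms in simp_all)
qed

text \<open>The supermartingale argument for one step: a step enters only through its level, and the
  second assumption is the drift inequality for the bounds \<open>U\<close>.\<close>

lemma word_mass_Suc_le: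
  fixes i :: "'d::finite"
  assumes "\<And>e. e \<in> unit_vectors \<Longrightarrow> word_mass i h n (\<lambda>w. P (e # w)) \<le> U (e $ i) / s ^ n"
    and "s * (exp h * U 1 + exp (- h) * U (- 1) + 2 * (real CARD('d) - 1) * U 0) \<le>
      c * (exp h + exp (- h) + 2 * (real CARD('d) - 1))" "0 < s"
  shows "word_mass i h (Suc n) P \<le> c / s ^ Suc n"
proof -
  let ?D = "exp h + exp (- h) + 2 * (real CARD('d) - 1)"
  have "word_mass i h (Suc n) P \<le> (\<Sum>e\<in>unit_vectors. step_weight i h e * (U (e $ i) / s ^ n))"
    unfolding word_mass_Suc by (intro sum_mono mult_left_mono assms step_weight_nonneg)
  also have "\<dots> = (exp h * U 1 + exp (- h) * U (- 1) + 2 * (real CARD('d) - 1) * U 0) / ?D / s ^ n"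
    by (simp only: times_divide_eq_right sum_divide_distrib[symmetric] sum_step_weight_level)
  also have "\<dots> \<le> (c / s) / s ^ n"
    using assms(2,3) step_normalizer_pos[of h, where 'd = 'd]
    by (intro divide_right_mono) (auto simp: field_simps)
  finally show ?thesis by simp
qed

text \<open>
  A time at which the walk attains its previous maximum starts a trial, which succeeds if the walk stays
  above the level of the trial ever after. In a trial begun \<open>y\<close> below the current height and with maximum
  \<open>m\<close> above its start, \<open>\<gamma> ^ m * exp (- h) ^ y\<close> is a supermartingale even after multiplication by
  powers of \<open>s\<close>; between trials \<open>\<gamma> ^ k\<close> plays this role, \<open>k\<close> being the distance to the maximum.
\<close>

lemma trial_bounds:
  fixes i :: "'d::finite" and h :: real
  defines "D \<equiv> exp h + exp (- h) + 2 * (real CARD('d) - 1)"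
  assumes l: "1 \<le> \<gamma>" "\<gamma> \<le> exp h" and s: "0 < s"
    and trial: "s * (\<gamma> + 1 + 2 * (real CARD('d) - 1)) \<le> D"
    and gap: "s * (exp h / \<gamma> + exp (- h) * \<gamma> + 2 * (real CARD('d) - 1)) \<le> D"
  shows "word_mass i h n (no_cut_above i (int k)) \<le> \<gamma> ^ k / s ^ n"
    and "1 \<le> y \<Longrightarrow> y \<le> m \<Longrightarrow> word_mass i h n (failing_trial i y m) \<le> \<gamma> ^ m * exp (- h) ^ y / s ^ n"
proof (induction n arbitrary: k y m)
  case 0
  {
    case 1
    show ?case using l(1) by (auto simp: word_mass_0)
  next
    case 2
    show ?case using l(1) by (simp add: word_mass_0 failing_trial_def)
  }
next
  case (Suc n)
  have l0: "0 < \<gamma>" using l by simp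
  {
    case (1 k)
    show ?case
    proof (cases k)
      case 0
      \<comment> \<open>At the maximum a step up opens a trial with \<open>y = m = 1\<close>, a flat
        step changes nothing, and a step down creates the distance 1.\<close>
      define U where "U = (\<lambda>l::int. if l = 1 then \<gamma> * exp (- h) else if l = 0 then 1 else \<gamma>)"
      show ?thesis
      proof (rule word_mass_Suc_le[where U = U])
        fix e :: "int ^ 'd"
        assume e: "e \<in> unit_vectors"
        consider "e $ i = 1" | "e $ i = 0" | "e $ i = - 1"
          using unit_vectors_level[OF e, of i] by auto
        then show "word_mass i h n (\<lambda>w. no_cut_above i (int k) (e # w)) \<le> U (e $ i) / s ^ n"
        proof cases
          case 1
          have "word_mass i h n (\<lambda>w. no_cut_above i (int k) (e # w)) \<le> word_mass i h n (failing_trial i 1 1)"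
            using 1 0 by (intro word_mass_mono failing_trial_start) auto
          also have "\<dots> \<le> U (e $ i) / s ^ n" using Suc.IH(2)[of 1 1] 1 by (simp add: U_def)
          finally show ?thesis .
        next
          case 2
          have "word_mass i h n (\<lambda>w. no_cut_above i (int k) (e # w)) \<le> word_mass i h n (no_cut_above i (int 0))"
            using 2 0 by (intro word_mass_mono) (auto intro: no_cut_above_Cons)
          also have "\<dots> \<le> U (e $ i) / s ^ n" using Suc.IH(1)[of 0] 2 by (simp add: U_def)
          finally show ?thesis .
        next
          case 3
          have "word_mass i h n (\<lambda>w. no_cut_above i (int k) (e # w)) \<le> word_mass i h n (no_cut_above i (int 1))"
            using 3 0 by (intro word_mass_mono) (auto intro: no_cut_above_Cons)
          also have "\<dots> \<le> U (e $ i) / s ^ n" using Suc.IH(1)[of 1] 3 by (simp add: U_def)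
          finally show ?thesis .
        qed
      next
        \<comment> \<open>With this the step from the maximum is covered by the rate of a running
          trial.\<close>
        have "exp (- h) * \<gamma> \<le> 1" using l by (simp add: exp_minus field_simps)
        then have "s * (\<gamma> + exp (- h) * \<gamma> + 2 * (real CARD('d) - 1)) \<le> D"
          using trial s by (intro order_trans[OF _ trial] mult_left_mono) auto
        then show "s * (exp h * U 1 + exp (- h) * U (- 1) + 2 * (real CARD('d) - 1) * U 0) \<le>
            \<gamma> ^ k * (exp h + exp (- h) + 2 * (real CARD('d) - 1))"
          using 0 mult.assoc[of \<gamma> "exp h" "exp (- h)"]
          by (simp add: U_def D_def mult.commute[of "exp h"] mult.assoc flip: exp_add)
      qed (use s in simp)
    next
      case (Suc k')
      define U where "U = (\<lambda>l::int. if l = 1 then \<gamma> ^ k' else if l = 0 then \<gamma> ^ Suc k' else \<gamma> ^ Suc (Suc k'))"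
      show ?thesis
      proof (rule word_mass_Suc_le[where U = U])
        fix e :: "int ^ 'd"
        assume e: "e \<in> unit_vectors"
        have *: "word_mass i h n (\<lambda>w. no_cut_above i (int k) (e # w)) \<le> \<gamma> ^ j / s ^ n" if "int j = int k - e $ i" for j
          by (rule order_trans[OF word_mass_mono Suc.IH(1)]) (use that in \<open>auto intro: no_cut_above_Cons\<close>)
        show "word_mass i h n (\<lambda>w. no_cut_above i (int k) (e # w)) \<le> U (e $ i) / s ^ n"
          using *[of k'] *[of "Suc k'"] *[of "Suc (Suc k')"] unit_vectors_level[OF e, of i] Suc
          by (auto simp: U_def)
      next
        have "s * (exp h * U 1 + exp (- h) * U (- 1) + 2 * (real CARD('d) - 1) * U 0) =
          \<gamma> ^ k * (s * (exp h / \<gamma> + exp (- h) * \<gamma> + 2 * (real CARD('d) - 1)))"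
          using l0 by (simp add: U_def Suc field_simps)
        also have "\<dots> \<le> \<gamma> ^ k * D"
          using gap l0 by (intro mult_left_mono) auto
        finally show "s * (exp h * U 1 + exp (- h) * U (- 1) + 2 * (real CARD('d) - 1) * U 0) \<le>
            \<gamma> ^ k * (exp h + exp (- h) + 2 * (real CARD('d) - 1))"
          by (simp add: D_def)
      qed (use s in simp)
    qed
  next
    case (2 y m)
    note ym = 2
    \<comment> \<open>Every step up is charged as if it raised the maximum, hence its factor
      \<gamma>. The powers of exp (- h) turn the weights exp h and exp (- h) of the steps up and
      down into \<gamma> and 1, as in the assumption \<open>trial\<close>.\<close>
    define U where "U = (\<lambda>l::int. \<gamma> ^ m * exp (- h) ^ y *
      (if l = 1 then \<gamma> * exp (- h) else if l = 0 then 1 else exp h))"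
    show ?case
    proof (rule word_mass_Suc_le[where U = U])
      fix e :: "int ^ 'd"
      assume e: "e \<in> unit_vectors"
      have *: "word_mass i h n (\<lambda>w. failing_trial i y m (e # w)) \<le> \<gamma> ^ m' * exp (- h) ^ y' / s ^ n"
        if "int y' = int y + e $ i" "1 \<le> y'" "m \<le> m'" "y' \<le> m'" for y' m'
        by (rule order_trans[OF word_mass_mono Suc.IH(2)], erule failing_trial_step) (use ym that in auto)
      consider "e $ i = 1" | "e $ i = 0" | "e $ i = - 1" "y = 1" | y' where "e $ i = - 1" "y = Suc y'" "1 \<le> y'"
        using unit_vectors_level[OF e, of i] ym(1) by (cases y) fastforce+
      then show "word_mass i h n (\<lambda>w. failing_trial i y m (e # w)) \<le> U (e $ i) / s ^ n"
      proof cases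
        case 1
        then show ?thesis using *[of "Suc y" "Suc m"] ym by (simp add: U_def mult_ac)
      next
        case 2
        then show ?thesis using *[of y m] ym by (simp add: U_def)
      next
        case 3
        have "word_mass i h n (\<lambda>w. failing_trial i y m (e # w)) \<le> word_mass i h n (no_cut_above i (int m))"
          using 3 ym by (intro word_mass_mono) (auto intro: failing_trial_end)
        also have "\<dots> \<le> \<gamma> ^ m / s ^ n" by (rule Suc.IH(1))
        finally show ?thesis using 3 by (simp add: U_def mult.assoc flip: exp_add)
      next
        case 4
        then show ?thesis using *[of y' m] ym by (simp add: U_def exp_minus field_simps)
      qed
    next
      have "s * (exp h * U 1 + exp (- h) * U (- 1) + 2 * (real CARD('d) - 1) * U 0) =
        \<gamma> ^ m * exp (- h) ^ y * (s * (\<gamma> + 1 + 2 * (real CARD('d) - 1)))"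
        by (simp add: U_def exp_minus field_simps)
      also have "\<dots> \<le> \<gamma> ^ m * exp (- h) ^ y * D"
        using trial l0 by (intro mult_left_mono) auto
      finally show "s * (exp h * U 1 + exp (- h) * U (- 1) + 2 * (real CARD('d) - 1) * U 0) \<le>
          \<gamma> ^ m * exp (- h) ^ y * (exp h + exp (- h) + 2 * (real CARD('d) - 1))"
        by (simp add: D_def)
    qed (use s in simp)
  }
qed

text \<open>\<gamma> is cosh h. The first inequality has room because \<gamma> + 1 < 2 * \<gamma> =
  exp h + exp (- h), the second because exp h + exp (- h) exceeds exp h / \<gamma> + exp (- h) *
  \<gamma> by (\<gamma> - 1) * (exp h / \<gamma> - exp (- h)) > 0. \<open>s\<close> is the smaller
  of the two ratios, and \<open>c\<close> stands for the weight of the sideways steps.\<close>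

lemma trial_rates:
  fixes h c :: real
  assumes "0 < h" "0 \<le> c"
  obtains \<gamma> s :: real where "1 \<le> \<gamma>" "\<gamma> \<le> exp h" "1 < s"
    "s * (\<gamma> + 1 + c) \<le> exp h + exp (- h) + c" "s * (exp h / \<gamma> + exp (- h) * \<gamma> + c) \<le> exp h + exp (- h) + c"
proof -
  define a b where "a = exp h" and "b = exp (- h)"
  have a: "1 < a" "0 < b" "b < 1" using assms by (auto simp: a_def b_def)
  have ab: "a * b = 1" by (simp add: a_def b_def flip: exp_add)
  have "0 < (a - 1) * (1 - b)" using a by (intro mult_pos_pos) auto
  then have ab2: "2 < a + b" using ab by (simp add: algebra_simps)
  define \<gamma> where "\<gamma> = (a + b) / 2"
  have l: "1 < \<gamma>" "\<gamma> < a" using a ab2 by (auto simp: \<gamma>_def field_simps)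
  define D where "D = a + b + c"
  have A: "\<gamma> + 1 + c < D" "0 < \<gamma> + 1 + c"
    using ab2 l assms by (auto simp: \<gamma>_def D_def add_divide_distrib)
  have "b * \<gamma> < 1 * a" using a l by (intro mult_strict_mono) auto
  then have "0 < (\<gamma> - 1) * (a / \<gamma> - b)"
    using l by (intro mult_pos_pos) (auto simp: field_simps)
  also have "\<dots> = a + b - (a / \<gamma> + b * \<gamma>)"
    using l by (simp add: field_simps)
  moreover have "0 < a / \<gamma>" "0 < b * \<gamma>" using a l by simp_all
  ultimately have B: "a / \<gamma> + b * \<gamma> + c < D" "0 < a / \<gamma> + b * \<gamma> + c"
    using assms by (auto simp: D_def)
  define s where "s = min (D / (\<gamma> + 1 + c)) (D / (a / \<gamma> + b * \<gamma> + c))"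
  have s: "s \<le> D / (\<gamma> + 1 + c)" "s \<le> D / (a / \<gamma> + b * \<gamma> + c)" "1 < s"
    using A B by (auto simp: s_def)
  have "s * (\<gamma> + 1 + c) \<le> D" "s * (a / \<gamma> + b * \<gamma> + c) \<le> D"
    using s(1,2) A(2) B(2) by (simp_all add: pos_le_divide_eq)
  then show thesis
    using that[of \<gamma> s] l s(3) by (simp add: D_def a_def b_def)
qed

lemma no_cut_tail:
  fixes i :: "'d::finite"
  assumes "0 < h"
  obtains C \<theta> :: real where "1 \<le> C" "0 < \<theta>" "\<theta> < 1" "\<And>n. word_mass i h n (no_cut i) \<le> C * \<theta> ^ n"
proof -
  have "0 \<le> 2 * (real CARD('d) - 1)" by (simp add: Suc_leI)
  then obtain \<gamma> s :: real where ls: "1 \<le> \<gamma>" "\<gamma> \<le> exp h" "1 < s"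
    "s * (\<gamma> + 1 + 2 * (real CARD('d) - 1)) \<le> exp h + exp (- h) + 2 * (real CARD('d) - 1)"
    "s * (exp h / \<gamma> + exp (- h) * \<gamma> + 2 * (real CARD('d) - 1)) \<le> exp h + exp (- h) + 2 * (real CARD('d) - 1)"
    using trial_rates[OF assms] by metis
  \<comment> \<open>The first step is given away. It costs one power of \<open>s\<close>, and it may
    leave the walk one below its maximum, which costs \<gamma>.\<close>
  have "word_mass i h n (no_cut i) \<le> (\<gamma> * s) * (1 / s) ^ n" for n
  proof (cases n)
    case 0
    have "1 * 1 \<le> \<gamma> * s" using ls by (intro mult_mono) auto
    then show ?thesis using word_mass_le_1[of i h n "no_cut i"] 0 by simp
  next
    case (Suc k)
    have "word_mass i h n (no_cut i) \<le> (\<Sum>e\<in>unit_vectors. step_weight i h e * (\<gamma> / s ^ k))"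
      unfolding Suc word_mass_Suc
    proof (intro sum_mono mult_left_mono step_weight_nonneg)
      fix e :: "int ^ 'd" assume "e \<in> unit_vectors"
      then have "word_mass i h k (\<lambda>w. no_cut i (e # w)) \<le> word_mass i h k (no_cut_above i (int 1))"
        by (intro word_mass_mono) (auto intro: no_cut_imp_no_cut_above)
      also have "\<dots> \<le> \<gamma> ^ 1 / s ^ k"
        using ls by (intro trial_bounds) auto
      finally show "word_mass i h k (\<lambda>w. no_cut i (e # w)) \<le> \<gamma> / s ^ k" by simp
    qed
    also have "\<dots> = (\<gamma> * s) * (1 / s) ^ n"
      using ls by (simp add: Suc power_one_over sum_step_weight flip: sum_divide_distrib sum_distrib_right)
    finally show ?thesis .
  qed
  moreover have "1 * 1 \<le> \<gamma> * s" using ls by (intro mult_mono) auto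
  ultimately show thesis using ls by (intro that[of "\<gamma> * s" "1 / s"]) auto
qed

section \<open>Renewal sequences\<close>

text \<open>A renewal theorem with an explicit constant, uniform over all laws \<open>q\<close> with
  the given tail. With \<open>T i\<close> the probability of a gap longer than \<open>i\<close>, the
  age of the renewal process splits 1 into the terms \<open>T i * b (n - i)\<close>. Ages beyond
  \<open>k\<close> carry less than 1 / 2. Since gaps of length 1 have probability at least \<eta>,
  \<open>\<eta> ^ i * b (n - i) \<le> b n\<close>; so if \<open>b n\<close> were too small, the ages
  up to \<open>k\<close> would carry at most 1 / 2 as well.\<close>

lemma renewal_lower_bound:
  fixes q b :: "nat \<Rightarrow> real"
  assumes q: "\<And>n. 0 \<le> q n" "q sums 1" "q 0 = 0" "\<And>n. q n \<le> C * \<kappa> ^ n"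
    and \<kappa>: "0 < \<kappa>" "\<kappa> < 1"
    and b_0: "b 0 = 1" and b_Suc: "\<And>n. b (Suc n) = (\<Sum>i\<le>n. q (Suc i) * b (n - i))"
    and k: "C * \<kappa> ^ k / (1 - \<kappa>)\<^sup>2 < 1 / 2"
    and \<eta>: "0 < \<eta>" "\<eta> \<le> q 1"
  shows "\<eta> ^ k / (2 * (real k + 1)) \<le> b n"
proof -
  define T where "T = (\<lambda>i. 1 - (\<Sum>j\<le>i. q j))"
  have q_le: "(\<Sum>j\<in>J. q j) \<le> 1" if "finite J" for J
    using sum_le_suminf[OF sums_summable[OF q(2)] that] q(1) sums_unique[OF q(2)] by simp
  have T: "0 \<le> T i" "T i \<le> 1" for i
    using q_le[of "{..i}"] q(1) by (auto simp: T_def intro: sum_nonneg)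
  have C: "0 \<le> C" using q(1)[of 0] q(4)[of 0] by simp
  have T_tail: "T i \<le> C * \<kappa> ^ i / (1 - \<kappa>)" for i
  proof -
    have "(\<lambda>j. q (j + Suc i)) sums (1 - (\<Sum>j<Suc i. q j))"
      using sums_split_initial_segment[OF q(2)] .
    then have "(\<lambda>j. q (j + Suc i)) sums T i" by (simp add: T_def lessThan_Suc_atMost)
    moreover have "(\<lambda>j. C * \<kappa> ^ i * \<kappa> ^ j) sums (C * \<kappa> ^ i * (1 / (1 - \<kappa>)))"
      using \<kappa> by (intro sums_mult geometric_sums) auto
    moreover have "q (j + Suc i) \<le> C * \<kappa> ^ i * \<kappa> ^ j" for j
    proof -
      have "q (j + Suc i) \<le> C * \<kappa> ^ (j + Suc i)" by (rule q(4))
      also have "\<dots> \<le> C * \<kappa> ^ (j + i)"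
        using C \<kappa> by (intro mult_left_mono power_decreasing) auto
      finally show ?thesis by (simp add: power_add mult_ac)
    qed
    ultimately have "T i \<le> C * \<kappa> ^ i * (1 / (1 - \<kappa>))" by (meson sums_le)
    then show ?thesis by simp
  qed
  have identity: "(\<Sum>i\<le>n. T i * b (n - i)) = 1" for n
  proof (induction n)
    case 0
    show ?case using q(3) b_0 by (simp add: T_def)
  next
    case (Suc n)
    have "(\<Sum>i\<le>Suc n. T i * b (Suc n - i)) = T 0 * b (Suc n) + (\<Sum>i\<le>n. T (Suc i) * b (n - i))"
      by (subst sum.atMost_Suc_shift) simp
    also have "(\<Sum>i\<le>n. T (Suc i) * b (n - i)) = (\<Sum>i\<le>n. T i * b (n - i)) - (\<Sum>i\<le>n. q (Suc i) * b (n - i))"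
      by (simp add: T_def algebra_simps flip: sum_subtractf)
    also have "T 0 = 1" using q(3) by (simp add: T_def)
    finally show ?case using Suc b_Suc[of n] by simp
  qed
  have b_nonneg: "0 \<le> b n" for n
  proof (induction n rule: less_induct)
    case (less n)
    show ?case
      using less q(1) b_0 by (cases n) (auto simp: b_Suc intro!: sum_nonneg mult_nonneg_nonneg)
  qed
  have b_le_1: "b n \<le> 1" for n
  proof -
    have "T 0 * b (n - 0) \<le> (\<Sum>i\<le>n. T i * b (n - i))"
      by (rule member_le_sum) (use T b_nonneg in auto)
    then show ?thesis using identity[of n] q(3) by (simp add: T_def)
  qed
  have step: "\<eta> ^ j * b n \<le> b (n + j)" for j n
  proof (induction j)
    case (Suc j)
    have "\<eta> * (\<eta> ^ j * b n) \<le> q (Suc 0) * b (n + j - 0)"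
      using Suc \<eta> b_nonneg by (intro mult_mono) auto
    also have "\<dots> \<le> (\<Sum>i\<le>n + j. q (Suc i) * b (n + j - i))"
      by (rule member_le_sum[where f = "\<lambda>i. q (Suc i) * b (n + j - i)"]) (use q(1) b_nonneg in auto)
    finally show ?case by (simp add: b_Suc mult.assoc)
  qed simp
  have "\<eta> \<le> 1" using \<eta>(2) q_le[of "{1}"] by simp
  show ?thesis
  proof (rule ccontr)
    assume "\<not> ?thesis"
    then have lt: "b n < \<eta> ^ k / (2 * (real k + 1))" by simp
    have small: "b (n - i) \<le> 1 / (2 * (real k + 1))" if "i \<le> k" "i \<le> n" for i
    proof -
      have "\<eta> ^ k * b (n - i) \<le> \<eta> ^ i * b (n - i)"
        using that \<eta> \<open>\<eta> \<le> 1\<close> b_nonneg by (intro mult_right_mono power_decreasing) auto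
      also have "\<dots> \<le> b n" using step[of i "n - i"] that by simp
      finally have "\<eta> ^ k * b (n - i) \<le> \<eta> ^ k * (1 / (2 * (real k + 1)))" using lt by simp
      then show ?thesis using \<eta> by (simp only: mult_le_cancel_left_pos zero_less_power)
    qed
    have "(\<Sum>i\<in>{..n} \<inter> {..k}. T i * b (n - i)) \<le> (\<Sum>i\<in>{..n} \<inter> {..k}. 1 / (2 * (real k + 1)))"
    proof (intro sum_mono)
      fix i assume "i \<in> {..n} \<inter> {..k}"
      then have "T i * b (n - i) \<le> 1 * (1 / (2 * (real k + 1)))"
        using T b_nonneg small by (intro mult_mono) auto
      then show "T i * b (n - i) \<le> 1 / (2 * (real k + 1))" by simp
    qed
    also have "\<dots> \<le> (\<Sum>i\<in>{..k}. 1 / (2 * (real k + 1)))"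
      by (intro sum_mono2) auto
    also have "\<dots> = 1 / 2" by (simp add: field_simps)
    finally have 1: "(\<Sum>i\<in>{..n} \<inter> {..k}. T i * b (n - i)) \<le> 1 / 2" .
    have "(\<Sum>i\<in>{..n} - {..k}. T i * b (n - i)) \<le> (\<Sum>i\<in>{..n} - {..k}. C * \<kappa> ^ i / (1 - \<kappa>))"
    proof (intro sum_mono)
      fix i
      have "T i * b (n - i) \<le> T i * 1" using T b_le_1 by (intro mult_left_mono) auto
      then show "T i * b (n - i) \<le> C * \<kappa> ^ i / (1 - \<kappa>)" using T_tail[of i] by simp
    qed
    also have "\<dots> \<le> (\<Sum>i=k..n + k. C * \<kappa> ^ i / (1 - \<kappa>))"
      using C \<kappa> by (intro sum_mono2) auto
    also have "\<dots> = C * \<kappa> ^ k / (1 - \<kappa>) * (\<Sum>i\<le>n. \<kappa> ^ i)"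
    proof -
      have "(\<Sum>i=k..n + k. C * \<kappa> ^ i / (1 - \<kappa>)) = (\<Sum>i=0..n. C * \<kappa> ^ (i + k) / (1 - \<kappa>))"
        using sum.shift_bounds_cl_nat_ivl[of "\<lambda>i. C * \<kappa> ^ i / (1 - \<kappa>)" 0 k n] by simp
      then show ?thesis by (simp add: power_add sum_distrib_left sum_divide_distrib atLeast0AtMost mult_ac)
    qed
    also have "\<dots> \<le> C * \<kappa> ^ k / (1 - \<kappa>) * (1 / (1 - \<kappa>))"
    proof (intro mult_left_mono)
      have "(\<Sum>i\<in>{..n}. \<kappa> ^ i) \<le> (\<Sum>i. \<kappa> ^ i)"
        using \<kappa> by (intro sum_le_suminf summable_geometric) auto
      then show "(\<Sum>i\<le>n. \<kappa> ^ i) \<le> 1 / (1 - \<kappa>)"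
        using \<kappa> by (simp add: suminf_geometric)
    qed (use C \<kappa> in auto)
    also have "\<dots> < 1 / 2" using k by (simp add: power2_eq_square)
    finally have 2: "(\<Sum>i\<in>{..n} - {..k}. T i * b (n - i)) < 1 / 2" .
    have "(\<Sum>i\<in>{..n}. T i * b (n - i)) =
        (\<Sum>i\<in>{..n} \<inter> {..k}. T i * b (n - i)) + (\<Sum>i\<in>{..n} - {..k}. T i * b (n - i))"
      by (rule sum.Int_Diff) simp
    then show False using identity[of n] 1 2 by simp
  qed
qed

text \<open>
  If the generating function of \<open>f\<close> stayed below \<open>1\<close> at \<open>R\<close>, then \<open>B n * R ^ n\<close> would be summable,
  and so would \<open>Z n * R ^ n \<ge> 1\<close>.
\<close>

lemma renewal_root:
  fixes f B Z p :: "nat \<Rightarrow> real"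
  assumes f: "\<And>n. 0 \<le> f n" "f 0 = 0" "\<And>n. f n \<le> C * \<theta> ^ n"
    and p: "\<And>n. 0 \<le> p n" "\<And>n. p n \<le> C * \<theta> ^ n"
    and \<theta>: "0 < \<theta>" "0 < R" "R * \<theta> < 1"
    and B: "B 0 = 1" "\<And>n. B (Suc n) = (\<Sum>i\<le>n. f (Suc i) * B (n - i))"
    and Z: "\<And>n. 1 \<le> Z n * R ^ n" "\<And>n. Z n \<le> (\<Sum>j\<le>n. \<Sum>l\<le>n - j. p j * p l * B (n - j - l))"
  shows "\<exists>t. 0 < t \<and> t \<le> R \<and> (\<lambda>n. f n * t ^ n) sums 1"
proof -
  have geo: "summable (\<lambda>n. C * (R * \<theta>) ^ n)"
    using \<theta> by (intro summable_mult summable_geometric) auto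
  have sumR: "summable (\<lambda>n. g n * R ^ n)" if "\<And>n. 0 \<le> g n" "\<And>n. g n \<le> C * \<theta> ^ n" for g :: "nat \<Rightarrow> real"
  proof (rule summable_comparison_test'[OF geo, of 0])
    fix n
    have "g n * R ^ n \<le> C * \<theta> ^ n * R ^ n" using that \<theta> by (intro mult_right_mono) auto
    then show "norm (g n * R ^ n) \<le> C * (R * \<theta>) ^ n"
      using that(1)[of n] \<theta> by (simp add: power_mult_distrib mult_ac)
  qed
  define F where "F = (\<lambda>t. \<Sum>n. f n * t ^ n)"
  have "1 \<le> F R"
  proof (rule ccontr)
    assume "\<not> 1 \<le> F R"
    then have F: "F R < 1" by simp
    have B_nonneg: "0 \<le> B n" for n
    proof (induction n rule: less_induct)
      case (less n)
      show ?case
        using less f(1) B by (cases n) (auto intro!: sum_nonneg mult_nonneg_nonneg)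
    qed
    define S where "S = (\<lambda>n. \<Sum>k\<le>n. B k * R ^ k)"
    have S_nonneg: "0 \<le> S n" for n
      unfolding S_def using B_nonneg \<theta> by (intro sum_nonneg) auto
    have S_mono: "S k \<le> S n" if "k \<le> n" for k n
      unfolding S_def using that B_nonneg \<theta> by (intro sum_mono2) auto
    have F_nonneg: "0 \<le> F R"
      unfolding F_def using f \<theta> sumR[of f] by (intro suminf_nonneg) auto
    \<comment> \<open>Splitting off the first gap gives S (n + 1) \<le> 1 + F R * S (n + 1). As
      \<open>S\<close> is a finite partial sum, no convergence is presupposed.\<close>
    have S_le: "S n \<le> 1 / (1 - F R)" for n
    proof -
      have "S (Suc n) = 1 + (\<Sum>k\<le>n. (\<Sum>i\<le>k. f (Suc i) * B (k - i)) * R ^ Suc k)"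
        unfolding S_def by (subst sum.atMost_Suc_shift) (simp add: B)
      also have "(\<Sum>k\<le>n. (\<Sum>i\<le>k. f (Suc i) * B (k - i)) * R ^ Suc k) =
          (\<Sum>k\<le>n. \<Sum>i\<le>k. f (Suc i) * R ^ Suc i * (B (k - i) * R ^ (k - i)))"
        unfolding sum_distrib_right
      proof (intro sum.cong refl)
        fix k i assume "k \<in> {..n}" "i \<in> {..k}"
        then have "R ^ Suc k = R ^ Suc i * R ^ (k - i)" by (simp flip: power_add)
        then show "f (Suc i) * B (k - i) * R ^ Suc k = f (Suc i) * R ^ Suc i * (B (k - i) * R ^ (k - i))"
          by simp
      qed
      also have "\<dots> = (\<Sum>i\<le>n. \<Sum>k\<le>n - i. f (Suc i) * R ^ Suc i * (B k * R ^ k))"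
      proof -
        have "(\<Sum>k\<le>n. \<Sum>i\<le>k. g i (k - i)) = (\<Sum>i\<le>n. \<Sum>k\<le>n - i. g i k)" for g :: "nat \<Rightarrow> nat \<Rightarrow> real"
          unfolding sum.Sigma[OF finite_atMost ballI[OF finite_atMost]]
          by (rule sum.reindex_bij_witness[of _ "\<lambda>(i, k). (i + k, i)" "\<lambda>(k, i). (i, k - i)"]) auto
        then show ?thesis .
      qed
      also have "\<dots> = (\<Sum>i\<le>n. f (Suc i) * R ^ Suc i * S (n - i))"
        by (simp add: S_def sum_distrib_left)
      also have "\<dots> \<le> (\<Sum>i\<le>n. f (Suc i) * R ^ Suc i * S (Suc n))"
        using f \<theta> by (intro sum_mono mult_left_mono S_mono) auto
      also have "\<dots> = (\<Sum>i<Suc (Suc n). f i * R ^ i) * S (Suc n)"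
        by (subst sum.lessThan_Suc_shift) (simp add: f(2) sum_distrib_right lessThan_Suc_atMost)
      also have "\<dots> \<le> F R * S (Suc n)"
        unfolding F_def
        by (intro mult_right_mono sum_le_suminf sumR S_nonneg) (use f \<theta> in auto)
      finally have "S (Suc n) * (1 - F R) \<le> 1" by (simp add: algebra_simps)
      then have "S (Suc n) \<le> 1 / (1 - F R)" using F by (simp add: field_simps)
      then show ?thesis using S_mono[of n "Suc n"] by simp
    qed
    define P where "P = (\<Sum>n. p n * R ^ n)"
    have P: "(\<Sum>j\<le>n. p j * R ^ j) \<le> P" for n
      unfolding P_def by (intro sum_le_suminf sumR) (use p \<theta> in auto)
    have P_nonneg: "0 \<le> P"
      unfolding P_def using p \<theta> sumR[of p] by (intro suminf_nonneg) auto
    \<comment> \<open>The left side counts the terms \<open>Z k * R ^ k \<ge> 1\<close>, while the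
      right side is free of \<open>n\<close>.\<close>
    have bound: "real n + 1 \<le> P * P * (1 / (1 - F R))" for n
    proof -
      have "real n + 1 = (\<Sum>k\<le>n. 1)" by simp
      also have "\<dots> \<le> (\<Sum>k\<le>n. Z k * R ^ k)" by (intro sum_mono Z(1))
      also have "\<dots> \<le> (\<Sum>k\<le>n. (\<Sum>j\<le>k. \<Sum>l\<le>k - j. p j * p l * B (k - j - l)) * R ^ k)"
        using \<theta> by (intro sum_mono mult_right_mono Z(2)) auto
      also have "\<dots> = (\<Sum>k\<le>n. \<Sum>j\<le>k. \<Sum>l\<le>k - j. (p j * R ^ j) * (p l * R ^ l) * (B (k - j - l) * R ^ (k - j - l)))"
        unfolding sum_distrib_right
      proof (intro sum.cong refl)
        fix k j l assume "k \<in> {..n}" "j \<in> {..k}" "l \<in> {..k - j}"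
        then have "R ^ k = R ^ j * R ^ l * R ^ (k - j - l)" by (simp flip: power_add)
        then show "p j * p l * B (k - j - l) * R ^ k =
            (p j * R ^ j) * (p l * R ^ l) * (B (k - j - l) * R ^ (k - j - l))" by simp
      qed
      also have "\<dots> = (\<Sum>(k, j, l)\<in>(SIGMA k:{..n}. SIGMA j:{..k}. {..k - j}).
          (p j * R ^ j) * (p l * R ^ l) * (B (k - j - l) * R ^ (k - j - l)))"
        by (simp add: sum.Sigma)
      also have "\<dots> \<le> (\<Sum>(j, l, k)\<in>{..n} \<times> {..n} \<times> {..n}. (p j * R ^ j) * (p l * R ^ l) * (B k * R ^ k))"
      proof (rule sum_le_included[where i = "\<lambda>(j, l, k). (j + l + k, j, l)"], goal_cases)
        case 4
        show ?case
        proof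
          fix x assume "x \<in> (SIGMA k:{..n}. SIGMA j:{..k}. {..k - j})"
          then obtain k j l where x: "x = (k, j, l)" "k \<le> n" "j \<le> k" "l \<le> k - j" by auto
          show "\<exists>y\<in>{..n} \<times> {..n} \<times> {..n}. (case y of (j, l, k) \<Rightarrow> (j + l + k, j, l)) = x \<and>
              (case x of (k, j, l) \<Rightarrow> p j * R ^ j * (p l * R ^ l) * (B (k - j - l) * R ^ (k - j - l)))
                \<le> (case y of (j, l, k) \<Rightarrow> p j * R ^ j * (p l * R ^ l) * (B k * R ^ k))"
            using x by (intro bexI[of _ "(j, l, k - j - l)"]) auto
        qed
      qed (use p \<theta> B_nonneg in \<open>auto intro!: mult_nonneg_nonneg\<close>)
      also have "\<dots> = (\<Sum>j\<le>n. p j * R ^ j) * (\<Sum>l\<le>n. p l * R ^ l) * S n"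
        unfolding sum.cartesian_product[symmetric] S_def
        by (simp only: sum_distrib_left[symmetric] sum_distrib_right[symmetric])
      also have "\<dots> \<le> P * P * (1 / (1 - F R))"
        using P S_le S_nonneg P_nonneg p \<theta> by (intro mult_mono) (auto intro!: sum_nonneg mult_nonneg_nonneg)
      finally show ?thesis .
    qed
    obtain n :: nat where "P * P * (1 / (1 - F R)) < real n"
      using reals_Archimedean2 by blast
    then show False using bound[of n] by simp
  qed
  moreover have "F 0 = 0" by (simp add: F_def f(2))
  moreover have "isCont F x" if "0 \<le> x" "x \<le> R" for x
  proof -
    \<comment> \<open>Continuity up to the endpoint \<open>R\<close> needs convergence beyond it;
      \<open>R'\<close> lies halfway between \<open>R\<close> and 1 / \<theta>, up to which the
      geometric bound gives convergence.\<close>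
    define R' where "R' = (R + 1 / \<theta>) / 2"
    have R': "R < R'" "R' * \<theta> < 1" using \<theta> by (auto simp: R'_def field_simps)
    have "summable (\<lambda>n. C * (R' * \<theta>) ^ n)"
      using R' \<theta> by (intro summable_mult summable_geometric) auto
    then have "summable (\<lambda>n. f n * R' ^ n)"
    proof (rule summable_comparison_test'[of _ 0])
      fix n
      have "f n * R' ^ n \<le> C * \<theta> ^ n * R' ^ n" using f R' \<theta> by (intro mult_right_mono) auto
      then show "norm (f n * R' ^ n) \<le> C * (R' * \<theta>) ^ n"
        using f(1)[of n] R' \<theta> by (simp add: power_mult_distrib mult_ac)
    qed
    then show ?thesis
      unfolding F_def using that R' \<theta> by (intro isCont_powser[where K = R']) auto
  qed
  ultimately obtain t where t: "0 \<le> t" "t \<le> R" "F t = 1"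
    using IVT[of F 0 1 R] \<theta> by auto
  have "t \<noteq> 0" using t \<open>F 0 = 0\<close> by auto
  moreover have "summable (\<lambda>n. f n * t ^ n)"
    by (rule summable_comparison_test'[OF sumR[OF f(1,3)], of 0])
       (use f t \<theta> in \<open>auto intro!: mult_left_mono power_mono simp: abs_mult\<close>)
  ultimately show ?thesis
    using t unfolding F_def by (intro exI[of _ t]) (auto simp: sums_iff)
qed

section \<open>Sequences of irreducible bridges\<close>

definition irred_words :: "'d::finite \<Rightarrow> nat \<Rightarrow> (int ^ 'd) list set" where
  "irred_words i n = {b \<in> words n. irred_bridge i b}"

definition no_cut_words :: "'d::finite \<Rightarrow> nat \<Rightarrow> (int ^ 'd) list set" where
  "no_cut_words i n = {w \<in> words n. no_cut i w}"

definition bridge_seqs :: "'d::finite \<Rightarrow> nat \<Rightarrow> (int ^ 'd) list list set" where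
  "bridge_seqs i n = {bs. (\<forall>b\<in>set bs. irred_bridge i b) \<and> concat bs \<in> words n}"

lemma finite_irred_words: "finite (irred_words i n)"
  by (simp add: irred_words_def finite_words)

lemma finite_no_cut_words: "finite (no_cut_words i n)"
  by (simp add: no_cut_words_def finite_words)

lemma finite_bridge_seqs: "finite (bridge_seqs i n)"
proof (rule finite_imageD)
  show "finite (concat ` bridge_seqs i n)"
    by (rule finite_subset[OF _ finite_words[of n]]) (auto simp: bridge_seqs_def)
  show "inj_on concat (bridge_seqs i n)"
    by (rule inj_on_subset[OF inj_on_concat_irred]) (auto simp: bridge_seqs_def)
qed

lemma words_append_iff:
  "u @ v \<in> words n \<longleftrightarrow> u \<in> words (length u) \<and> v \<in> words (length v) \<and> length u + length v = n"
  by (auto simp: words_def)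

lemma irred_words_0 [simp]: "irred_words i 0 = {}"
  by (auto simp: irred_words_def irred_bridge_def)

lemma bridge_seqs_0 [simp]: "bridge_seqs i 0 = {[]}"
proof
  show "bridge_seqs i 0 \<subseteq> {[]}"
  proof
    fix bs assume "bs \<in> bridge_seqs i 0"
    then have "\<forall>b\<in>set bs. irred_bridge i b" "\<forall>b\<in>set bs. b = []"
      by (simp_all add: bridge_seqs_def)
    moreover have "\<not> irred_bridge i []" by (simp add: irred_bridge_def)
    ultimately show "bs \<in> {[]}" by (cases bs) auto
  qed
qed (simp add: bridge_seqs_def)

lemma bridge_seqs_Cons_iff:
  "b # bs \<in> bridge_seqs i n \<longleftrightarrow>
     b \<in> irred_words i (length b) \<and> length b \<le> n \<and> bs \<in> bridge_seqs i (n - length b)"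
  by (auto simp: bridge_seqs_def irred_words_def words_def)

lemma bridge_seqs_append_iff:
  "bs @ cs \<in> bridge_seqs i n \<longleftrightarrow>
     bs \<in> bridge_seqs i (length (concat bs)) \<and> length (concat bs) \<le> n \<and> cs \<in> bridge_seqs i (n - length (concat bs))"
  by (auto simp: bridge_seqs_def words_def)

lemma bridge_seqs_Suc:
  "bridge_seqs i (Suc n) =
     (\<lambda>(k, b, bs). b # bs) ` (SIGMA k:{..n}. irred_words i (Suc k) \<times> bridge_seqs i (n - k))"
proof (intro equalityI subsetI)
  fix bs assume bs: "bs \<in> bridge_seqs i (Suc n)"
  then have "bs \<noteq> []" by (auto simp: bridge_seqs_def words_def)
  then obtain b cs where bs_eq: "bs = b # cs" by (cases bs) auto
  with bs have b: "b \<in> irred_words i (length b)" "length b \<le> Suc n" "cs \<in> bridge_seqs i (Suc n - length b)"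
    by (simp_all add: bridge_seqs_Cons_iff)
  moreover obtain k where "length b = Suc k"
    using b(1) by (metis empty_iff irred_words_0 not0_implies_Suc)
  ultimately show "bs \<in> (\<lambda>(k, b, bs). b # bs) ` (SIGMA k:{..n}. irred_words i (Suc k) \<times> bridge_seqs i (n - k))"
    unfolding bs_eq by (intro image_eqI[of _ _ "(k, b, cs)"]) auto
next
  fix bs assume "bs \<in> (\<lambda>(k, b, bs). b # bs) ` (SIGMA k:{..n}. irred_words i (Suc k) \<times> bridge_seqs i (n - k))"
  then obtain k b cs where "bs = b # cs" "k \<le> n" "b \<in> irred_words i (Suc k)" "cs \<in> bridge_seqs i (n - k)"
    by auto
  moreover from this have "length b = Suc k" by (simp add: irred_words_def words_def)
  ultimately show "bs \<in> bridge_seqs i (Suc n)" by (simp add: bridge_seqs_Cons_iff)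
qed

lemma sum_bridge_seqs_Suc:
  "sum f (bridge_seqs i (Suc n)) =
     (\<Sum>k\<le>n. \<Sum>b\<in>irred_words i (Suc k). \<Sum>bs\<in>bridge_seqs i (n - k). f (b # bs))"
proof -
  have "inj_on (\<lambda>(k, b, bs). b # bs) (SIGMA k:{..n}. irred_words i (Suc k) \<times> bridge_seqs i (n - k))"
    by (auto simp: inj_on_def irred_words_def words_def)
  then have "sum f (bridge_seqs i (Suc n)) =
      (\<Sum>(k, b, bs)\<in>(SIGMA k:{..n}. irred_words i (Suc k) \<times> bridge_seqs i (n - k)). f (b # bs))"
    unfolding bridge_seqs_Suc by (subst sum.reindex) (auto intro!: sum.cong)
  also have "\<dots> = (\<Sum>k\<le>n. \<Sum>b\<in>irred_words i (Suc k). \<Sum>bs\<in>bridge_seqs i (n - k). f (b # bs))"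
    by (subst sum.Sigma[symmetric])
       (auto simp: finite_irred_words finite_bridge_seqs sum.cartesian_product)
  finally show ?thesis .
qed

definition seq_weight :: "('b \<Rightarrow> real) \<Rightarrow> 'b list \<Rightarrow> real" where
  "seq_weight a bs = (\<Prod>b\<leftarrow>bs. a b)"

lemma seq_weight_simps [simp]:
  "seq_weight a [] = 1" "seq_weight a (b # bs) = a b * seq_weight a bs"
  "seq_weight a (bs @ cs) = seq_weight a bs * seq_weight a cs"
  by (auto simp: seq_weight_def)

lemma seq_weight_nonneg: "(\<And>b. 0 \<le> a b) \<Longrightarrow> 0 \<le> seq_weight a bs"
  by (induction bs) auto

lemma seq_weight_power:
  "seq_weight (\<lambda>b. a b * t ^ length b) bs = seq_weight a bs * t ^ length (concat bs)"
  by (induction bs) (auto simp: power_add)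

definition irred_sum :: "'d::finite \<Rightarrow> ((int ^ 'd) list \<Rightarrow> real) \<Rightarrow> nat \<Rightarrow> real" where
  "irred_sum i a n = (\<Sum>b\<in>irred_words i n. a b)"

definition bridge_sum :: "'d::finite \<Rightarrow> ((int ^ 'd) list \<Rightarrow> real) \<Rightarrow> nat \<Rightarrow> real" where
  "bridge_sum i a n = (\<Sum>bs\<in>bridge_seqs i n. seq_weight a bs)"

lemma bridge_sum_0: "bridge_sum i a 0 = 1"
  by (simp add: bridge_sum_def)

lemma bridge_sum_Suc: "bridge_sum i a (Suc n) = (\<Sum>k\<le>n. irred_sum i a (Suc k) * bridge_sum i a (n - k))"
  by (simp add: bridge_sum_def irred_sum_def sum_bridge_seqs_Suc sum_product)

text \<open>Only the existence of a decomposition enters, so this is an upper bound for nonnegative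
  \<open>g\<close>. The general \<open>g\<close> allows the lemma to be applied to single words and,
  nested, to pairs of words.\<close>

lemma sum_words_le_decomp:
  fixes i :: "'d::finite" and f :: "(int ^ 'd) list \<Rightarrow> real"
  assumes nonneg: "\<And>u v bs. 0 \<le> g u v bs"
    and le: "\<And>u v bs. u @ concat bs @ v \<in> words n \<Longrightarrow> \<forall>b\<in>set bs. irred_bridge i b \<Longrightarrow> stays_above i v \<Longrightarrow>
      set_mset (sites u) \<inter> set_mset (translate (sum_list u) (sites (concat bs @ v))) = {} \<Longrightarrow>
      f (u @ concat bs @ v) \<le> g u v bs"
  shows "(\<Sum>w\<in>words n. f w) \<le>
    (\<Sum>j\<le>n. \<Sum>u\<in>no_cut_words i j. \<Sum>l\<le>n - j. \<Sum>v\<in>no_cut_words i l. \<Sum>bs\<in>bridge_seqs i (n - j - l). g u v bs)"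
proof -
  let ?T = "SIGMA j:{..n}. SIGMA u:no_cut_words i j. SIGMA l:{..n - j}. SIGMA v:no_cut_words i l. bridge_seqs i (n - j - l)"
  have "(\<Sum>w\<in>words n. f w) \<le> (\<Sum>(j, u, l, v, bs)\<in>?T. g u v bs)"
  proof (rule sum_le_included[where i = "\<lambda>(j :: nat, u, l :: nat, v, bs). u @ concat bs @ v :: (int ^ 'd) list"], goal_cases)
    case 4
    show ?case
    proof
      fix w :: "(int ^ 'd) list" assume w: "w \<in> words n"
      obtain u bs v where d: "w = u @ concat bs @ v" "no_cut i u" "\<forall>b\<in>set bs. irred_bridge i b" "no_cut i v"
        "set_mset (sites u) \<inter> set_mset (translate (sum_list u) (sites (concat bs @ v))) = {}" "stays_above i v"
        using cut_decomp[of w i] by metis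
      have "u \<in> words (length u) \<and> concat bs \<in> words (length (concat bs)) \<and> v \<in> words (length v) \<and>
          length u + (length (concat bs) + length v) = n"
        using w unfolding d(1) by (metis words_append_iff length_append)
      moreover have "f w \<le> g u v bs" using le[OF _ d(3,6,5)] w d(1) by simp
      ultimately show "\<exists>y\<in>?T. (case y of (j, u, l, v, bs) \<Rightarrow> u @ concat bs @ v) = w \<and>
          f w \<le> (case y of (j, u, l, v, bs) \<Rightarrow> g u v bs)"
        using d(1-4)
        by (intro bexI[of _ "(length u, u, length v, v, bs)"]) (auto simp: no_cut_words_def bridge_seqs_def)
    qed
  qed (auto simp: nonneg finite_words finite_bridge_seqs finite_no_cut_words)
  also have "\<dots> = (\<Sum>j\<le>n. \<Sum>u\<in>no_cut_words i j. \<Sum>l\<le>n - j. \<Sum>v\<in>no_cut_words i l. \<Sum>bs\<in>bridge_seqs i (n - j - l). g u v bs)"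
    by (simp add: sum.Sigma finite_bridge_seqs finite_no_cut_words)
  finally show ?thesis .
qed

lemma sum_no_cut_words: "(\<Sum>w\<in>no_cut_words i n. word_weight i h w) = word_mass i h n (no_cut i)"
  unfolding word_mass_def no_cut_words_def
  by (intro sum.mono_neutral_cong_left) (auto simp: finite_words)

section \<open>Bridge sums compared with the annealed sum\<close>

context site_interaction
begin

definition bridge_weight :: "'d::finite \<Rightarrow> real \<Rightarrow> (int ^ 'd) list \<Rightarrow> real" where
  "bridge_weight i h b = word_weight i h b * site_weight m (sites b)"

definition annealed_sum :: "'d::finite \<Rightarrow> real \<Rightarrow> nat \<Rightarrow> real" where
  "annealed_sum i h n = (\<Sum>w\<in>words n. word_weight i h w * site_weight m (sites w))"

lemma bridge_weight_nonneg: "0 \<le> bridge_weight i h b"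
  by (simp add: bridge_weight_def word_weight_nonneg site_weight_pos less_imp_le)

lemma bridge_weight_le: "bridge_weight i h b \<le> word_weight i h b"
  unfolding bridge_weight_def
  using mult_left_mono[OF site_weight_le_1 word_weight_nonneg] by simp

lemma seq_weight_bridge:
  "seq_weight (bridge_weight i h) bs = word_weight i h (concat bs) * (\<Prod>b\<leftarrow>bs. site_weight m (sites b))"
  by (induction bs) (auto simp: bridge_weight_def)

text \<open>Distinct sequences of irreducible bridges spell distinct words and their weights
  factorize, so the left side is the annealed sum restricted to some words.\<close>

lemma bridge_sum_le_annealed: "bridge_sum i (bridge_weight i h) n \<le> annealed_sum i h n"
proof -
  have "bridge_sum i (bridge_weight i h) n =
      (\<Sum>bs\<in>bridge_seqs i n. word_weight i h (concat bs) * site_weight m (sites (concat bs)))"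
    unfolding bridge_sum_def
  proof (intro sum.cong refl)
    fix bs assume "bs \<in> bridge_seqs i n"
    then show "seq_weight (bridge_weight i h) bs = word_weight i h (concat bs) * site_weight m (sites (concat bs))"
      using site_weight_concat[of bs i "[]"]
      by (simp add: seq_weight_bridge bridge_seqs_def site_weight_def[of m "{#}"])
  qed
  also have "\<dots> = (\<Sum>w\<in>concat ` bridge_seqs i n. word_weight i h w * site_weight m (sites w))"
    by (subst sum.reindex)
       (auto intro!: inj_on_subset[OF inj_on_concat_irred[of i]] simp: bridge_seqs_def)
  also have "\<dots> \<le> annealed_sum i h n"
    unfolding annealed_sum_def
    by (intro sum_mono2 finite_words mult_nonneg_nonneg word_weight_nonneg less_imp_le[OF site_weight_pos])
       (auto simp: bridge_seqs_def)
  finally show ?thesis .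
qed

text \<open>The cuts make the interaction factorize. Within the two ends it is bounded by 1, since
  the walk alone already makes long ends unlikely.\<close>

lemma decomp_weight_le:
  assumes "\<forall>b\<in>set bs. irred_bridge i b" "stays_above i v"
    and "set_mset (sites u) \<inter> set_mset (translate (sum_list u) (sites (concat bs @ v))) = {}"
  shows "word_weight i h (u @ concat bs @ v) * site_weight m (sites (u @ concat bs @ v)) \<le>
    word_weight i h u * word_weight i h v * seq_weight (bridge_weight i h) bs"
proof -
  let ?G = "\<lambda>w. site_weight m (sites w)"
  have "?G (u @ concat bs @ v) = ?G u * ((\<Prod>b\<leftarrow>bs. ?G b) * ?G v)"
    using assms(3) site_weight_concat[OF assms(1,2)]
    by (simp add: sites_append[of u] site_weight_add_disjoint m_0)
  also have "\<dots> \<le> 1 * ((\<Prod>b\<leftarrow>bs. ?G b) * 1)"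
    by (intro mult_mono mult_left_mono site_weight_le_1 mult_nonneg_nonneg prod_list_nonneg)
       (auto simp: site_weight_pos less_imp_le)
  finally have "word_weight i h (u @ concat bs @ v) * ?G (u @ concat bs @ v) \<le>
      word_weight i h (u @ concat bs @ v) * (\<Prod>b\<leftarrow>bs. ?G b)"
    by (intro mult_left_mono word_weight_nonneg) simp
  then show ?thesis by (simp add: seq_weight_bridge mult_ac)
qed

lemma annealed_sum_le:
  "annealed_sum i h n \<le>
     (\<Sum>j\<le>n. \<Sum>l\<le>n - j. word_mass i h j (no_cut i) * word_mass i h l (no_cut i) *
        bridge_sum i (bridge_weight i h) (n - j - l))"
proof -
  have "annealed_sum i h n \<le> (\<Sum>j\<le>n. \<Sum>u\<in>no_cut_words i j. \<Sum>l\<le>n - j. \<Sum>v\<in>no_cut_words i l.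
      \<Sum>bs\<in>bridge_seqs i (n - j - l). word_weight i h u * word_weight i h v * seq_weight (bridge_weight i h) bs)"
    unfolding annealed_sum_def
    by (intro sum_words_le_decomp decomp_weight_le mult_nonneg_nonneg word_weight_nonneg
          seq_weight_nonneg bridge_weight_nonneg)
  also have "\<dots> = (\<Sum>j\<le>n. \<Sum>l\<le>n - j. word_mass i h j (no_cut i) * word_mass i h l (no_cut i) *
        bridge_sum i (bridge_weight i h) (n - j - l))"
    unfolding bridge_sum_def sum_no_cut_words[symmetric]
    by (rule sum.cong[OF refl], subst sum.swap, rule sum.cong[OF refl])
       (simp only: sum_distrib_left[symmetric] sum_distrib_right[symmetric])
  finally show ?thesis .
qed

lemma annealed_sum_lower: "exp (- \<epsilon> * real n) \<le> annealed_sum i h n"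
proof -
  have "exp (- \<epsilon> * real n) = (\<Sum>w\<in>words n. word_weight i h w * exp (- \<epsilon> * real n))"
    by (simp add: sum_word_weight flip: sum_distrib_right)
  also have "\<dots> \<le> annealed_sum i h n"
    unfolding annealed_sum_def
  proof (intro sum_mono mult_left_mono word_weight_nonneg)
    fix w :: "(int ^ 'a) list" assume "w \<in> words n"
    then show "exp (- \<epsilon> * real n) \<le> site_weight m (sites w)"
      using site_weight_lower[of "sites w"] by (simp add: words_def)
  qed
  finally show ?thesis .
qed

lemma irred_sum_le: "irred_sum i (bridge_weight i h) n \<le> word_mass i h n (no_cut i)"
proof -
  have "irred_sum i (bridge_weight i h) n \<le> (\<Sum>b\<in>irred_words i n. word_weight i h b)"
    unfolding irred_sum_def by (intro sum_mono bridge_weight_le)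
  also have "\<dots> \<le> (\<Sum>b\<in>no_cut_words i n. word_weight i h b)"
    by (intro sum_mono2 finite_no_cut_words word_weight_nonneg)
       (auto simp: irred_words_def no_cut_words_def irred_bridge_def)
  finally show ?thesis by (simp add: sum_no_cut_words)
qed

lemma irred_sum_nonneg: "0 \<le> irred_sum i (bridge_weight i h) n"
  unfolding irred_sum_def by (intro sum_nonneg bridge_weight_nonneg)

end

section \<open>Coincidences of two sequences of blocks\<close>

text \<open>Counts the sequences of \<open>g\<close> signs with sum \<open>t\<close>.\<close>

primrec sign_walks :: "nat \<Rightarrow> int \<Rightarrow> real" where
  "sign_walks 0 t = of_bool (t = 0)"
| "sign_walks (Suc g) t = sign_walks g (t - 1) + sign_walks g (t + 1)"

lemma sign_walks_eq:
  "sign_walks g t = (if even (t + int g) \<and> 0 \<le> t + int g then real (g choose nat ((t + int g) div 2)) else 0)"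
proof (induction g arbitrary: t)
  case 0
  show ?case by (cases "t = 0") (auto simp: binomial_eq_0_iff elim!: evenE)
next
  case (Suc g)
  show ?case
  proof (cases "even (t + int (Suc g))")
    case True
    then obtain k where k: "t + int (Suc g) = 2 * k" by (elim evenE)
    have eq: "t - 1 + int g = 2 * (k - 1)" "t + 1 + int g = 2 * k" using k by simp_all
    consider "k < 0" | "k = 0" | j where "k = int (Suc j)"
      by (metis linorder_neqE_linordered_idom zero_less_imp_eq_int Suc_pred)
    then show ?thesis
      unfolding sign_walks.simps Suc.IH eq k
      by cases (auto simp: nat_add_distrib)
  next
    case False
    then have "odd (t - 1 + int g)" "odd (t + 1 + int g)" by simp_all
    with False show ?thesis by (simp add: Suc.IH)
  qed
qed

text \<open>Consecutive central binomial coefficients have the ratio 2 * (2 * k + 1) / (k + 1), and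
  the induction step amounts to (2 * k + 1) * (2 * k + 3) \<le> 4 * (k + 1) * (k + 1). The squared
  form avoids roots.\<close>

lemma central_binomial_square: "(real ((2 * k) choose k))\<^sup>2 * (2 * real k + 1) \<le> 16 ^ k"
proof (induction k)
  case (Suc k)
  let ?c = "real ((2 * k) choose k)" and ?d = "real ((2 * Suc k) choose Suc k)"
  have "(2 * Suc k) choose Suc k = 2 * (Suc (2 * k) choose Suc k)"
    using binomial_symmetric[of k "Suc (2 * k)"] by (simp add: Suc_diff_le)
  then have "?d = 2 * real (Suc (2 * k) choose Suc k)" by simp
  moreover have "real (Suc k) * real (Suc (2 * k) choose Suc k) = real (Suc (2 * k)) * ?c"
    using Suc_times_binomial[of k "2 * k"] by (metis of_nat_mult)
  ultimately have d: "(real k + 1) * ?d = 2 * (2 * real k + 1) * ?c"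
    by (simp add: algebra_simps)
  have "(real k + 1)\<^sup>2 * (?d\<^sup>2 * (2 * real (Suc k) + 1)) = ((real k + 1) * ?d)\<^sup>2 * (2 * real k + 3)"
    by (simp add: power_mult_distrib)
  also have "\<dots> = (?c\<^sup>2 * (2 * real k + 1)) * (4 * (2 * real k + 1) * (2 * real k + 3))"
    unfolding d by (simp add: power2_eq_square algebra_simps)
  also have "\<dots> \<le> 16 ^ k * (16 * (real k + 1)\<^sup>2)"
    by (rule mult_mono[OF Suc.IH]) (auto simp: power2_eq_square algebra_simps)
  finally have "(real k + 1)\<^sup>2 * (?d\<^sup>2 * (2 * real (Suc k) + 1)) \<le> (real k + 1)\<^sup>2 * 16 ^ Suc k"
    by simp
  then show ?case by (simp add: mult_le_cancel_left_pos)
qed simp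

text \<open>The local limit bound in one dimension, read off from the largest binomial coefficient
  of the row.\<close>

lemma sign_walks_le: "sign_walks g t \<le> 2 ^ g / sqrt (real g + 1)"
proof -
  have even: "real ((2 * k) choose k) \<le> 4 ^ k / sqrt (2 * real k + 1)" for k
  proof -
    have "sqrt ((real ((2 * k) choose k))\<^sup>2 * (2 * real k + 1)) \<le> sqrt ((4 ^ k)\<^sup>2)"
      using central_binomial_square[of k] by (simp add: power2_eq_square[of "4 ^ k"] flip: power_mult_distrib)
    then have "real ((2 * k) choose k) * sqrt (2 * real k + 1) \<le> 4 ^ k"
      by (simp only: real_sqrt_mult real_sqrt_abs) simp
    then show ?thesis by (simp add: pos_le_divide_eq)
  qed
  have "real (g choose (g div 2)) \<le> 2 ^ g / sqrt (real g + 1)"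
  proof (cases "even g")
    case True
    then obtain k where "g = 2 * k" by (elim evenE)
    then show ?thesis using even[of k] by (simp add: power_mult)
  next
    case False
    then obtain k where k: "g = 2 * k + 1" by (elim oddE)
    \<comment> \<open>For odd \<open>g\<close> the middle entry is half of the central binomial
      coefficient of the next row.\<close>
    have "(2 * Suc k) choose Suc k = 2 * (g choose k)"
      using binomial_symmetric[of k "Suc (2 * k)"] k by (simp add: Suc_diff_le)
    then have "real (g choose k) = real ((2 * Suc k) choose Suc k) / 2" by simp
    also have "\<dots> \<le> 4 ^ Suc k / sqrt (2 * real (Suc k) + 1) / 2"
      by (intro divide_right_mono even) simp
    also have "\<dots> \<le> 4 ^ Suc k / sqrt (real g + 1) / 2"
      by (intro divide_right_mono divide_left_mono mult_pos_pos real_sqrt_le_mono) (auto simp: k)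
    also have "\<dots> = 2 ^ g / sqrt (real g + 1)" by (simp add: k power_mult)
    finally show ?thesis using k by simp
  qed
  moreover have "sign_walks g t \<le> real (g choose (g div 2))"
    using binomial_maximum[of g] by (simp add: sign_walks_eq)
  ultimately show ?thesis by simp
qed

lemma sign_walks_nonneg: "0 \<le> sign_walks g t"
  by (induction g arbitrary: t) auto

text \<open>Summing over lists of all lengths counts visits, as a Green function does. The
  truncation keeps the sums finite; the bounds below depend on it at most through partial sums of a
  convergent series.\<close>

definition short_lists :: "'b set \<Rightarrow> nat \<Rightarrow> 'b list set" where
  "short_lists A n = {bs. set bs \<subseteq> A \<and> length bs \<le> n}"

lemma finite_short_lists: "finite A \<Longrightarrow> finite (short_lists A n)"
  unfolding short_lists_def by (rule finite_lists_length_le)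

lemma short_lists_0 [simp]: "short_lists A 0 = {[]}"
  by (auto simp: short_lists_def)

lemma sum_short_lists_Suc:
  fixes f :: "'b list \<Rightarrow> real"
  assumes "finite A"
  shows "sum f (short_lists A (Suc n)) = f [] + (\<Sum>b\<in>A. \<Sum>bs\<in>short_lists A n. f (b # bs))"
proof -
  have eq: "short_lists A (Suc n) = insert [] ((\<lambda>(b, bs). b # bs) ` (A \<times> short_lists A n))"
  proof (intro equalityI subsetI)
    fix bs assume "bs \<in> short_lists A (Suc n)"
    then show "bs \<in> insert [] ((\<lambda>(b, bs). b # bs) ` (A \<times> short_lists A n))"
      by (cases bs) (auto simp: short_lists_def)
  qed (auto simp: short_lists_def)
  have "sum f ((\<lambda>(b, bs). b # bs) ` (A \<times> short_lists A n)) = (\<Sum>b\<in>A. \<Sum>bs\<in>short_lists A n. f (b # bs))"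
    by (subst sum.reindex) (auto simp: inj_on_def sum.cartesian_product intro: sum.cong)
  then show ?thesis
    unfolding eq using assms by (subst sum.insert) (auto simp: finite_short_lists)
qed

definition disp :: "('b \<Rightarrow> int ^ 'd) \<Rightarrow> 'b list \<Rightarrow> int ^ 'd" where
  "disp X bs = (\<Sum>b\<leftarrow>bs. X b)"

lemma disp_simps [simp]:
  "disp X [] = 0" "disp X (b # bs) = X b + disp X bs" "disp X (bs @ cs) = disp X bs + disp X cs"
  by (auto simp: disp_def)

text \<open>Blocks have positive height, so a sequence of blocks is at the level \<open>l\<close> at
  most once. In the induction only the empty list counts if \<open>l = 0\<close>, and otherwise the
  first block is removed.\<close>

lemma level_visits_le_1:
  fixes X :: "'b \<Rightarrow> int ^ 'd::finite"
  assumes A: "finite A" "\<And>b. 0 \<le> q b" "sum q A \<le> 1" "\<And>b. b \<in> A \<Longrightarrow> 0 < X b $ i"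
  shows "(\<Sum>bs\<in>short_lists A n. seq_weight q bs * of_bool (disp X bs $ i = l)) \<le> 1"
proof (induction n arbitrary: l)
  case (Suc n)
  have nonneg: "0 \<le> disp X bs $ i" if "bs \<in> short_lists A n" for bs
  proof -
    have "set bs \<subseteq> A" using that by (simp add: short_lists_def)
    then show ?thesis using A(4) by (induction bs) (auto intro: add_nonneg_nonneg less_imp_le)
  qed
  have eq: "(\<Sum>bs\<in>short_lists A (Suc n). seq_weight q bs * of_bool (disp X bs $ i = l)) =
      of_bool (l = 0) + (\<Sum>b\<in>A. q b * (\<Sum>bs\<in>short_lists A n. seq_weight q bs * of_bool (disp X bs $ i = l - X b $ i)))"
    by (subst sum_short_lists_Suc[OF A(1)])
       (auto simp: sum_distrib_left mult.assoc algebra_simps intro!: sum.cong)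
  show ?case
  proof (cases "l = 0")
    case True
    have "(\<Sum>b\<in>A. q b * (\<Sum>bs\<in>short_lists A n. seq_weight q bs * of_bool (disp X bs $ i = l - X b $ i))) = 0"
      using True A(4) nonneg by (intro sum.neutral ballI) (fastforce intro!: sum.neutral)
    then show ?thesis using eq True by simp
  next
    case False
    have "(\<Sum>b\<in>A. q b * (\<Sum>bs\<in>short_lists A n. seq_weight q bs * of_bool (disp X bs $ i = l - X b $ i)))
        \<le> (\<Sum>b\<in>A. q b * 1)"
      by (intro sum_mono mult_left_mono Suc.IH A(2))
    then show ?thesis using eq False A(3) by simp
  qed
qed simp

text \<open>\<open>q\<close> is a subprobability on blocks with displacements \<open>X\<close>. The
  special block \<open>s J\<close> moves by - 1 in the directions in \<open>J\<close> and by 1 in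
  the others of \<open>T\<close>. The eight special blocks have total mass \<eta>, so given that a
  block is special, its displacement along \<open>T\<close> is uniform on the sign vectors.\<close>

locale block_family =
  fixes A :: "'b set" and q :: "'b \<Rightarrow> real" and X :: "'b \<Rightarrow> int ^ 'd::finite" and i :: 'd
    and s :: "'d set \<Rightarrow> 'b" and T :: "'d set" and \<eta> :: real
  assumes finite_A: "finite A" and q_nonneg: "\<And>b. 0 \<le> q b" and sum_q: "sum q A \<le> 1"
    and X_level: "\<And>b. b \<in> A \<Longrightarrow> 0 < X b $ i"
    and T: "card T = 3" "i \<notin> T"
    and s: "inj_on s (Pow T)" "s ` Pow T \<subseteq> A" "\<And>J. J \<subseteq> T \<Longrightarrow> q (s J) = \<eta> / 8"
    and \<eta>: "0 < \<eta>"
    and X_s: "\<And>J. J \<subseteq> T \<Longrightarrow> X (s J) $ i = 1" "\<And>J c. J \<subseteq> T \<Longrightarrow> c \<in> T \<Longrightarrow> X (s J) $ c = (if c \<in> J then - 1 else 1)"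
begin

lemma finite_T: "finite T"
  using T(1) card.infinite by fastforce

lemma sum_s: "(\<Sum>b\<in>s ` Pow T. f b) = (\<Sum>J\<in>Pow T. f (s J))"
  by (rule sum.reindex_cong[OF s(1)]) auto

lemma sum_q_s: "(\<Sum>b\<in>s ` Pow T. q b) = \<eta>"
  by (simp add: sum_s s(3) card_Pow finite_T T(1))

lemma sum_q_rest: "(\<Sum>b\<in>A - s ` Pow T. q b) \<le> 1 - \<eta>"
  using sum_q sum.subset_diff[OF s(2) finite_A, of q] sum_q_s by simp

lemma \<eta>_le_1: "\<eta> \<le> 1"
  using sum_q_rest sum_nonneg[of "A - s ` Pow T" q] q_nonneg by force

text \<open>\<open>8 ^ k\<close> times the probability that \<open>k\<close> independent uniform
  sign vectors on \<open>T\<close> add up to \<open>y\<close> in these three coordinates.\<close>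

definition kernel :: "nat \<Rightarrow> int ^ 'd \<Rightarrow> real" where
  "kernel k y = (\<Prod>c\<in>T. sign_walks k (y $ c))"

lemma kernel_nonneg: "0 \<le> kernel k y"
  unfolding kernel_def by (intro prod_nonneg) (simp add: sign_walks_nonneg)

lemma kernel_0: "kernel 0 0 = 1"
  by (simp add: kernel_def)

lemma kernel_le: "kernel k y \<le> 8 ^ k * (1 / sqrt (real k + 1)) ^ 3"
proof -
  have "kernel k y \<le> (\<Prod>c\<in>T. 2 ^ k / sqrt (real k + 1))"
    unfolding kernel_def by (intro prod_mono) (auto simp: sign_walks_nonneg sign_walks_le)
  also have "\<dots> = (2 ^ k) ^ 3 * (1 / sqrt (real k + 1)) ^ 3"
    by (simp add: T(1) power_divide)
  also have "(2 ^ k) ^ 3 = (8 :: real) ^ k"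
    by (simp add: power_mult[symmetric] mult.commute[of k] power_mult[of 2 3 k])
  finally show ?thesis .
qed

text \<open>A product of sums expands into a sum over subsets of \<open>T\<close>, here the sets of
  minus signs. As \<open>i\<close> lies outside \<open>T\<close>, the shift by
  \<open>axis i 1\<close> does not change the kernel; it records the height of the special block for
  \<open>smoothed_Suc\<close>.\<close>

lemma kernel_Suc: "(\<Sum>J\<in>Pow T. kernel k (y - X (s J))) = kernel (Suc k) (y - axis i 1)"
proof -
  have "kernel (Suc k) (y - axis i 1) = (\<Prod>c\<in>T. sign_walks k (y $ c + 1) + sign_walks k (y $ c - 1))"
    unfolding kernel_def using T(2) by (intro prod.cong) (auto simp: axis_def)
  also have "\<dots> = (\<Sum>J\<in>Pow T. (\<Prod>c\<in>J. sign_walks k (y $ c + 1)) * (\<Prod>c\<in>T - J. sign_walks k (y $ c - 1)))"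
    by (rule prod_add[OF finite_T])
  also have "\<dots> = (\<Sum>J\<in>Pow T. kernel k (y - X (s J)))"
  proof (intro sum.cong refl)
    fix J assume "J \<in> Pow T"
    then have J: "J \<subseteq> T" by simp
    have "kernel k (y - X (s J)) =
        (\<Prod>c\<in>T - J. sign_walks k ((y - X (s J)) $ c)) * (\<Prod>c\<in>J. sign_walks k ((y - X (s J)) $ c))"
      unfolding kernel_def by (rule prod.subset_diff[OF J finite_T])
    also have "(\<Prod>c\<in>T - J. sign_walks k ((y - X (s J)) $ c)) = (\<Prod>c\<in>T - J. sign_walks k (y $ c - 1))"
      using X_s(2)[OF J] by (intro prod.cong) auto
    also have "(\<Prod>c\<in>J. sign_walks k ((y - X (s J)) $ c)) = (\<Prod>c\<in>J. sign_walks k (y $ c + 1))"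
      using X_s(2)[OF J] J by (intro prod.cong) auto
    finally show "(\<Prod>c\<in>J. sign_walks k (y $ c + 1)) * (\<Prod>c\<in>T - J. sign_walks k (y $ c - 1)) = kernel k (y - X (s J))"
      by simp
  qed
  finally show ?thesis by simp
qed

text \<open>
  The expected number of visits to \<open>z\<close>, up to a shift by \<open>w\<close>, with the point mass at \<open>z\<close> replaced by the
  number of ways in which \<open>k\<close> special blocks can make up for the displacement in the directions \<open>T\<close>.
\<close>

definition smoothed :: "nat \<Rightarrow> int ^ 'd \<Rightarrow> nat \<Rightarrow> int ^ 'd \<Rightarrow> real" where
  "smoothed n w k z = (\<Sum>cs\<in>short_lists A n. seq_weight q cs *
     (of_bool (disp X cs $ i + w $ i = z $ i) * kernel k (disp X cs + w - z)))"

text \<open>Once the kernel is bounded uniformly, what remains is the expected number of visits to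
  one level, at most 1.\<close>

lemma smoothed_le: "smoothed n w k z \<le> 8 ^ k * (1 / sqrt (real k + 1)) ^ 3"
proof -
  let ?K = "8 ^ k * (1 / sqrt (real k + 1)) ^ 3"
  have "smoothed n w k z \<le> (\<Sum>cs\<in>short_lists A n. seq_weight q cs * (of_bool (disp X cs $ i = z $ i - w $ i) * ?K))"
    unfolding smoothed_def
    by (intro sum_mono mult_left_mono mult_mono seq_weight_nonneg q_nonneg kernel_le kernel_nonneg) auto
  also have "\<dots> = (\<Sum>cs\<in>short_lists A n. seq_weight q cs * of_bool (disp X cs $ i = z $ i - w $ i)) * ?K"
    by (simp add: sum_distrib_right mult.assoc)
  also have "\<dots> \<le> 1 * ?K"
    using level_visits_le_1[of A q X i, where n = n and l = "z $ i - w $ i"] finite_A q_nonneg sum_q X_level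
    by (intro mult_right_mono) auto
  finally show ?thesis by simp
qed

lemma smoothed_nonneg: "0 \<le> smoothed n w k z"
  unfolding smoothed_def
  by (intro sum_nonneg mult_nonneg_nonneg seq_weight_nonneg q_nonneg kernel_nonneg) auto

lemma smoothed_Suc: "(\<Sum>J\<in>Pow T. smoothed n w k (z + X (s J))) = smoothed n w (Suc k) (z + axis i 1)"
proof -
  have "(\<Sum>J\<in>Pow T. smoothed n w k (z + X (s J))) = (\<Sum>J\<in>Pow T. \<Sum>cs\<in>short_lists A n. seq_weight q cs *
      (of_bool (disp X cs $ i + w $ i = z $ i + 1) * kernel k (disp X cs + w - z - X (s J))))"
    unfolding smoothed_def by (intro sum.cong refl) (simp add: X_s(1) diff_diff_eq)
  also have "\<dots> = (\<Sum>cs\<in>short_lists A n. seq_weight q cs *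
      (of_bool (disp X cs $ i + w $ i = z $ i + 1) * (\<Sum>J\<in>Pow T. kernel k (disp X cs + w - z - X (s J)))))"
    by (subst sum.swap) (simp only: sum_distrib_left)
  also have "\<dots> = smoothed n w (Suc k) (z + axis i 1)"
    unfolding smoothed_def kernel_Suc by (simp add: diff_diff_eq axis_def)
  finally show ?thesis .
qed

definition specials :: "'b list \<Rightarrow> nat" where
  "specials bs = length (filter (\<lambda>b. b \<in> s ` Pow T) bs)"

text \<open>The number of special blocks keeps a given value for at most 1 / \<eta> blocks in the
  mean. A special first block averages the target over eight displacements; by
  \<open>smoothed_Suc\<close> this turns \<open>k\<close> into \<open>k + 1\<close> and
  \<open>g\<close> into \<open>g - 1\<close>, so \<open>k + g\<close> is invariant, and the growth
  of \<open>8 ^ k\<close> is compensated by the mass \<eta> / 8.\<close>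

lemma specials_smoothed:
  "(\<Sum>bs\<in>short_lists A n. seq_weight q bs * (of_bool (specials bs = g) * smoothed n' w k (z + disp X bs)))
     \<le> 8 ^ k * (1 / sqrt (real (k + g) + 1)) ^ 3 / \<eta>"
proof (induction n arbitrary: g k z)
  case 0
  have "smoothed n' w k z \<le> 8 ^ k * (1 / sqrt (real k + 1)) ^ 3 / \<eta>"
    using smoothed_le[of n' w k z] smoothed_nonneg[of n' w k z] \<eta> \<eta>_le_1 by (simp add: pos_le_divide_eq mult_left_le order_trans)
  then show ?case using \<eta> by (auto simp: specials_def)
next
  case (Suc n)
  let ?S = "\<lambda>g k z. \<Sum>bs\<in>short_lists A n. seq_weight q bs * (of_bool (specials bs = g) * smoothed n' w k (z + disp X bs))"
  let ?R = "\<lambda>g k. 8 ^ k * (1 / sqrt (real (k + g) + 1)) ^ 3"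
  have eq: "(\<Sum>bs\<in>short_lists A (Suc n). seq_weight q bs * (of_bool (specials bs = g) * smoothed n' w k (z + disp X bs))) =
      of_bool (g = 0) * smoothed n' w k z +
      (\<Sum>b\<in>A. \<Sum>bs\<in>short_lists A n. seq_weight q (b # bs) * (of_bool (specials (b # bs) = g) * smoothed n' w k (z + disp X (b # bs))))"
    by (subst sum_short_lists_Suc[OF finite_A]) (auto simp: specials_def)
  also have "(\<Sum>b\<in>A. \<Sum>bs\<in>short_lists A n. seq_weight q (b # bs) * (of_bool (specials (b # bs) = g) * smoothed n' w k (z + disp X (b # bs))))
     = (\<Sum>b\<in>A - s ` Pow T. q b * ?S g k (z + X b)) +
       (\<Sum>J\<in>Pow T. \<Sum>bs\<in>short_lists A n. \<eta> / 8 * (seq_weight q bs * (of_bool (Suc (specials bs) = g) * smoothed n' w k ((z + disp X bs) + X (s J)))))"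
    unfolding sum.subset_diff[OF s(2) finite_A] sum_s
    by (intro arg_cong2[where f = "(+)"] sum.cong)
       (auto simp: specials_def sum_distrib_left mult.assoc add_ac s(3))
  also have "(\<Sum>J\<in>Pow T. \<Sum>bs\<in>short_lists A n. \<eta> / 8 * (seq_weight q bs * (of_bool (Suc (specials bs) = g) * smoothed n' w k ((z + disp X bs) + X (s J)))))
     = \<eta> / 8 * (\<Sum>bs\<in>short_lists A n. seq_weight q bs * (of_bool (Suc (specials bs) = g) * smoothed n' w (Suc k) ((z + axis i 1) + disp X bs)))"
  proof -
    have "(\<Sum>J\<in>Pow T. smoothed n' w k ((z + disp X bs) + X (s J))) = smoothed n' w (Suc k) ((z + axis i 1) + disp X bs)" for bs
      using smoothed_Suc[of n' w k "z + disp X bs"] by (simp only: add_ac)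
    then show ?thesis
      by (subst sum.swap) (simp only: sum_distrib_left[symmetric])
  qed
  finally have eq': "(\<Sum>bs\<in>short_lists A (Suc n). seq_weight q bs * (of_bool (specials bs = g) * smoothed n' w k (z + disp X bs))) =
    of_bool (g = 0) * smoothed n' w k z + ((\<Sum>b\<in>A - s ` Pow T. q b * ?S g k (z + X b)) +
      \<eta> / 8 * (\<Sum>bs\<in>short_lists A n. seq_weight q bs * (of_bool (Suc (specials bs) = g) * smoothed n' w (Suc k) ((z + axis i 1) + disp X bs))))" .
  have R_nonneg: "0 \<le> ?R g k" for g k by simp
  have "(\<Sum>b\<in>A - s ` Pow T. q b * ?S g k (z + X b)) \<le> (\<Sum>b\<in>A - s ` Pow T. q b * (?R g k / \<eta>))"
    by (intro sum_mono mult_left_mono Suc.IH q_nonneg)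
  also have "\<dots> \<le> (1 - \<eta>) * (?R g k / \<eta>)"
    unfolding sum_distrib_right[symmetric] by (intro mult_right_mono sum_q_rest divide_nonneg_pos R_nonneg \<eta>)
  finally have rest: "(\<Sum>b\<in>A - s ` Pow T. q b * ?S g k (z + X b)) \<le> (1 - \<eta>) * (?R g k / \<eta>)" .
  show ?case
  proof (cases g)
    case 0
    then have "smoothed n' w k z \<le> ?R g k" using smoothed_le[of n' w k z] by simp
    \<comment> \<open>The right side is the fixed point of the recursion: a mass of at most 1 -
      \<eta> reproduces the bound, and \<open>?R g k\<close> is added once.\<close>
    moreover have "?R g k + (1 - \<eta>) * (?R g k / \<eta>) = ?R g k / \<eta>"
      using \<eta> by (simp add: field_simps)
    ultimately show ?thesis using eq' rest 0 by simp
  next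
    case (Suc g')
    have "\<eta> / 8 * ?S g' (Suc k) (z + axis i 1) \<le> \<eta> / 8 * (?R g' (Suc k) / \<eta>)"
      using \<eta> by (intro mult_left_mono Suc.IH) auto
    also have "\<dots> = ?R g k" using \<eta> by (simp add: Suc)
    moreover have "?R g k + (1 - \<eta>) * (?R g k / \<eta>) = ?R g k / \<eta>"
      using \<eta> by (simp add: field_simps)
    ultimately show ?thesis using eq' rest Suc by simp
  qed
qed

text \<open>Splitting by the number \<open>g\<close> of special blocks in the first sequence yields
  the decay. A coincidence is relaxed to agreement of the level and of the directions
  \<open>T\<close>, the latter being \<open>kernel 0\<close>; from the second sequence only the
  bound on visits to a level is drawn.\<close>

lemma coincidence_bound:
  "(\<Sum>bs\<in>short_lists A n. \<Sum>cs\<in>short_lists A n'. seq_weight q bs * seq_weight q cs * of_bool (disp X bs = disp X cs + w))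
     \<le> (\<Sum>g\<le>n. (1 / sqrt (real g + 1)) ^ 3) / \<eta>"
proof -
  have "(\<Sum>bs\<in>short_lists A n. \<Sum>cs\<in>short_lists A n'. seq_weight q bs * seq_weight q cs * of_bool (disp X bs = disp X cs + w))
      \<le> (\<Sum>bs\<in>short_lists A n. seq_weight q bs * smoothed n' w 0 (disp X bs))"
  proof (intro sum_mono)
    fix bs
    have "of_bool (disp X bs = disp X cs + w) \<le>
        of_bool (disp X cs $ i + w $ i = disp X bs $ i) * kernel 0 (disp X cs + w - disp X bs)" for cs
      by (auto simp: kernel_0 kernel_nonneg)
    then have "(\<Sum>cs\<in>short_lists A n'. seq_weight q cs * of_bool (disp X bs = disp X cs + w)) \<le> smoothed n' w 0 (disp X bs)"
      unfolding smoothed_def by (intro sum_mono mult_left_mono seq_weight_nonneg q_nonneg)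
    then have "seq_weight q bs * (\<Sum>cs\<in>short_lists A n'. seq_weight q cs * of_bool (disp X bs = disp X cs + w)) \<le>
        seq_weight q bs * smoothed n' w 0 (disp X bs)"
      by (intro mult_left_mono seq_weight_nonneg q_nonneg)
    then show "(\<Sum>cs\<in>short_lists A n'. seq_weight q bs * seq_weight q cs * of_bool (disp X bs = disp X cs + w))
        \<le> seq_weight q bs * smoothed n' w 0 (disp X bs)"
      by (simp add: sum_distrib_left mult.assoc)
  qed
  also have "\<dots> = (\<Sum>bs\<in>short_lists A n. \<Sum>g\<le>n. seq_weight q bs * (of_bool (specials bs = g) * smoothed n' w 0 (0 + disp X bs)))"
  proof (intro sum.cong refl)
    fix bs assume "bs \<in> short_lists A n"
    then have "specials bs \<le> n"
      unfolding specials_def short_lists_def by (auto intro: order_trans[OF length_filter_le])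
    then show "seq_weight q bs * smoothed n' w 0 (disp X bs) =
        (\<Sum>g\<le>n. seq_weight q bs * (of_bool (specials bs = g) * smoothed n' w 0 (0 + disp X bs)))"
      by (simp add: of_bool_def if_distrib if_distribR cong: if_cong)
  qed
  also have "\<dots> = (\<Sum>g\<le>n. \<Sum>bs\<in>short_lists A n. seq_weight q bs * (of_bool (specials bs = g) * smoothed n' w 0 (0 + disp X bs)))"
    by (rule sum.swap)
  also have "\<dots> \<le> (\<Sum>g\<le>n. 8 ^ 0 * (1 / sqrt (real (0 + g) + 1)) ^ 3 / \<eta>)"
    by (intro sum_mono specials_smoothed)
  also have "\<dots> = (\<Sum>g\<le>n. (1 / sqrt (real g + 1)) ^ 3) / \<eta>"
    by (simp add: sum_divide_distrib)
  finally show ?thesis .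
qed

end

lemma summable_inverse_sqrt_cube: "summable (\<lambda>g. (1 / sqrt (real g + 1)) ^ 3)"
proof -
  have "summable (\<lambda>n. real n powr (- 3 / 2))"
    by (subst summable_real_powr_iff) simp
  then have "summable (\<lambda>n. real (Suc n) powr (- 3 / 2))"
    by (subst summable_Suc_iff)
  moreover have "real (Suc n) powr (- 3 / 2) = (1 / sqrt (real n + 1)) ^ 3" for n
  proof -
    have "(1 / sqrt (real n + 1)) = real (Suc n) powr (- 1 / 2)"
      by (simp add: powr_half_sqrt[symmetric] powr_minus_divide add.commute)
    then show ?thesis by (simp add: powr_power)
  qed
  ultimately show ?thesis by simp
qed

section \<open>Overlap of two sequences of bridges\<close>

definition overlap :: "int ^ 'd::finite \<Rightarrow> (int ^ 'd) list \<Rightarrow> (int ^ 'd) list \<Rightarrow> real" where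
  "overlap y u v = real (size (sites u \<inter># translate y (sites v)))"

definition meet :: "int ^ 'd::finite \<Rightarrow> (int ^ 'd) list \<Rightarrow> (int ^ 'd) list \<Rightarrow> bool" where
  "meet y u v \<longleftrightarrow> set_mset (sites u) \<inter> (+) y ` set_mset (sites v) \<noteq> {}"

lemma overlap_Nil [simp]: "overlap y [] v = 0" "overlap y u [] = 0"
  by (simp_all add: overlap_def)

lemma overlap_le: "overlap y u v \<le> length u" "overlap y u v \<le> length v"
  using size_inter_le[of "sites u" "translate y (sites v)"] by (auto simp: overlap_def)

lemma overlap_eq_0: "\<not> meet y u v \<Longrightarrow> overlap y u v = 0"
  using set_mset_eq_empty_iff[of "sites u \<inter># translate y (sites v)"] by (simp add: overlap_def meet_def)

lemma size_translate_inter_overlap: "real (size (translate x (sites u) \<inter># translate y (sites v))) = overlap (y - x) u v"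
  by (simp add: overlap_def size_translate_inter)

lemma overlap_append_left: "overlap y (u @ u') v \<le> overlap y u v + overlap (y - sum_list u) u' v"
proof -
  have "overlap y (u @ u') v \<le> overlap y u v + real (size (translate (sum_list u) (sites u') \<inter># translate y (sites v)))"
    unfolding overlap_def sites_append using size_add_inter_le of_nat_mono by (metis of_nat_add)
  then show ?thesis by (simp add: size_translate_inter_overlap)
qed

lemma overlap_append_right: "overlap y u (v @ v') \<le> overlap y u v + overlap (y + sum_list v) u v'"
proof -
  have "overlap y u (v @ v') \<le> overlap y u v + real (size (sites u \<inter># translate y (translate (sum_list v) (sites v'))))"
    unfolding overlap_def sites_append translate_simps
    using size_inter_add_le of_nat_mono by (metis of_nat_add)
  then show ?thesis by (simp add: overlap_def)
qed

text \<open>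
  Levels increase along bridges: if a bridge \<open>b\<close> meets a bridge \<open>c\<close>, then what follows \<open>b\<close> lies above
  everything that precedes \<open>c\<close>.
\<close>

lemma overlap_after_meeting:
  assumes b: "irred_bridge i b" and bs: "\<forall>b\<in>set bs. irred_bridge i b"
    and cs: "\<forall>c\<in>set (cs1 @ c # cs2). irred_bridge i c"
    and meet: "meet (y + sum_list (concat cs1)) b c"
  shows "overlap (y - sum_list b) (concat bs) (concat (cs1 @ c # cs2)) \<le>
    length c + overlap (y + sum_list (concat cs1) + sum_list c - sum_list b) (concat bs) (concat cs2)"
proof -
  obtain x x' where x: "x \<in># sites b" "x' \<in># sites c" "x = y + sum_list (concat cs1) + x'"
    using meet by (auto simp: meet_def)
  have "x $ i \<le> sum_list b $ i" "0 < x' $ i"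
    using b cs x(1,2) by (auto simp: irred_bridge_def below_end_def stays_above_def)
  then have low: "y $ i + sum_list (concat cs1) $ i < sum_list b $ i" using x(3) by simp
  have "\<not> meet (y - sum_list b) (concat bs) (concat cs1)"
  proof
    assume "meet (y - sum_list b) (concat bs) (concat cs1)"
    then obtain z z' where z: "z \<in># sites (concat bs)" "z' \<in># sites (concat cs1)" "z = y - sum_list b + z'"
      by (auto simp: meet_def)
    have "0 < z $ i" "z' $ i \<le> sum_list (concat cs1) $ i"
      using irred_concat(1)[OF bs] irred_concat(2)[of cs1 i] cs z(1,2) by (auto simp: stays_above_def below_end_def)
    then show False using z(3) low by simp
  qed
  then have 0: "overlap (y - sum_list b) (concat bs) (concat cs1) = 0" by (rule overlap_eq_0)
  have "overlap (y - sum_list b) (concat bs) (concat cs1 @ c @ concat cs2) \<le>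
      overlap (y - sum_list b) (concat bs) (concat cs1) +
      (overlap (y - sum_list b + sum_list (concat cs1)) (concat bs) c +
       overlap (y - sum_list b + sum_list (concat cs1) + sum_list c) (concat bs) (concat cs2))"
    by (intro order_trans[OF overlap_append_right] add_left_mono overlap_append_right)
  also have "\<dots> \<le> 0 + (length c + overlap (y - sum_list b + sum_list (concat cs1) + sum_list c) (concat bs) (concat cs2))"
    using 0 overlap_le(2) by (intro add_mono) auto
  finally show ?thesis by (simp add: algebra_simps)
qed

text \<open>The price of a meeting of \<open>b\<close> with \<open>c\<close>: \<open>b\<close>
  overlaps with the other word in at most \<open>length b\<close> sites, later blocks overlap with
  \<open>c\<close> in at most \<open>length c\<close>, and the last factor is the overlap of what
  follows the two blocks, at their relative displacement.\<close>

definition meeting_term ::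
  "real \<Rightarrow> int ^ 'd::finite \<Rightarrow> (int ^ 'd) list list \<Rightarrow> (int ^ 'd) list \<Rightarrow> (int ^ 'd) list list \<Rightarrow>
     (int ^ 'd) list list \<Rightarrow> (int ^ 'd) list \<Rightarrow> (int ^ 'd) list list \<Rightarrow> real" where
  "meeting_term \<epsilon> y bs1 b bs2 cs1 c cs2 =
     of_bool (meet (y + sum_list (concat cs1) - sum_list (concat bs1)) b c) *
     ((exp (\<epsilon> * length b) - 1) * exp (\<epsilon> * length c)) *
     exp (\<epsilon> * overlap (y + sum_list (concat cs1) + sum_list c - sum_list (concat bs1) - sum_list b) (concat bs2) (concat cs2))"

lemma meeting_term_nonneg: "0 \<le> \<epsilon> \<Longrightarrow> 0 \<le> meeting_term \<epsilon> y bs1 b bs2 cs1 c cs2"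
  unfolding meeting_term_def by (intro mult_nonneg_nonneg) auto

text \<open>Write exp (x + z) as exp z + (exp x - 1) * exp z, with x the overlap of
  \<open>b\<close>. The second summand vanishes unless \<open>b\<close> meets a block of
  \<open>cs\<close>, and any such block can be used to split \<open>cs\<close>, by
  \<open>overlap_after_meeting\<close>.\<close>

lemma exp_overlap_Cons:
  assumes \<epsilon>: "0 \<le> \<epsilon>" and b: "irred_bridge i b" and bs: "\<forall>b\<in>set bs. irred_bridge i b"
    and cs: "\<forall>c\<in>set cs. irred_bridge i c"
  shows "exp (\<epsilon> * overlap y (concat (b # bs)) (concat cs)) \<le>
    exp (\<epsilon> * overlap (y - sum_list b) (concat bs) (concat cs)) +
    (\<Sum>j<length cs. meeting_term \<epsilon> y [] b bs (take j cs) (cs ! j) (drop (Suc j) cs))"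
proof -
  let ?O = "overlap y b (concat cs)" and ?I = "overlap (y - sum_list b) (concat bs) (concat cs)"
  have "overlap y (concat (b # bs)) (concat cs) \<le> ?O + ?I"
    using overlap_append_left[of y b "concat bs"] by simp
  then have le: "exp (\<epsilon> * overlap y (concat (b # bs)) (concat cs)) \<le> exp (\<epsilon> * ?O) * exp (\<epsilon> * ?I)"
    using \<epsilon> by (simp add: mult_left_mono flip: exp_add distrib_left)
  show ?thesis
  proof (cases "meet y b (concat cs)")
    case False
    then have "?O = 0" by (rule overlap_eq_0)
    with le have "exp (\<epsilon> * overlap y (concat (b # bs)) (concat cs)) \<le> exp (\<epsilon> * ?I)"
      by (simp only: mult_zero_right exp_zero mult_1)
    moreover have "0 \<le> (\<Sum>j<length cs. meeting_term \<epsilon> y [] b bs (take j cs) (cs ! j) (drop (Suc j) cs))"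
      by (intro sum_nonneg meeting_term_nonneg \<epsilon>)
    ultimately show ?thesis by linarith
  next
    case True
    have "\<exists>j<length cs. meet (y + sum_list (concat (take j cs))) b (cs ! j)"
      using True
    proof (induction cs arbitrary: y)
      case Nil
      then show ?case by (simp add: meet_def)
    next
      case (Cons c cs)
      then consider "meet y b c" | "meet (y + sum_list c) b (concat cs)"
        by (auto simp: meet_def sites_append image_Un image_image add.assoc)
      then show ?case
      proof cases
        case 1
        then show ?thesis by (intro exI[of _ 0]) simp
      next
        case 2
        then obtain j where "j < length cs" "meet (y + sum_list c + sum_list (concat (take j cs))) b (cs ! j)"
          using Cons.IH by blast
        then show ?thesis by (intro exI[of _ "Suc j"]) (simp add: add.assoc)
      qed
    qed
    then obtain j where j: "j < length cs" "meet (y + sum_list (concat (take j cs))) b (cs ! j)" by blast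
    have split: "take j cs @ cs ! j # drop (Suc j) cs = cs" by (rule id_take_nth_drop[OF j(1), symmetric])
    have "?I \<le> length (cs ! j) + overlap (y + sum_list (concat (take j cs)) + sum_list (cs ! j) - sum_list b)
        (concat bs) (concat (drop (Suc j) cs))"
      using overlap_after_meeting[OF b bs _ j(2), of "drop (Suc j) cs"] cs unfolding split by simp
    then have I: "exp (\<epsilon> * ?I) \<le> exp (\<epsilon> * length (cs ! j)) *
        exp (\<epsilon> * overlap (y + sum_list (concat (take j cs)) + sum_list (cs ! j) - sum_list b)
          (concat bs) (concat (drop (Suc j) cs)))"
      using \<epsilon> by (simp add: mult_left_mono flip: exp_add distrib_left)
    have "exp (\<epsilon> * ?O) * exp (\<epsilon> * ?I) = exp (\<epsilon> * ?I) + (exp (\<epsilon> * ?O) - 1) * exp (\<epsilon> * ?I)"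
      by (simp add: algebra_simps)
    also have "(exp (\<epsilon> * ?O) - 1) * exp (\<epsilon> * ?I) \<le> (exp (\<epsilon> * length b) - 1) * (exp (\<epsilon> * length (cs ! j)) *
        exp (\<epsilon> * overlap (y + sum_list (concat (take j cs)) + sum_list (cs ! j) - sum_list b)
          (concat bs) (concat (drop (Suc j) cs))))"
      using \<epsilon> overlap_le(1)[of y b "concat cs"] by (intro mult_mono I) (auto simp: mult_left_mono)
    also have "\<dots> = meeting_term \<epsilon> y [] b bs (take j cs) (cs ! j) (drop (Suc j) cs)"
      using j(2) by (simp add: meeting_term_def mult.assoc)
    also have "\<dots> \<le> (\<Sum>j<length cs. meeting_term \<epsilon> y [] b bs (take j cs) (cs ! j) (drop (Suc j) cs))"
      using j(1) by (intro member_le_sum[of j, where f = "\<lambda>j. meeting_term \<epsilon> y [] b bs (take j cs) (cs ! j) (drop (Suc j) cs)"])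
        (auto simp: meeting_term_nonneg \<epsilon>)
    finally show ?thesis using le by linarith
  qed
qed

text \<open>The blocks of \<open>bs\<close> are removed one at a time. Each term exposes a single
  meeting and keeps the exponential of what follows intact; this permits the recursion for
  \<open>pair_sum\<close>.\<close>

lemma exp_overlap_le:
  assumes \<epsilon>: "0 \<le> \<epsilon>" and "\<forall>b\<in>set bs. irred_bridge i b" and cs: "\<forall>c\<in>set cs. irred_bridge i c"
  shows "exp (\<epsilon> * overlap y (concat bs) (concat cs)) \<le> 1 +
    (\<Sum>k<length bs. \<Sum>j<length cs.
       meeting_term \<epsilon> y (take k bs) (bs ! k) (drop (Suc k) bs) (take j cs) (cs ! j) (drop (Suc j) cs))"
  using assms(2)
proof (induction bs arbitrary: y)
  case (Cons b bs)
  have shift: "meeting_term \<epsilon> (y - sum_list b) bs1 b' bs2 cs1 c cs2 = meeting_term \<epsilon> y (b # bs1) b' bs2 cs1 c cs2"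
    for bs1 b' bs2 cs1 c cs2
    by (simp add: meeting_term_def algebra_simps)
  have "exp (\<epsilon> * overlap y (concat (b # bs)) (concat cs)) \<le>
    exp (\<epsilon> * overlap (y - sum_list b) (concat bs) (concat cs)) +
    (\<Sum>j<length cs. meeting_term \<epsilon> y [] b bs (take j cs) (cs ! j) (drop (Suc j) cs))"
    using Cons.prems by (intro exp_overlap_Cons[OF \<epsilon> _ _ cs]) auto
  also have "exp (\<epsilon> * overlap (y - sum_list b) (concat bs) (concat cs)) \<le> 1 +
    (\<Sum>k<length bs. \<Sum>j<length cs.
       meeting_term \<epsilon> (y - sum_list b) (take k bs) (bs ! k) (drop (Suc k) bs) (take j cs) (cs ! j) (drop (Suc j) cs))"
    using Cons.prems by (intro Cons.IH) auto
  finally show ?case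
    by (simp only: shift length_Cons sum.lessThan_Suc_shift take_Suc_Cons nth_Cons_Suc drop_Suc_Cons take_0 nth_Cons_0
          drop_0 add.assoc add.commute add.left_commute)
qed simp

section \<open>Special bridges\<close>

lemma sites_map:
  assumes "\<And>x y. f (x + y) = f x + f y"
  shows "sites (map f w) = image_mset f (sites w)"
  by (induction w) (simp_all add: assms multiset.map_comp o_def)

lemma count_image_inj: "inj f \<Longrightarrow> count (image_mset f A) (f x) = count A x"
  by (induction A) (auto simp: inj_eq)

lemma site_weight_image: "inj f \<Longrightarrow> site_weight m (image_mset f A) = site_weight m A"
  by (simp add: site_weight_def prod.reindex inj_on_subset count_image_inj)

definition reflect :: "'d set \<Rightarrow> int ^ 'd::finite \<Rightarrow> int ^ 'd" where
  "reflect J x = (\<chi> j. if j \<in> J then - x $ j else x $ j)"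

lemma reflect_nth [simp]: "reflect J x $ j = (if j \<in> J then - x $ j else x $ j)"
  by (simp add: reflect_def)

lemma reflect_add: "reflect J (x + y) = reflect J x + reflect J y"
  by (simp add: vec_eq_iff)

lemma inj_reflect: "inj (reflect J)"
  by (rule injI) (auto simp: vec_eq_iff split: if_splits)

lemma reflect_axis: "reflect J (axis c 1) = (if c \<in> J then - axis c 1 else axis c 1)"
  by (simp add: vec_eq_iff axis_def)

text \<open>The source of the symmetric steps: one step up, then one step in each direction of
  \<open>ds\<close>, reversed on \<open>J\<close>. Reflections that fix the level map these words to
  each other, so their weights agree.\<close>

definition special_word :: "'d::finite \<Rightarrow> 'd list \<Rightarrow> 'd set \<Rightarrow> (int ^ 'd) list" where
  "special_word i ds J = map (reflect J) (axis i 1 # map (\<lambda>c. axis c 1) ds)"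

lemma axis_in_unit_vectors: "axis c 1 \<in> unit_vectors" "- axis c 1 \<in> unit_vectors"
  by (auto simp: unit_vectors_def)

lemma special_word_in_words: "special_word i ds J \<in> words (Suc (length ds))"
  by (auto simp: special_word_def words_def reflect_axis axis_in_unit_vectors)

lemma sites_level_0:
  "\<forall>e\<in>set w. e $ i = 0 \<Longrightarrow> (\<forall>x\<in>#sites w. x $ i = 0) \<and> sum_list w $ i = 0"
  by (induction w) auto

text \<open>After its first step the word stays at level 1, so no proper final part rises above its
  own starting point.\<close>

lemma irred_bridge_flat:
  assumes "e $ i = 1" "\<forall>x\<in>set w. x $ i = 0"
  shows "irred_bridge i (e # w)"
proof -
  have level: "\<forall>x\<in>#sites w. x $ i = 0" "sum_list w $ i = 0"
    using sites_level_0[OF assms(2)] by auto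
  have "no_cut i (e # w)"
    unfolding no_cut_def
  proof (intro allI impI)
    fix u v
    assume uv: "e # w = u @ v" "u \<noteq> []" "v \<noteq> []"
    then have "set v \<subseteq> set w" by (cases u) auto
    then have "sum_list v $ i = 0" using sites_level_0[of v i] assms(2) by auto
    then show "\<not> stays_above i v"
      using stays_above_sum_list[of i v] uv(3) by auto
  qed
  then show ?thesis
    using level assms(1) by (auto simp: irred_bridge_def stays_above_def below_end_def)
qed

lemma irred_special_word: "i \<notin> set ds \<Longrightarrow> i \<notin> J \<Longrightarrow> irred_bridge i (special_word i ds J)"
  unfolding special_word_def list.map by (rule irred_bridge_flat) (auto simp: axis_def)

lemma sum_list_special_word_nth:
  assumes "distinct ds" "i \<notin> set ds"
  shows "i \<notin> J \<Longrightarrow> sum_list (special_word i ds J) $ i = 1"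
    and "c \<in> set ds \<Longrightarrow> sum_list (special_word i ds J) $ c = (if c \<in> J then - 1 else 1)"
proof -
  have axes: "sum_list (map (reflect J) (map (\<lambda>c. axis c 1) ds)) $ c =
      (if c \<in> set ds then (if c \<in> J then - 1 else 1) else 0)" for c
    using assms(1) by (induction ds) (auto simp: axis_def)
  show "i \<notin> J \<Longrightarrow> sum_list (special_word i ds J) $ i = 1"
    using axes[of i] assms(2) by (simp add: special_word_def axis_def)
  show "c \<in> set ds \<Longrightarrow> sum_list (special_word i ds J) $ c = (if c \<in> J then - 1 else 1)"
    using axes[of c] assms(2) by (auto simp: special_word_def axis_def)
qed

lemma inj_on_special_word:
  assumes "distinct ds" "i \<notin> set ds"
  shows "inj_on (special_word i ds) (Pow (set ds))"
proof (rule inj_onI)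
  fix J J' assume J: "J \<in> Pow (set ds)" "J' \<in> Pow (set ds)" "special_word i ds J = special_word i ds J'"
  have "c \<in> J \<longleftrightarrow> c \<in> J'" if "c \<in> set ds" for c
    using sum_list_special_word_nth(2)[OF assms that, of J] sum_list_special_word_nth(2)[OF assms that, of J'] J(3)
    by (auto split: if_splits)
  with J(1,2) show "J = J'" by auto
qed

lemma word_weight_special_word:
  assumes "i \<notin> J"
  shows "word_weight i h (special_word i ds J) = word_weight i h (special_word i ds {})"
proof -
  have "step_weight i h (reflect J (axis c 1)) = step_weight i h (axis c 1)" for c
  proof -
    have "reflect J (axis c 1) \<in> unit_vectors" "axis c 1 \<in> (unit_vectors :: (int ^ 'a) set)"
      by (simp_all add: reflect_axis axis_in_unit_vectors)
    with assms show ?thesis by (simp add: step_weight_eq)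
  qed
  then show ?thesis by (simp add: special_word_def word_weight_def o_def reflect_axis)
qed

lemma step_weight_pos: "e \<in> unit_vectors \<Longrightarrow> 0 < step_weight i h e"
  unfolding step_weight_eq using step_normalizer_pos[of h, where 'd = 'a] by simp

lemma word_weight_pos: "w \<in> words n \<Longrightarrow> 0 < word_weight i h w"
proof (induction w arbitrary: n)
  case (Cons e w)
  then have "e \<in> unit_vectors" "w \<in> words (length w)" by (auto simp: words_def)
  then show ?case using Cons.IH by (simp add: step_weight_pos)
qed simp

section \<open>Blocks of bounded length and marked blocks of a sequence\<close>

lemma disp_sum_list: "disp sum_list bs = sum_list (concat bs)"
  by (induction bs) auto

definition blocks :: "'d::finite \<Rightarrow> nat \<Rightarrow> (int ^ 'd) list set" where
  "blocks i L = (\<Union>k\<le>L. irred_words i k)"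

lemma finite_blocks: "finite (blocks i L)"
  by (simp add: blocks_def finite_irred_words)

lemma sum_blocks: "sum f (blocks i L) = (\<Sum>k\<le>L. \<Sum>b\<in>irred_words i k. f b)"
  unfolding blocks_def
  by (rule sum.UNION_disjoint) (simp_all add: finite_irred_words, auto simp: irred_words_def words_def)

lemma blocksD:
  assumes "b \<in> blocks i L"
  shows "irred_bridge i b" "b \<noteq> []" "length b \<le> L" "0 < sum_list b $ i"
  using assms stays_above_sum_list[of i b]
  by (auto simp: blocks_def irred_words_def words_def irred_bridge_def)

lemma bridge_seqs_short:
  assumes "bs \<in> bridge_seqs i n" "n \<le> L"
  shows "bs \<in> short_lists (blocks i L) L"
proof -
  have "length bs \<le> length (concat bs)" if "\<forall>b\<in>set bs. irred_bridge i b" for bs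
    using that
  proof (induction bs)
    case (Cons b bs)
    then have "1 \<le> length b" by (cases b) (auto simp: irred_bridge_def)
    with Cons show ?case by auto
  qed simp
  moreover have "length b \<le> length (concat bs)" if "b \<in> set bs" for b
    using that by (induction bs) auto
  ultimately show ?thesis
    using assms by (fastforce simp: bridge_seqs_def short_lists_def blocks_def irred_words_def words_def)
qed

text \<open>The prefix of the marked block is released from the length constraint. If prefix and
  block are too long, the truncated subtraction leaves \<open>bridge_seqs i 0\<close>, which only
  adds nonnegative terms.\<close>

lemma sum_bridge_seqs_split:
  fixes i :: "'d::finite" and F :: "(int ^ 'd) list list \<Rightarrow> (int ^ 'd) list \<Rightarrow> (int ^ 'd) list list \<Rightarrow> real"
  assumes "n \<le> L" "\<And>bs1 b bs2. 0 \<le> F bs1 b bs2"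
  shows "(\<Sum>bs\<in>bridge_seqs i n. \<Sum>k<length bs. F (take k bs) (bs ! k) (drop (Suc k) bs)) \<le>
    (\<Sum>bs1\<in>short_lists (blocks i L) L. \<Sum>b\<in>blocks i L. \<Sum>bs2\<in>bridge_seqs i (n - length (concat bs1) - length b). F bs1 b bs2)"
proof -
  let ?S = "SIGMA bs:bridge_seqs i n. {..<length bs}"
  let ?T = "SIGMA bs1:short_lists (blocks i L) L. SIGMA b:blocks i L. bridge_seqs i (n - length (concat bs1) - length b)"
  have "(\<Sum>bs\<in>bridge_seqs i n. \<Sum>k<length bs. F (take k bs) (bs ! k) (drop (Suc k) bs)) =
      (\<Sum>(bs, k)\<in>?S. F (take k bs) (bs ! k) (drop (Suc k) bs))"
    by (simp add: sum.Sigma finite_bridge_seqs)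
  also have "\<dots> \<le> (\<Sum>(bs1, b, bs2)\<in>?T. F bs1 b bs2)"
  proof (rule sum_le_included[where i = "\<lambda>(bs1, b :: (int ^ 'd) list, bs2). (bs1 @ b # bs2, length bs1)"], goal_cases)
    case 4
    show ?case
    proof
      fix x assume "x \<in> ?S"
      then obtain bs k where x: "x = (bs, k)" "bs \<in> bridge_seqs i n" "k < length bs" by auto
      have split: "bs = take k bs @ bs ! k # drop (Suc k) bs" by (rule id_take_nth_drop[OF x(3)])
      have "bs \<in> short_lists (blocks i L) L" using bridge_seqs_short x(2) assms(1) by blast
      then have "take k bs \<in> short_lists (blocks i L) L" "bs ! k \<in> blocks i L"
        using x(3) set_take_subset[of k bs] by (auto simp: short_lists_def)
      moreover have "drop (Suc k) bs \<in> bridge_seqs i (n - length (concat (take k bs)) - length (bs ! k))"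
        using x(2) split by (metis bridge_seqs_append_iff bridge_seqs_Cons_iff)
      ultimately show "\<exists>y\<in>?T. (case y of (bs1, b, bs2) \<Rightarrow> (bs1 @ b # bs2, length bs1)) = x \<and>
          (case x of (bs, k) \<Rightarrow> F (take k bs) (bs ! k) (drop (Suc k) bs)) \<le> (case y of (bs1, b, bs2) \<Rightarrow> F bs1 b bs2)"
        using x(1,3) split[symmetric]
        by (intro bexI[of _ "(take k bs, bs ! k, drop (Suc k) bs)"]) auto
    qed
  qed (auto simp: assms finite_bridge_seqs finite_blocks finite_short_lists)
  also have "\<dots> = (\<Sum>bs1\<in>short_lists (blocks i L) L. \<Sum>b\<in>blocks i L.
      \<Sum>bs2\<in>bridge_seqs i (n - length (concat bs1) - length b). F bs1 b bs2)"
    by (simp add: sum.Sigma finite_bridge_seqs finite_blocks finite_short_lists)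
  finally show ?thesis .
qed

text \<open>A union bound over pairs of sites: for each pair, the meeting becomes a coincidence of
  the starting points of the two blocks up to a fixed shift.\<close>

lemma meet_le_coincidences:
  "of_bool (meet (y + X' - X) b c) \<le>
     (\<Sum>x\<in>set_mset (sites b). \<Sum>x'\<in>set_mset (sites c). of_bool (X = X' + (y + x' - x)) :: real)"
proof (cases "meet (y + X' - X) b c")
  case True
  then obtain x x' where x: "x \<in># sites b" "x' \<in># sites c" "x = y + X' - X + x'"
    by (auto simp: meet_def)
  have "(1 :: real) = of_bool (X = X' + (y + x' - x))" using x(3) by (simp add: algebra_simps)
  also have "\<dots> \<le> (\<Sum>x'\<in>set_mset (sites c). of_bool (X = X' + (y + x' - x)))"
    by (rule member_le_sum[OF x(2)]) auto
  also have "\<dots> \<le> (\<Sum>x\<in>set_mset (sites b). \<Sum>x'\<in>set_mset (sites c). of_bool (X = X' + (y + x' - x)))"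
    by (rule member_le_sum[OF x(1), where f = "\<lambda>x. \<Sum>x'\<in>set_mset (sites c). of_bool (X = X' + (y + x' - x))"])
       (auto intro: sum_nonneg)
  finally show ?thesis using True by simp
qed (auto intro!: sum_nonneg)

lemma card_sites_le: "card (set_mset (sites b)) \<le> length b"
proof -
  have "card (set_mset (sites b)) \<le> (\<Sum>x\<in>set_mset (sites b). count (sites b) x)"
    unfolding card_eq_sum by (intro sum_mono) (simp add: Suc_leI)
  then show ?thesis by (simp flip: size_multiset_overloaded_eq)
qed

section \<open>The tilted weights\<close>

text \<open>\<open>C\<close>, \<theta>, \<kappa>, \<open>ds\<close> and \<open>k\<^sub>0\<close> are
  fixed before \<epsilon>; constants built from these, \<open>i\<close> and \<open>h\<close> alone
  are independent of \<beta>. The factor exp (2 * \<epsilon>) leaves room for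
  \<open>tilt \<le> exp \<epsilon>\<close> and for one further weight exp (\<epsilon> * length) at
  the same time.\<close>

locale tilted_walk = site_interaction m \<epsilon> for m \<epsilon> +
  fixes i :: "'d::finite" and h C \<theta> \<kappa> :: real and ds :: "'d list" and k\<^sub>0 :: nat
  assumes \<epsilon>: "0 \<le> \<epsilon>" "\<epsilon> \<le> 1"
    and C: "1 \<le> C" and \<theta>: "0 < \<theta>" "\<theta> * exp (2 * \<epsilon>) \<le> \<kappa>" and \<kappa>: "\<kappa> < 1"
    and tail: "\<And>n. word_mass i h n (no_cut i) \<le> C * \<theta> ^ n"
    and ds: "distinct ds" "length ds = 3" "i \<notin> set ds"
    and k\<^sub>0: "C * \<kappa> ^ k\<^sub>0 / (1 - \<kappa>)\<^sup>2 < 1 / 2"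
begin

lemma \<theta>_exp: "\<theta> * exp \<epsilon> \<le> \<kappa>" "\<theta> \<le> \<kappa>" "0 < \<kappa>"
proof -
  show "\<theta> * exp \<epsilon> \<le> \<kappa>"
    using \<theta> \<epsilon> by (intro order_trans[OF _ \<theta>(2)] mult_left_mono) auto
  show "\<theta> \<le> \<kappa>"
    by (rule order_trans[OF _ \<theta>(2)]) (use \<theta>(1) \<epsilon> in simp)
  then show "0 < \<kappa>" using \<theta>(1) by simp
qed

text \<open>The root lies below exp \<epsilon> because \<open>annealed_sum_lower\<close> makes the
  annealed sum at least exp (- \<epsilon> * n).\<close>

lemma ex_tilt:
  "\<exists>t. 0 < t \<and> t \<le> exp \<epsilon> \<and> (\<lambda>n. irred_sum i (bridge_weight i h) n * t ^ n) sums 1"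
proof (rule renewal_root[where C = C and \<theta> = \<theta> and B = "bridge_sum i (bridge_weight i h)"
      and Z = "annealed_sum i h" and p = "\<lambda>n. word_mass i h n (no_cut i)"])
  show "1 \<le> annealed_sum i h n * exp \<epsilon> ^ n" for n
  proof -
    have "exp (- \<epsilon> * real n) * exp \<epsilon> ^ n \<le> annealed_sum i h n * exp \<epsilon> ^ n"
      by (intro mult_right_mono annealed_sum_lower) auto
    moreover have "exp (- \<epsilon> * real n) * exp \<epsilon> ^ n = 1"
      by (simp add: exp_minus mult.commute[of \<epsilon>] exp_of_nat_mult)
    ultimately show ?thesis by (simp only:)
  qed
  show "annealed_sum i h n \<le> (\<Sum>j\<le>n. \<Sum>l\<le>n - j. word_mass i h j (no_cut i) * word_mass i h l (no_cut i) *
      bridge_sum i (bridge_weight i h) (n - j - l))" for n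
    by (rule annealed_sum_le)
  show "exp \<epsilon> * \<theta> < 1" using \<theta>_exp(1) \<kappa> by (simp add: mult.commute)
  show "irred_sum i (bridge_weight i h) n \<le> C * \<theta> ^ n" for n
    by (rule order_trans[OF irred_sum_le tail])
qed (simp_all add: irred_sum_nonneg irred_sum_def[of _ _ 0] word_mass_nonneg tail \<theta> bridge_sum_0 bridge_sum_Suc)

section \<open>The tilted law of an irreducible bridge\<close>

definition tilt :: real where
  "tilt = (SOME t. 0 < t \<and> t \<le> exp \<epsilon> \<and> (\<lambda>n. irred_sum i (bridge_weight i h) n * t ^ n) sums 1)"

definition tilted :: "(int ^ 'd) list \<Rightarrow> real" where
  "tilted b = bridge_weight i h b * tilt ^ length b"

lemma tilt: "0 < tilt" "tilt \<le> exp \<epsilon>" "(\<lambda>n. irred_sum i (bridge_weight i h) n * tilt ^ n) sums 1"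
  using someI_ex[OF ex_tilt] unfolding tilt_def[symmetric] by auto

lemma tilted_nonneg: "0 \<le> tilted b"
  using tilt(1) by (simp add: tilted_def bridge_weight_nonneg)

lemma irred_sum_tilted: "irred_sum i tilted n = irred_sum i (bridge_weight i h) n * tilt ^ n"
  by (auto simp: irred_sum_def tilted_def sum_distrib_right irred_words_def words_def intro!: sum.cong)

lemma seq_weight_tilted: "seq_weight tilted bs = seq_weight (bridge_weight i h) bs * tilt ^ length (concat bs)"
  unfolding tilted_def by (rule seq_weight_power)

lemma bridge_sum_tilted: "bridge_sum i tilted n = bridge_sum i (bridge_weight i h) n * tilt ^ n"
  by (auto simp: bridge_sum_def seq_weight_tilted sum_distrib_right bridge_seqs_def words_def intro!: sum.cong)

lemma irred_sum_tilted_nonneg: "0 \<le> irred_sum i tilted n"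
  unfolding irred_sum_def by (intro sum_nonneg tilted_nonneg)

lemma irred_sum_tilted_sums: "irred_sum i tilted sums 1"
  using tilt(3) unfolding irred_sum_tilted by simp

lemma irred_sum_tilted_le: "irred_sum i tilted n \<le> C * (\<theta> * exp \<epsilon>) ^ n"
proof -
  have "irred_sum i tilted n \<le> C * \<theta> ^ n * exp \<epsilon> ^ n"
    unfolding irred_sum_tilted
    by (intro mult_mono power_mono order_trans[OF irred_sum_le tail]) (use tilt C \<theta> in auto)
  then show ?thesis by (simp add: power_mult_distrib mult.assoc)
qed

lemma irred_sum_tilted_0: "irred_sum i tilted 0 = 0"
  by (simp add: irred_sum_def)

lemma sum_irred_sum_tilted_le_1: "finite J \<Longrightarrow> (\<Sum>n\<in>J. irred_sum i tilted n) \<le> 1"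
  using sum_le_suminf[OF sums_summable[OF irred_sum_tilted_sums], of J] irred_sum_tilted_nonneg
    sums_unique[OF irred_sum_tilted_sums] by simp

definition tilt_min :: real where
  "tilt_min = (1 - \<theta>) / C"

lemma tilt_min_pos: "0 < tilt_min"
  using C \<theta>_exp \<kappa> by (simp add: tilt_min_def)

text \<open>A smaller \<open>tilt\<close> would be at most 1, so \<open>tilt ^ n \<le> tilt\<close>
  for n \<ge> 1, and the tilted masses would sum to at most C * tilt / (1 - \<theta>) < 1. The bound
  makes the lower bounds below uniform in \<epsilon>.\<close>

lemma tilt_min_le: "tilt_min \<le> tilt"
proof (rule ccontr)
  assume less: "\<not> tilt_min \<le> tilt"
  have \<theta>1: "\<theta> < 1" using \<theta>_exp(2) \<kappa> by simp
  then have "tilt_min \<le> 1" using C \<theta> by (simp add: tilt_min_def)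
  then have t1: "tilt \<le> 1" using less by simp
  have "(\<lambda>n. C * tilt * \<theta> ^ n) sums (C * tilt * (1 / (1 - \<theta>)))"
    using \<theta> \<theta>1 by (intro sums_mult geometric_sums) auto
  moreover have "irred_sum i tilted n \<le> C * tilt * \<theta> ^ n" for n
  proof (cases n)
    case 0
    then show ?thesis using C tilt(1) by (simp add: irred_sum_tilted_0)
  next
    case (Suc k)
    have "irred_sum i tilted n \<le> C * \<theta> ^ n * tilt ^ n"
      unfolding irred_sum_tilted
      by (intro mult_right_mono order_trans[OF irred_sum_le tail]) (use tilt in auto)
    also have "\<dots> \<le> C * \<theta> ^ n * tilt"
    proof (rule mult_left_mono)
      show "tilt ^ n \<le> tilt" using power_decreasing[of 1 n tilt] tilt(1) t1 Suc by simp
      show "0 \<le> C * \<theta> ^ n" using C \<theta>(1) by simp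
    qed
    finally show ?thesis by (simp add: mult_ac)
  qed
  ultimately have "1 \<le> C * tilt * (1 / (1 - \<theta>))"
    by (intro sums_le[OF _ irred_sum_tilted_sums])
  then have "1 - \<theta> \<le> C * tilt" using \<theta>1 by (simp add: pos_le_divide_eq)
  moreover have "tilt * C < 1 - \<theta>" using less C by (simp add: tilt_min_def pos_less_divide_eq not_le)
  ultimately show False by (simp add: mult.commute)
qed

text \<open>The left side is the probability that \<open>n\<close> is a renewal time.\<close>

lemma bridge_sum_tilted_le_1: "bridge_sum i tilted n \<le> 1"
proof (induction n rule: less_induct)
  case (less n)
  show ?case
  proof (cases n)
    case (Suc k)
    have "bridge_sum i tilted n \<le> (\<Sum>j\<le>k. irred_sum i tilted (Suc j) * 1)"
      unfolding Suc bridge_sum_Suc by (intro sum_mono mult_left_mono less irred_sum_tilted_nonneg) (simp add: Suc)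
    also have "\<dots> = (\<Sum>j\<in>Suc ` {..k}. irred_sum i tilted j)"
      by (subst sum.reindex) auto
    also have "\<dots> \<le> 1" by (intro sum_irred_sum_tilted_le_1) auto
    finally show ?thesis .
  qed (simp add: bridge_sum_0)
qed

text \<open>The constant of \<open>renewal_lower_bound\<close>, with the bridge of one step as the
  gap of length 1. Through \<epsilon> \<le> 1 and \<open>tilt_min\<close> it is free of
  \<open>m\<close> and \<epsilon>.\<close>

definition bridge_min :: real where
  "bridge_min = (step_weight i h (axis i 1) * exp (- 1) * tilt_min) ^ k\<^sub>0 / (2 * (real k\<^sub>0 + 1))"

lemma bridge_min_pos: "0 < bridge_min"
  unfolding bridge_min_def
  by (intro divide_pos_pos zero_less_power mult_pos_pos step_weight_pos axis_in_unit_vectors tilt_min_pos) auto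

lemma exp_size_le: "exp (- real (length b)) \<le> site_weight m (sites b)"
proof -
  have "exp (- real (length b)) \<le> exp (- \<epsilon> * real (length b))"
    using \<epsilon> mult_right_mono[of \<epsilon> 1 "real (length b)"] by simp
  also have "\<dots> \<le> site_weight m (sites b)"
    using site_weight_lower[of "sites b"] by simp
  finally show ?thesis .
qed

lemma tilted_lower: "word_weight i h b * exp (- real (length b)) * tilt_min ^ length b \<le> tilted b"
  unfolding tilted_def bridge_weight_def
  by (intro mult_mono mult_left_mono power_mono exp_size_le tilt_min_le word_weight_nonneg mult_nonneg_nonneg)
     (use tilt_min_pos in \<open>auto simp: site_weight_pos less_imp_le word_weight_nonneg\<close>)

lemma bridge_min_le: "bridge_min \<le> bridge_sum i tilted n"
  unfolding bridge_min_def
proof (rule renewal_lower_bound[where q = "irred_sum i tilted" and C = C and \<kappa> = \<kappa>])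
  show "irred_sum i tilted n \<le> C * \<kappa> ^ n" for n
    using C \<theta> \<theta>_exp(1)
    by (intro order_trans[OF irred_sum_tilted_le] mult_left_mono power_mono) auto
  have "[axis i 1] \<in> irred_words i 1"
    using irred_bridge_flat[of "axis i 1" i "[]"]
    by (simp add: irred_words_def words_def axis_in_unit_vectors)
  then have "tilted [axis i 1] \<le> irred_sum i tilted 1"
    unfolding irred_sum_def by (intro member_le_sum tilted_nonneg finite_irred_words)
  then show "step_weight i h (axis i 1) * exp (- 1) * tilt_min \<le> irred_sum i tilted 1"
    using tilted_lower[of "[axis i 1]"] by simp
  show "C * \<kappa> ^ k\<^sub>0 / (1 - \<kappa>)\<^sup>2 < 1 / 2" by (rule k\<^sub>0)
  show "0 < step_weight i h (axis i 1) * exp (- 1) * tilt_min"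
    by (intro mult_pos_pos step_weight_pos axis_in_unit_vectors tilt_min_pos) auto
qed (simp_all add: irred_sum_tilted_nonneg irred_sum_tilted_sums irred_sum_tilted_0 \<kappa> \<theta>_exp bridge_sum_0 bridge_sum_Suc)

section \<open>Special bridges and meetings under the tilted law\<close>

lemma special_word_in_blocks: "J \<subseteq> set ds \<Longrightarrow> 4 \<le> L \<Longrightarrow> special_word i ds J \<in> blocks i L"
  using special_word_in_words[of i ds J] irred_special_word[of i ds J] ds
  by (auto simp: blocks_def irred_words_def intro!: bexI[of _ 4])

lemma tilted_special_word: "i \<notin> J \<Longrightarrow> tilted (special_word i ds J) = tilted (special_word i ds {})"
proof -
  assume J: "i \<notin> J"
  have "site_weight m (sites (special_word i ds K)) =
      site_weight m (sites (axis i 1 # map (\<lambda>c. axis c 1) ds :: (int ^ 'd) list))" for K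
    unfolding special_word_def sites_map[of "reflect K", OF reflect_add]
    by (rule site_weight_image[OF inj_reflect])
  then show ?thesis
    using word_weight_special_word[OF J, of h ds]
    by (simp add: tilted_def bridge_weight_def) (simp add: special_word_def)
qed

definition special_mass :: real where
  "special_mass = 8 * tilted (special_word i ds {})"

text \<open>A lower bound for \<open>special_mass\<close> free of \<open>m\<close> and \<epsilon>;
  the special words have length 4.\<close>

definition special_min :: real where
  "special_min = 8 * (word_weight i h (special_word i ds {}) * exp (- 4) * tilt_min ^ 4)"

lemma special_min_pos: "0 < special_min"
  unfolding special_min_def
  by (intro mult_pos_pos zero_less_power tilt_min_pos word_weight_pos[OF special_word_in_words]) auto

lemma special_min_le: "special_min \<le> special_mass"
  using tilted_lower[of "special_word i ds {}"] ds
  by (simp add: special_min_def special_mass_def special_word_def)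

lemma block_family_blocks:
  assumes "4 \<le> L"
  shows "block_family (blocks i L) tilted sum_list i (special_word i ds) (set ds) special_mass"
proof
  show "sum tilted (blocks i L) \<le> 1"
    using sum_irred_sum_tilted_le_1[of "{..L}"] by (simp add: sum_blocks irred_sum_def)
  show "0 < sum_list b $ i" if "b \<in> blocks i L" for b using blocksD[OF that] by simp
  show "card (set ds) = 3" using ds by (simp add: distinct_card)
  show "special_word i ds ` Pow (set ds) \<subseteq> blocks i L" using special_word_in_blocks assms by auto
  show "0 < special_mass" using special_min_pos special_min_le by simp
  show "tilted (special_word i ds J) = special_mass / 8" if "J \<subseteq> set ds" for J
    using tilted_special_word[of J] that ds by (auto simp: special_mass_def)
  show "sum_list (special_word i ds J) $ i = 1" if "J \<subseteq> set ds" for J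
    using sum_list_special_word_nth(1)[OF ds(1,3)] that ds by auto
qed (use sum_list_special_word_nth(2)[OF ds(1,3)] inj_on_special_word[OF ds(1,3)] ds in
    \<open>simp_all add: finite_blocks tilted_nonneg\<close>)

definition meeting_const :: real where
  "meeting_const = (\<Sum>g. (1 / sqrt (real g + 1)) ^ 3) / special_min"

lemma tilted_coincidences:
  assumes "4 \<le> L"
  shows "(\<Sum>bs\<in>short_lists (blocks i L) L. \<Sum>cs\<in>short_lists (blocks i L) L.
    seq_weight tilted bs * seq_weight tilted cs * of_bool (sum_list (concat bs) = sum_list (concat cs) + w)) \<le> meeting_const"
proof -
  interpret block_family "blocks i L" tilted sum_list i "special_word i ds" "set ds" special_mass
    by (rule block_family_blocks[OF assms])
  have "(\<Sum>bs\<in>short_lists (blocks i L) L. \<Sum>cs\<in>short_lists (blocks i L) L.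
      seq_weight tilted bs * seq_weight tilted cs * of_bool (sum_list (concat bs) = sum_list (concat cs) + w)) \<le>
      (\<Sum>g\<le>L. (1 / sqrt (real g + 1)) ^ 3) / special_mass"
    using coincidence_bound[where n = L and n' = L and w = w] by (simp only: disp_sum_list)
  also have "\<dots> \<le> meeting_const"
    unfolding meeting_const_def
    by (intro frac_le special_min_le special_min_pos sum_le_suminf summable_inverse_sqrt_cube suminf_nonneg) auto
  finally show ?thesis .
qed

lemma meeting_const_nonneg: "0 \<le> meeting_const"
  unfolding meeting_const_def
  by (intro divide_nonneg_pos special_min_pos suminf_nonneg summable_inverse_sqrt_cube) auto

text \<open>Every pair of sites of \<open>b\<close> and \<open>c\<close> contributes at most
  \<open>meeting_const\<close>, whatever the shift.\<close>

lemma tilted_meetings: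
  assumes "4 \<le> L"
  shows "(\<Sum>bs\<in>short_lists (blocks i L) L. \<Sum>cs\<in>short_lists (blocks i L) L.
    seq_weight tilted bs * seq_weight tilted cs * of_bool (meet (y + sum_list (concat cs) - sum_list (concat bs)) b c))
    \<le> real (length b) * real (length c) * meeting_const"
proof -
  let ?S = "short_lists (blocks i L) L"
  have "(\<Sum>bs\<in>?S. \<Sum>cs\<in>?S. seq_weight tilted bs * seq_weight tilted cs *
      of_bool (meet (y + sum_list (concat cs) - sum_list (concat bs)) b c)) \<le>
      (\<Sum>bs\<in>?S. \<Sum>cs\<in>?S. seq_weight tilted bs * seq_weight tilted cs *
      (\<Sum>x\<in>set_mset (sites b). \<Sum>x'\<in>set_mset (sites c). of_bool (sum_list (concat bs) = sum_list (concat cs) + (y + x' - x))))"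
    by (intro sum_mono mult_left_mono meet_le_coincidences mult_nonneg_nonneg seq_weight_nonneg tilted_nonneg)
  also have "\<dots> = (\<Sum>x\<in>set_mset (sites b). \<Sum>x'\<in>set_mset (sites c). \<Sum>bs\<in>?S. \<Sum>cs\<in>?S.
      seq_weight tilted bs * seq_weight tilted cs * of_bool (sum_list (concat bs) = sum_list (concat cs) + (y + x' - x)))"
    unfolding sum_distrib_left
    by (simp only: sum.swap[of _ "set_mset (sites _)" ?S])
  also have "\<dots> \<le> (\<Sum>x\<in>set_mset (sites b). \<Sum>x'\<in>set_mset (sites c). meeting_const)"
    by (intro sum_mono tilted_coincidences assms)
  also have "\<dots> = real (card (set_mset (sites b))) * real (card (set_mset (sites c))) * meeting_const"
    by simp
  also have "\<dots> \<le> real (length b) * real (length c) * meeting_const"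
    by (intro mult_right_mono mult_mono meeting_const_nonneg) (simp_all add: card_sites_le)
  finally show ?thesis .
qed

text \<open>The second derivative of the geometric series at \<kappa>, a convenient majorant for the
  sum of k * k * \<kappa> ^ k.\<close>

definition moment :: real where
  "moment = (\<Sum>k. (real k + 1) * (real k + 2) * \<kappa> ^ k)"

lemma summable_moment: "summable (\<lambda>k. (real k + 1) * (real k + 2) * \<kappa> ^ k)"
proof -
  have 0: "summable (\<lambda>n. 1 * x ^ n)" if "norm x < 1" for x :: real
    using that by (simp add: summable_geometric)
  have 1: "summable (\<lambda>n. diffs (\<lambda>_. 1) n * x ^ n)" if "norm x < 1" for x :: real
    by (rule termdiff_converges[OF that]) (rule 0)
  have "summable (\<lambda>n. diffs (diffs (\<lambda>_. 1)) n * \<kappa> ^ n)"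
    using \<kappa> \<theta>_exp by (intro termdiff_converges[of _ 1] 1) auto
  then show ?thesis by (simp add: diffs_def algebra_simps)
qed

end

section \<open>Two sequences of bridges\<close>

context tilted_walk
begin

lemma sum_blocks_tilted_le:
  assumes "\<And>k. 0 \<le> g k" "\<And>k. (\<theta> * exp \<epsilon>) ^ k * g k \<le> D * ((real k + 1) * (real k + 2) * \<kappa> ^ k)" "0 \<le> D"
  shows "(\<Sum>b\<in>blocks i L. tilted b * g (length b)) \<le> D * C * moment"
proof -
  have "(\<Sum>b\<in>blocks i L. tilted b * g (length b)) = (\<Sum>k\<le>L. irred_sum i tilted k * g k)"
    unfolding sum_blocks irred_sum_def sum_distrib_right
    by (intro sum.cong refl) (simp add: irred_words_def words_def)
  also have "\<dots> \<le> (\<Sum>k\<le>L. D * C * ((real k + 1) * (real k + 2) * \<kappa> ^ k))"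
  proof (intro sum_mono)
    fix k
    have "irred_sum i tilted k * g k \<le> C * (\<theta> * exp \<epsilon>) ^ k * g k"
      by (intro mult_right_mono irred_sum_tilted_le assms)
    also have "\<dots> = C * ((\<theta> * exp \<epsilon>) ^ k * g k)" by simp
    also have "\<dots> \<le> C * (D * ((real k + 1) * (real k + 2) * \<kappa> ^ k))"
      using C by (intro mult_left_mono assms) auto
    finally show "irred_sum i tilted k * g k \<le> D * C * ((real k + 1) * (real k + 2) * \<kappa> ^ k)"
      by (simp add: mult_ac)
  qed
  also have "\<dots> = D * C * (\<Sum>k\<le>L. (real k + 1) * (real k + 2) * \<kappa> ^ k)"
    by (simp add: sum_distrib_left)
  also have "\<dots> \<le> D * C * moment"
    unfolding moment_def using C assms(3) \<theta>_exp
    by (intro mult_left_mono sum_le_suminf summable_moment) auto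
  finally show ?thesis .
qed

lemma exp_power_le: "(\<theta> * exp \<epsilon>) ^ k * exp (\<epsilon> * real k) \<le> \<kappa> ^ k"
proof -
  have "(\<theta> * exp \<epsilon>) ^ k * exp (\<epsilon> * real k) = (\<theta> * exp (2 * \<epsilon>)) ^ k"
  proof -
    have "exp (\<epsilon> * real k) = exp \<epsilon> ^ k" using exp_of_nat_mult[of k \<epsilon>] by (simp add: mult.commute)
    moreover have "exp (2 * \<epsilon>) = exp \<epsilon> * exp \<epsilon>" by (simp flip: exp_add)
    ultimately show ?thesis by (simp add: power_mult_distrib)
  qed
  also have "\<dots> \<le> \<kappa> ^ k" using \<theta> by (intro power_mono) auto
  finally show ?thesis .
qed

text \<open>Here the smallness arises: exp x - 1 \<le> x * exp x makes the bound linear in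
  \<epsilon>, at the price of a second power of the length.\<close>

lemma sum_blocks_meeting_left:
  "(\<Sum>b\<in>blocks i L. tilted b * ((exp (\<epsilon> * real (length b)) - 1) * real (length b))) \<le> \<epsilon> * C * moment"
proof (rule sum_blocks_tilted_le)
  fix k
  show "0 \<le> (exp (\<epsilon> * real k) - 1) * real k" using \<epsilon> by simp
  have "1 - \<epsilon> * real k \<le> exp (- (\<epsilon> * real k))"
    using exp_ge_add_one_self[of "- (\<epsilon> * real k)"] by simp
  then have "exp (\<epsilon> * real k) - 1 \<le> \<epsilon> * real k * exp (\<epsilon> * real k)"
    using mult_right_mono[of "1 - \<epsilon> * real k" "exp (- (\<epsilon> * real k))" "exp (\<epsilon> * real k)"]
    by (simp add: algebra_simps flip: exp_add)
  then have "(\<theta> * exp \<epsilon>) ^ k * ((exp (\<epsilon> * real k) - 1) * real k) \<le>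
      (\<theta> * exp \<epsilon>) ^ k * ((\<epsilon> * real k * exp (\<epsilon> * real k)) * real k)"
    using \<theta> by (intro mult_left_mono mult_right_mono) auto
  also have "\<dots> = \<epsilon> * ((\<theta> * exp \<epsilon>) ^ k * exp (\<epsilon> * real k) * (real k * real k))"
    by simp
  also have "\<dots> \<le> \<epsilon> * (\<kappa> ^ k * ((real k + 1) * (real k + 2)))"
    using \<epsilon> \<theta>_exp by (intro mult_left_mono mult_mono exp_power_le) auto
  finally show "(\<theta> * exp \<epsilon>) ^ k * ((exp (\<epsilon> * real k) - 1) * real k) \<le> \<epsilon> * ((real k + 1) * (real k + 2) * \<kappa> ^ k)"
    by (simp add: mult_ac)
qed (rule \<epsilon>)

lemma sum_blocks_meeting_right:
  "(\<Sum>b\<in>blocks i L. tilted b * (exp (\<epsilon> * real (length b)) * real (length b))) \<le> 1 * C * moment"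
proof (rule sum_blocks_tilted_le)
  fix k
  have "(\<theta> * exp \<epsilon>) ^ k * (exp (\<epsilon> * real k) * real k) = (\<theta> * exp \<epsilon>) ^ k * exp (\<epsilon> * real k) * real k"
    by simp
  also have "\<dots> \<le> \<kappa> ^ k * ((real k + 1) * (real k + 2))"
    using \<theta>_exp by (intro mult_mono exp_power_le) (auto simp: algebra_simps)
  finally show "(\<theta> * exp \<epsilon>) ^ k * (exp (\<epsilon> * real k) * real k) \<le> 1 * ((real k + 1) * (real k + 2) * \<kappa> ^ k)"
    by (simp add: mult_ac)
qed auto

definition pair_const :: real where
  "pair_const = (C * moment)\<^sup>2 * meeting_const"

lemma moment_nonneg: "0 \<le> moment"
  unfolding moment_def using \<theta>_exp by (intro suminf_nonneg summable_moment) auto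

text \<open>For fixed meeting blocks the prefixes are summed by \<open>tilted_meetings\<close>. The
  sums over the two blocks then separate, each with one factor \<open>length\<close> from its number
  of sites.\<close>

lemma sum_meetings_le:
  assumes "4 \<le> L"
  shows "(\<Sum>bs\<in>short_lists (blocks i L) L. \<Sum>b\<in>blocks i L. \<Sum>cs\<in>short_lists (blocks i L) L. \<Sum>c\<in>blocks i L.
      seq_weight tilted bs * tilted b * (seq_weight tilted cs * tilted c) *
      (of_bool (meet (y + sum_list (concat cs) - sum_list (concat bs)) b c) *
       ((exp (\<epsilon> * real (length b)) - 1) * exp (\<epsilon> * real (length c))))) \<le> \<epsilon> * pair_const"
proof -
  let ?S = "short_lists (blocks i L) L" and ?B = "blocks i L"
  let ?w = "\<lambda>b c. tilted b * tilted c * ((exp (\<epsilon> * real (length b)) - 1) * exp (\<epsilon> * real (length c)))"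
  let ?m = "\<lambda>bs cs b c. of_bool (meet (y + sum_list (concat cs) - sum_list (concat bs)) b c)"
  have w_nonneg: "0 \<le> ?w b c" for b c
    using \<epsilon> by (intro mult_nonneg_nonneg tilted_nonneg) auto
  have "(\<Sum>bs\<in>?S. \<Sum>b\<in>?B. \<Sum>cs\<in>?S. \<Sum>c\<in>?B. seq_weight tilted bs * tilted b * (seq_weight tilted cs * tilted c) *
      (?m bs cs b c * ((exp (\<epsilon> * real (length b)) - 1) * exp (\<epsilon> * real (length c))))) =
      (\<Sum>b\<in>?B. \<Sum>c\<in>?B. \<Sum>bs\<in>?S. \<Sum>cs\<in>?S. ?w b c * (seq_weight tilted bs * seq_weight tilted cs * ?m bs cs b c))"
  proof (subst sum.swap, intro sum.cong refl)
    fix b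
    show "(\<Sum>bs\<in>?S. \<Sum>cs\<in>?S. \<Sum>c\<in>?B. seq_weight tilted bs * tilted b * (seq_weight tilted cs * tilted c) *
        (?m bs cs b c * ((exp (\<epsilon> * real (length b)) - 1) * exp (\<epsilon> * real (length c))))) =
        (\<Sum>c\<in>?B. \<Sum>bs\<in>?S. \<Sum>cs\<in>?S. ?w b c * (seq_weight tilted bs * seq_weight tilted cs * ?m bs cs b c))"
      unfolding sum.swap[of _ ?B ?S] by (intro sum.cong refl) (simp only: mult_ac)
  qed
  also have "\<dots> = (\<Sum>b\<in>?B. \<Sum>c\<in>?B. ?w b c * (\<Sum>bs\<in>?S. \<Sum>cs\<in>?S. seq_weight tilted bs * seq_weight tilted cs * ?m bs cs b c))"
    by (simp only: sum_distrib_left)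
  also have "\<dots> \<le> (\<Sum>b\<in>?B. \<Sum>c\<in>?B. ?w b c * (real (length b) * real (length c) * meeting_const))"
    by (intro sum_mono mult_left_mono tilted_meetings assms w_nonneg)
  also have "\<dots> = (\<Sum>b\<in>?B. \<Sum>c\<in>?B. tilted b * ((exp (\<epsilon> * real (length b)) - 1) * real (length b)) *
      (tilted c * (exp (\<epsilon> * real (length c)) * real (length c))) * meeting_const)"
    by (intro sum.cong refl) (simp only: mult_ac)
  also have "\<dots> = (\<Sum>b\<in>?B. tilted b * ((exp (\<epsilon> * real (length b)) - 1) * real (length b))) *
      (\<Sum>c\<in>?B. tilted c * (exp (\<epsilon> * real (length c)) * real (length c))) * meeting_const"
    unfolding sum_product by (simp only: sum_distrib_right)
  also have "\<dots> \<le> (\<epsilon> * C * moment) * (1 * C * moment) * meeting_const"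
    using \<epsilon> C moment_nonneg
    by (intro mult_right_mono mult_mono sum_blocks_meeting_left sum_blocks_meeting_right meeting_const_nonneg
          sum_nonneg mult_nonneg_nonneg tilted_nonneg) auto
  also have "\<dots> = \<epsilon> * pair_const" by (simp add: pair_const_def power2_eq_square)
  finally show ?thesis .
qed

definition pair_sum :: "nat \<Rightarrow> nat \<Rightarrow> int ^ 'd \<Rightarrow> real" where
  "pair_sum n n' y = (\<Sum>bs\<in>bridge_seqs i n. \<Sum>cs\<in>bridge_seqs i n'.
     seq_weight tilted bs * seq_weight tilted cs * exp (\<epsilon> * overlap y (concat bs) (concat cs)))"

lemma tilted_seq_nonneg: "0 \<le> seq_weight tilted bs"
  by (rule seq_weight_nonneg[OF tilted_nonneg])

text \<open>
  Expanding at the meetings of two blocks, what comes after a meeting is again a pair of sequences of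
  bridges, of smaller total length.
\<close>

lemma pair_sum_le_2:
  assumes "\<epsilon> * pair_const \<le> 1 / 2"
  shows "pair_sum n n' y \<le> 2"
proof (induction n arbitrary: n' y rule: less_induct)
  case (less n)
  \<comment> \<open>At least both lengths, so that all sequences consist of blocks in
    \<open>?B\<close>, and at least 4, so that \<open>?B\<close> contains the special
    bridges.\<close>
  let ?L = "n + n' + 4"
  let ?S = "short_lists (blocks i ?L) ?L" and ?B = "blocks i ?L"
  let ?t = "\<lambda>bs1 b bs2 cs1 c cs2. meeting_term \<epsilon> y bs1 b bs2 cs1 c cs2"
  let ?R = "\<lambda>cs1 c. bridge_seqs i (n' - length (concat cs1) - length c)"
  let ?Q = "\<lambda>bs1 b. bridge_seqs i (n - length (concat bs1) - length b)"
  let ?W = "\<lambda>bs1 b bs2. seq_weight tilted bs1 * tilted b * seq_weight tilted bs2"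
  have W_nonneg: "0 \<le> ?W bs1 b bs2" for bs1 b bs2
    by (intro mult_nonneg_nonneg tilted_nonneg tilted_seq_nonneg)
  have W: "seq_weight tilted bs = ?W (take k bs) (bs ! k) (drop (Suc k) bs)" if "k < length bs" for k bs
    using id_take_nth_drop[OF that] by (metis seq_weight_simps(2,3) mult.assoc)
  have t_nonneg: "0 \<le> ?t bs1 b bs2 cs1 c cs2" for bs1 b bs2 cs1 c cs2
    by (rule meeting_term_nonneg[OF \<epsilon>(1)])
  have "pair_sum n n' y \<le> (\<Sum>bs\<in>bridge_seqs i n. \<Sum>cs\<in>bridge_seqs i n'. seq_weight tilted bs * seq_weight tilted cs *
      (1 + (\<Sum>k<length bs. \<Sum>j<length cs.
        ?t (take k bs) (bs ! k) (drop (Suc k) bs) (take j cs) (cs ! j) (drop (Suc j) cs))))"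
    unfolding pair_sum_def
    by (intro sum_mono mult_left_mono exp_overlap_le mult_nonneg_nonneg tilted_seq_nonneg \<epsilon>)
       (auto simp: bridge_seqs_def)
  also have "\<dots> = bridge_sum i tilted n * bridge_sum i tilted n' +
      (\<Sum>bs\<in>bridge_seqs i n. \<Sum>cs\<in>bridge_seqs i n'. \<Sum>k<length bs. \<Sum>j<length cs. seq_weight tilted bs * (seq_weight tilted cs *
        ?t (take k bs) (bs ! k) (drop (Suc k) bs) (take j cs) (cs ! j) (drop (Suc j) cs)))"
    unfolding bridge_sum_def sum_product
    by (simp add: distrib_left sum.distrib sum_distrib_left mult.assoc)
  also have "(\<Sum>bs\<in>bridge_seqs i n. \<Sum>cs\<in>bridge_seqs i n'. \<Sum>k<length bs. \<Sum>j<length cs. seq_weight tilted bs * (seq_weight tilted cs *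
        ?t (take k bs) (bs ! k) (drop (Suc k) bs) (take j cs) (cs ! j) (drop (Suc j) cs))) =
      (\<Sum>bs\<in>bridge_seqs i n. \<Sum>k<length bs. \<Sum>cs\<in>bridge_seqs i n'. \<Sum>j<length cs.
        ?W (take k bs) (bs ! k) (drop (Suc k) bs) * (?W (take j cs) (cs ! j) (drop (Suc j) cs) *
        ?t (take k bs) (bs ! k) (drop (Suc k) bs) (take j cs) (cs ! j) (drop (Suc j) cs)))"
    by (intro sum.cong refl, subst sum.swap, intro sum.cong refl) (simp only: W lessThan_iff)
  also have "\<dots> \<le> (\<Sum>bs1\<in>?S. \<Sum>b\<in>?B. \<Sum>bs2\<in>?Q bs1 b. \<Sum>cs\<in>bridge_seqs i n'. \<Sum>j<length cs.
        ?W bs1 b bs2 * (?W (take j cs) (cs ! j) (drop (Suc j) cs) *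
        ?t bs1 b bs2 (take j cs) (cs ! j) (drop (Suc j) cs)))"
    by (rule sum_bridge_seqs_split[where F = "\<lambda>bs1 b bs2. \<Sum>cs\<in>bridge_seqs i n'. \<Sum>j<length cs.
        ?W bs1 b bs2 * (?W (take j cs) (cs ! j) (drop (Suc j) cs) *
        ?t bs1 b bs2 (take j cs) (cs ! j) (drop (Suc j) cs))"])
       (auto intro!: sum_nonneg mult_nonneg_nonneg tilted_nonneg tilted_seq_nonneg t_nonneg)
  also have "\<dots> \<le> (\<Sum>bs1\<in>?S. \<Sum>b\<in>?B. \<Sum>bs2\<in>?Q bs1 b. \<Sum>cs1\<in>?S. \<Sum>c\<in>?B. \<Sum>cs2\<in>?R cs1 c.
        ?W bs1 b bs2 * (?W cs1 c cs2 * ?t bs1 b bs2 cs1 c cs2))"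
  proof (intro sum_mono)
    fix bs1 b bs2
    show "(\<Sum>cs\<in>bridge_seqs i n'. \<Sum>j<length cs. ?W bs1 b bs2 * (?W (take j cs) (cs ! j) (drop (Suc j) cs) *
        ?t bs1 b bs2 (take j cs) (cs ! j) (drop (Suc j) cs))) \<le>
        (\<Sum>cs1\<in>?S. \<Sum>c\<in>?B. \<Sum>cs2\<in>?R cs1 c. ?W bs1 b bs2 * (?W cs1 c cs2 * ?t bs1 b bs2 cs1 c cs2))"
      by (rule sum_bridge_seqs_split[where F = "\<lambda>cs1 c cs2. ?W bs1 b bs2 * (?W cs1 c cs2 * ?t bs1 b bs2 cs1 c cs2)"])
         (auto intro!: mult_nonneg_nonneg tilted_nonneg tilted_seq_nonneg t_nonneg)
  qed
  also have "\<dots> \<le> (\<Sum>bs1\<in>?S. \<Sum>b\<in>?B. \<Sum>cs1\<in>?S. \<Sum>c\<in>?B.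
      seq_weight tilted bs1 * tilted b * (seq_weight tilted cs1 * tilted c) *
      (of_bool (meet (y + sum_list (concat cs1) - sum_list (concat bs1)) b c) *
       ((exp (\<epsilon> * real (length b)) - 1) * exp (\<epsilon> * real (length c)))) * 2)"
  proof (intro sum_mono)
    fix bs1 b
    assume b: "b \<in> ?B"
    let ?E = "\<lambda>cs1 c. of_bool (meet (y + sum_list (concat cs1) - sum_list (concat bs1)) b c) *
       ((exp (\<epsilon> * real (length b)) - 1) * exp (\<epsilon> * real (length c)))"
    let ?y = "\<lambda>cs1 c. y + sum_list (concat cs1) + sum_list c - sum_list (concat bs1) - sum_list b"
    have eq: "(\<Sum>bs2\<in>?Q bs1 b. \<Sum>cs1\<in>?S. \<Sum>c\<in>?B. \<Sum>cs2\<in>?R cs1 c. ?W bs1 b bs2 * (?W cs1 c cs2 * ?t bs1 b bs2 cs1 c cs2)) =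
        (\<Sum>cs1\<in>?S. \<Sum>c\<in>?B. seq_weight tilted bs1 * tilted b * (seq_weight tilted cs1 * tilted c) * ?E cs1 c *
          pair_sum (n - length (concat bs1) - length b) (n' - length (concat cs1) - length c) (?y cs1 c))"
      unfolding sum.swap[of _ _ "?Q bs1 b"] pair_sum_def sum_distrib_left
    proof (intro sum.cong refl)
      fix cs1 c bs2 cs2
      show "?W bs1 b bs2 * (?W cs1 c cs2 * ?t bs1 b bs2 cs1 c cs2) =
        seq_weight tilted bs1 * tilted b * (seq_weight tilted cs1 * tilted c) * ?E cs1 c *
        (seq_weight tilted bs2 * seq_weight tilted cs2 * exp (\<epsilon> * overlap (?y cs1 c) (concat bs2) (concat cs2)))"
        unfolding meeting_term_def by (simp only: mult_ac)
    qed
    show "(\<Sum>bs2\<in>?Q bs1 b. \<Sum>cs1\<in>?S. \<Sum>c\<in>?B. \<Sum>cs2\<in>?R cs1 c. ?W bs1 b bs2 * (?W cs1 c cs2 * ?t bs1 b bs2 cs1 c cs2)) \<le>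
        (\<Sum>cs1\<in>?S. \<Sum>c\<in>?B. seq_weight tilted bs1 * tilted b * (seq_weight tilted cs1 * tilted c) * ?E cs1 c * 2)"
      unfolding eq
    proof (intro sum_mono mult_left_mono)
      fix cs1 c
      show "pair_sum (n - length (concat bs1) - length b) (n' - length (concat cs1) - length c) (?y cs1 c) \<le> 2"
      \<comment> \<open>Blocks have positive length, so the first argument decreases, except when it
        is 0 and the subtraction is truncated. Then the only sequence is empty and overlaps with
        nothing.\<close>
      proof (cases "n = 0")
        case True
        then show ?thesis
          using bridge_sum_tilted_le_1[of "n' - length (concat cs1) - length c"]
          by (simp add: pair_sum_def bridge_sum_def)
      next
        case False
        then show ?thesis using blocksD(2)[OF b] by (intro less.IH) (cases b, auto)
      qed
      show "0 \<le> seq_weight tilted bs1 * tilted b * (seq_weight tilted cs1 * tilted c) * ?E cs1 c"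
        using \<epsilon> by (intro mult_nonneg_nonneg tilted_nonneg tilted_seq_nonneg) auto
    qed
  qed
  also have "\<dots> = (\<Sum>bs1\<in>?S. \<Sum>b\<in>?B. \<Sum>cs1\<in>?S. \<Sum>c\<in>?B.
      seq_weight tilted bs1 * tilted b * (seq_weight tilted cs1 * tilted c) *
      (of_bool (meet (y + sum_list (concat cs1) - sum_list (concat bs1)) b c) *
       ((exp (\<epsilon> * real (length b)) - 1) * exp (\<epsilon> * real (length c))))) * 2"
    by (simp only: sum_distrib_right)
  also have "\<dots> \<le> \<epsilon> * pair_const * 2"
    by (intro mult_right_mono sum_meetings_le) auto
  \<comment> \<open>The bound 2 reproduces itself: 1 + 2 * (\<epsilon> * pair_const) \<le>
    2.\<close>
  also have "\<dots> \<le> 1" using assms by simp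
  finally have "pair_sum n n' y \<le> bridge_sum i tilted n * bridge_sum i tilted n' + 1" by simp
  also have "bridge_sum i tilted n * bridge_sum i tilted n' \<le> 1 * 1"
    by (intro mult_mono bridge_sum_tilted_le_1) (auto simp: bridge_sum_def intro!: sum_nonneg tilted_seq_nonneg)
  finally show ?case by simp
qed

end

section \<open>Second moment of the path sums\<close>

context tilted_walk
begin

definition second_moment_sum :: "nat \<Rightarrow> real" where
  "second_moment_sum n = (\<Sum>w\<in>words n. \<Sum>w'\<in>words n.
     word_weight i h w * word_weight i h w' * site_weight m (sites w + sites w'))"

definition end_pieces :: "nat \<Rightarrow> (nat \<times> (int ^ 'd) list \<times> nat \<times> (int ^ 'd) list) set" where
  "end_pieces n = (SIGMA j:{..n}. SIGMA u:no_cut_words i j. SIGMA l:{..n - j}. no_cut_words i l)"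

lemma sum_end_pieces:
  "(\<Sum>j\<le>n. \<Sum>u\<in>no_cut_words i j. \<Sum>l\<le>n - j. \<Sum>v\<in>no_cut_words i l. g j u l v) =
     (\<Sum>(j, u, l, v)\<in>end_pieces n. g j u l v)"
  by (simp add: end_pieces_def sum.Sigma finite_no_cut_words)

text \<open>The end pieces have no renewal structure, so their overlap is bounded by their length;
  the exponential tail pays for it.\<close>

definition end_weight :: "(int ^ 'd) list \<Rightarrow> (int ^ 'd) list \<Rightarrow> real" where
  "end_weight u v = word_weight i h u * word_weight i h v * exp (\<epsilon> * (real (length u) + real (length v)))"

lemma end_weight_nonneg: "0 \<le> end_weight u v"
  by (simp add: end_weight_def word_weight_nonneg)

lemma overlap_decomp_le:
  "overlap 0 (u @ concat bs @ v) (u' @ concat cs @ v') \<le> (real (length u) + real (length v)) +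
     (real (length u') + real (length v')) + overlap (sum_list u' - sum_list u) (concat bs) (concat cs)"
proof -
  let ?w = "u' @ concat cs @ v'"
  have "overlap 0 (u @ concat bs @ v) ?w \<le> overlap 0 u ?w + (overlap (0 - sum_list u) (concat bs) ?w +
      overlap (0 - sum_list u - sum_list (concat bs)) v ?w)"
    by (intro order_trans[OF overlap_append_left] add_left_mono overlap_append_left)
  also have "\<dots> \<le> real (length u) + (overlap (- sum_list u) (concat bs) ?w + real (length v))"
    by (intro add_mono overlap_le(1)) simp
  also have "overlap (- sum_list u) (concat bs) ?w \<le> overlap (- sum_list u) (concat bs) u' +
      (overlap (- sum_list u + sum_list u') (concat bs) (concat cs) +
       overlap (- sum_list u + sum_list u' + sum_list (concat cs)) (concat bs) v')"
    by (intro order_trans[OF overlap_append_right] add_left_mono overlap_append_right)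
  also have "\<dots> \<le> real (length u') + (overlap (- sum_list u + sum_list u') (concat bs) (concat cs) + real (length v'))"
    by (intro add_mono overlap_le(2)) simp
  finally show ?thesis by (simp add: algebra_simps)
qed

lemma seq_weight_bridge_tilted:
  "seq_weight (bridge_weight i h) bs = seq_weight tilted bs * (1 / tilt) ^ length (concat bs)"
  using tilt(1) by (simp add: seq_weight_tilted power_one_over)

text \<open>\<open>end_weight\<close> brings one factor exp (\<epsilon> * (j + l)) for overlaps, and
  the missing tilt of the ends brings the other; together they use up exp (2 * \<epsilon>) in the
  assumption on \<theta>. The square stands for the two ends of a word.\<close>

lemma sum_end_weight_le:
  "(\<Sum>(j, u, l, v)\<in>end_pieces n. end_weight u v * exp (\<epsilon> * (real j + real l))) \<le> (C / (1 - \<kappa>))\<^sup>2"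
proof -
  let ?g = "\<lambda>j. word_mass i h j (no_cut i) * exp (2 * (\<epsilon> * real j))"
  have g_nonneg: "0 \<le> ?g j" for j by (simp add: word_mass_nonneg)
  have g_le: "(\<Sum>j\<le>N. ?g j) \<le> C / (1 - \<kappa>)" for N
  proof -
    have "?g j \<le> C * \<kappa> ^ j" for j
    proof -
      have "exp (2 * (\<epsilon> * real j)) = exp (2 * \<epsilon>) ^ j"
        using exp_of_nat_mult[of j "2 * \<epsilon>"] by (simp add: mult_ac)
      then have "?g j \<le> C * \<theta> ^ j * exp (2 * \<epsilon>) ^ j" by (simp add: mult_right_mono tail)
      also have "\<dots> = C * (\<theta> * exp (2 * \<epsilon>)) ^ j" by (simp add: power_mult_distrib)
      also have "\<dots> \<le> C * \<kappa> ^ j" using C \<theta> by (intro mult_left_mono power_mono) auto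
      finally show ?thesis .
    qed
    then have "(\<Sum>j\<le>N. ?g j) \<le> (\<Sum>j\<le>N. C * \<kappa> ^ j)" by (intro sum_mono)
    also have "\<dots> \<le> (\<Sum>j. C * \<kappa> ^ j)"
      using \<kappa> \<theta>_exp C by (intro sum_le_suminf summable_mult summable_geometric) auto
    also have "\<dots> = C / (1 - \<kappa>)" using \<kappa> \<theta>_exp by (simp add: suminf_mult summable_geometric suminf_geometric)
    finally show ?thesis .
  qed
  have "(\<Sum>(j, u, l, v)\<in>end_pieces n. end_weight u v * exp (\<epsilon> * (real j + real l))) =
      (\<Sum>j\<le>n. \<Sum>u\<in>no_cut_words i j. \<Sum>l\<le>n - j. \<Sum>v\<in>no_cut_words i l.
        (word_weight i h u * exp (2 * (\<epsilon> * real j))) * (word_weight i h v * exp (2 * (\<epsilon> * real l))))"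
    unfolding sum_end_pieces[symmetric]
  proof (intro sum.cong refl)
    fix j u l v assume "u \<in> no_cut_words i j" "v \<in> no_cut_words i l"
    then have "length u = j" "length v = l" by (simp_all add: no_cut_words_def words_def)
    moreover have "exp (\<epsilon> * (real j + real l)) * exp (\<epsilon> * (real j + real l)) = exp (2 * (\<epsilon> * real j)) * exp (2 * (\<epsilon> * real l))"
      by (simp add: algebra_simps flip: exp_add)
    ultimately show "end_weight u v * exp (\<epsilon> * (real j + real l)) =
        (word_weight i h u * exp (2 * (\<epsilon> * real j))) * (word_weight i h v * exp (2 * (\<epsilon> * real l)))"
      by (simp add: end_weight_def mult_ac)
  qed
  also have "\<dots> = (\<Sum>j\<le>n. ?g j * (\<Sum>l\<le>n - j. ?g l))"
    by (simp only: sum_distrib_left[symmetric] sum_distrib_right[symmetric] sum_no_cut_words)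
  also have "\<dots> \<le> (\<Sum>j\<le>n. ?g j * (C / (1 - \<kappa>)))"
    by (intro sum_mono mult_left_mono g_le g_nonneg)
  also have "\<dots> = (\<Sum>j\<le>n. ?g j) * (C / (1 - \<kappa>))" by (simp only: sum_distrib_right)
  also have "\<dots> \<le> C / (1 - \<kappa>) * (C / (1 - \<kappa>))"
    using C \<kappa> by (intro mult_right_mono g_le) auto
  finally show ?thesis by (simp add: power2_eq_square)
qed

lemma second_moment_sum_le:
  assumes "\<epsilon> * pair_const \<le> 1 / 2"
  shows "second_moment_sum n \<le> 2 * (C / (1 - \<kappa>)) ^ 4 * (1 / tilt) ^ (2 * n)"
proof -
  let ?w = "word_weight i h" and ?a = "seq_weight (bridge_weight i h)"
  let ?O = "\<lambda>u bs u' cs. exp (\<epsilon> * overlap (sum_list u' - sum_list u) (concat bs) (concat cs))"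
  let ?G = "\<lambda>u v bs u' v' cs. end_weight u v * end_weight u' v' * (?a bs * ?a cs * ?O u bs u' cs)"
  have a_nonneg: "0 \<le> ?a bs" for bs by (rule seq_weight_nonneg[OF bridge_weight_nonneg])
  have G_nonneg: "0 \<le> ?G u v bs u' v' cs" for u v bs u' v' cs
    by (intro mult_nonneg_nonneg end_weight_nonneg a_nonneg) simp
  have G: "?w (u @ concat bs @ v) * ?w (u' @ concat cs @ v') *
      site_weight m (sites (u @ concat bs @ v) + sites (u' @ concat cs @ v')) \<le> ?G u v bs u' v' cs"
    if 1: "\<forall>b\<in>set bs. irred_bridge i b" "stays_above i v"
      "set_mset (sites u) \<inter> set_mset (translate (sum_list u) (sites (concat bs @ v))) = {}"
    and 2: "\<forall>b\<in>set cs. irred_bridge i b" "stays_above i v'"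
      "set_mset (sites u') \<inter> set_mset (translate (sum_list u') (sites (concat cs @ v'))) = {}"
    for u v bs u' v' cs
  proof -
    let ?x = "u @ concat bs @ v" and ?y = "u' @ concat cs @ v'"
    have "?w ?x * ?w ?y * site_weight m (sites ?x + sites ?y) \<le>
        ?w ?x * ?w ?y * (site_weight m (sites ?x) * site_weight m (sites ?y) * exp (\<epsilon> * overlap 0 ?x ?y))"
      using site_weight_add_le[of "sites ?x" "sites ?y"]
      by (intro mult_left_mono mult_nonneg_nonneg word_weight_nonneg) (simp add: overlap_def)
    also have "\<dots> = (?w ?x * site_weight m (sites ?x)) * (?w ?y * site_weight m (sites ?y)) * exp (\<epsilon> * overlap 0 ?x ?y)"
      by (simp only: mult_ac)
    also have "\<dots> \<le> (?w u * ?w v * ?a bs) * (?w u' * ?w v' * ?a cs) *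
        exp (\<epsilon> * ((real (length u) + real (length v)) + (real (length u') + real (length v')) +
          overlap (sum_list u' - sum_list u) (concat bs) (concat cs)))"
      using \<epsilon> by (intro mult_mono decomp_weight_le[OF 1] decomp_weight_le[OF 2] mult_nonneg_nonneg word_weight_nonneg
            a_nonneg less_imp_le[OF site_weight_pos]) (auto intro!: mult_left_mono overlap_decomp_le)
    also have "\<dots> = ?G u v bs u' v' cs"
      by (simp only: end_weight_def distrib_left exp_add mult_ac)
    finally show ?thesis .
  qed
  have "second_moment_sum n \<le> (\<Sum>j\<le>n. \<Sum>u\<in>no_cut_words i j. \<Sum>l\<le>n - j. \<Sum>v\<in>no_cut_words i l.
      \<Sum>bs\<in>bridge_seqs i (n - j - l). \<Sum>j'\<le>n. \<Sum>u'\<in>no_cut_words i j'. \<Sum>l'\<le>n - j'. \<Sum>v'\<in>no_cut_words i l'.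
        \<Sum>cs\<in>bridge_seqs i (n - j' - l'). ?G u v bs u' v' cs)"
    unfolding second_moment_sum_def
  proof (rule sum_words_le_decomp)
    show "0 \<le> (\<Sum>j'\<le>n. \<Sum>u'\<in>no_cut_words i j'. \<Sum>l'\<le>n - j'. \<Sum>v'\<in>no_cut_words i l'.
        \<Sum>cs\<in>bridge_seqs i (n - j' - l'). ?G u v bs u' v' cs)" for u v bs
      by (intro sum_nonneg G_nonneg)
  next
    fix u v bs
    assume 1: "\<forall>b\<in>set bs. irred_bridge i b" "stays_above i v"
      "set_mset (sites u) \<inter> set_mset (translate (sum_list u) (sites (concat bs @ v))) = {}"
    show "(\<Sum>w'\<in>words n. ?w (u @ concat bs @ v) * ?w w' * site_weight m (sites (u @ concat bs @ v) + sites w')) \<le>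
        (\<Sum>j'\<le>n. \<Sum>u'\<in>no_cut_words i j'. \<Sum>l'\<le>n - j'. \<Sum>v'\<in>no_cut_words i l'.
          \<Sum>cs\<in>bridge_seqs i (n - j' - l'). ?G u v bs u' v' cs)"
      by (rule sum_words_le_decomp, rule G_nonneg, rule G[OF 1])
  qed
  also have "\<dots> = (\<Sum>(j, u, l, v)\<in>end_pieces n. \<Sum>bs\<in>bridge_seqs i (n - j - l).
      \<Sum>(j', u', l', v')\<in>end_pieces n. \<Sum>cs\<in>bridge_seqs i (n - j' - l'). ?G u v bs u' v' cs)"
    by (simp only: sum_end_pieces)
  also have "\<dots> \<le> (\<Sum>(j, u, l, v)\<in>end_pieces n. \<Sum>(j', u', l', v')\<in>end_pieces n.
      2 * (1 / tilt) ^ (2 * n) * ((end_weight u v * exp (\<epsilon> * (real j + real l))) *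
        (end_weight u' v' * exp (\<epsilon> * (real j' + real l')))))"
  proof (rule sum_mono)
    fix p assume p: "p \<in> end_pieces n"
    obtain j u l v where p_eq: "p = (j, u, l, v)" by (cases p)
    have jl: "j + l \<le> n" using p by (auto simp: p_eq end_pieces_def)
    \<comment> \<open>The end pieces are not tilted; completing the power to \<open>n\<close> for
      them costs \<open>tilt ^ (j + l)\<close>.\<close>
    have power: "(1 / tilt) ^ (n - j - l) \<le> (1 / tilt) ^ n * exp (\<epsilon> * (real j + real l))" if "j + l \<le> n" for j l
    proof -
      have "(1 / tilt) ^ n = (1 / tilt) ^ (n - j - l) * (1 / tilt) ^ (j + l)"
        using that by (simp flip: power_add)
      then have "(1 / tilt) ^ (n - j - l) = (1 / tilt) ^ n * tilt ^ (j + l)"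
        using tilt(1) by (simp add: power_one_over)
      also have "\<dots> \<le> (1 / tilt) ^ n * exp \<epsilon> ^ (j + l)"
        using tilt by (intro mult_left_mono power_mono) auto
      also have "exp \<epsilon> ^ (j + l) = exp (\<epsilon> * (real j + real l))"
        using exp_of_nat_mult[of "j + l" \<epsilon>] by (simp add: mult.commute)
      finally show ?thesis .
    qed
    have swap: "(\<Sum>bs\<in>bridge_seqs i (n - j - l). \<Sum>(j', u', l', v')\<in>end_pieces n.
        \<Sum>cs\<in>bridge_seqs i (n - j' - l'). ?G u v bs u' v' cs) =
      (\<Sum>(j', u', l', v')\<in>end_pieces n. \<Sum>bs\<in>bridge_seqs i (n - j - l).
        \<Sum>cs\<in>bridge_seqs i (n - j' - l'). ?G u v bs u' v' cs)"
      by (subst sum.swap) (simp add: case_prod_unfold)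
    have "(\<Sum>(j', u', l', v')\<in>end_pieces n. \<Sum>bs\<in>bridge_seqs i (n - j - l).
        \<Sum>cs\<in>bridge_seqs i (n - j' - l'). ?G u v bs u' v' cs) \<le>
        (\<Sum>(j', u', l', v')\<in>end_pieces n. 2 * (1 / tilt) ^ (2 * n) * ((end_weight u v * exp (\<epsilon> * (real j + real l))) *
          (end_weight u' v' * exp (\<epsilon> * (real j' + real l')))))"
    proof (rule sum_mono)
      fix p' assume p': "p' \<in> end_pieces n"
      obtain j' u' l' v' where p'_eq: "p' = (j', u', l', v')" by (cases p')
      have jl': "j' + l' \<le> n" using p' by (auto simp: p'_eq end_pieces_def)
      have "(\<Sum>bs\<in>bridge_seqs i (n - j - l). \<Sum>cs\<in>bridge_seqs i (n - j' - l'). ?G u v bs u' v' cs) =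
          (\<Sum>bs\<in>bridge_seqs i (n - j - l). \<Sum>cs\<in>bridge_seqs i (n - j' - l').
            end_weight u v * end_weight u' v' * ((1 / tilt) ^ (n - j - l) * (1 / tilt) ^ (n - j' - l')) *
            (seq_weight tilted bs * seq_weight tilted cs * ?O u bs u' cs))"
      proof (intro sum.cong refl)
        fix bs cs assume "bs \<in> bridge_seqs i (n - j - l)" "cs \<in> bridge_seqs i (n - j' - l')"
        then have "length (concat bs) = n - j - l" "length (concat cs) = n - j' - l'"
          by (simp_all add: bridge_seqs_def words_def)
        then show "?G u v bs u' v' cs =
            end_weight u v * end_weight u' v' * ((1 / tilt) ^ (n - j - l) * (1 / tilt) ^ (n - j' - l')) *
            (seq_weight tilted bs * seq_weight tilted cs * ?O u bs u' cs)"
          by (simp only: seq_weight_bridge_tilted mult_ac)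
      qed
      also have "\<dots> = end_weight u v * end_weight u' v' * ((1 / tilt) ^ (n - j - l) * (1 / tilt) ^ (n - j' - l')) *
          pair_sum (n - j - l) (n - j' - l') (sum_list u' - sum_list u)"
        by (simp only: pair_sum_def sum_distrib_left)
      also have "\<dots> \<le> end_weight u v * end_weight u' v' *
          (((1 / tilt) ^ n * exp (\<epsilon> * (real j + real l))) * ((1 / tilt) ^ n * exp (\<epsilon> * (real j' + real l')))) * 2"
        using tilt(1) by (intro mult_mono mult_left_mono power jl jl' pair_sum_le_2 assms mult_nonneg_nonneg end_weight_nonneg)
          (auto simp: pair_sum_def intro!: sum_nonneg mult_nonneg_nonneg tilted_seq_nonneg)
      also have "\<dots> = 2 * (1 / tilt) ^ (2 * n) * ((end_weight u v * exp (\<epsilon> * (real j + real l))) *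
          (end_weight u' v' * exp (\<epsilon> * (real j' + real l'))))"
        unfolding power_even_eq power2_eq_square by (simp only: mult_ac)
      finally show "(case p' of (j', u', l', v') \<Rightarrow> \<Sum>bs\<in>bridge_seqs i (n - j - l).
          \<Sum>cs\<in>bridge_seqs i (n - j' - l'). ?G u v bs u' v' cs) \<le>
          (case p' of (j', u', l', v') \<Rightarrow> 2 * (1 / tilt) ^ (2 * n) * ((end_weight u v * exp (\<epsilon> * (real j + real l))) *
          (end_weight u' v' * exp (\<epsilon> * (real j' + real l')))))"
        unfolding p'_eq prod.case .
    qed
    then show "(case p of (j, u, l, v) \<Rightarrow> \<Sum>bs\<in>bridge_seqs i (n - j - l). \<Sum>(j', u', l', v')\<in>end_pieces n.
        \<Sum>cs\<in>bridge_seqs i (n - j' - l'). ?G u v bs u' v' cs) \<le>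
      (case p of (j, u, l, v) \<Rightarrow> \<Sum>(j', u', l', v')\<in>end_pieces n.
        2 * (1 / tilt) ^ (2 * n) * ((end_weight u v * exp (\<epsilon> * (real j + real l))) *
        (end_weight u' v' * exp (\<epsilon> * (real j' + real l')))))"
      unfolding p_eq prod.case swap .
  qed
  also have "\<dots> = 2 * (1 / tilt) ^ (2 * n) * (\<Sum>(j, u, l, v)\<in>end_pieces n. end_weight u v * exp (\<epsilon> * (real j + real l)))\<^sup>2"
    unfolding power2_eq_square sum_product
    by (simp add: sum_distrib_left case_prod_unfold)
  also have "\<dots> \<le> 2 * (1 / tilt) ^ (2 * n) * ((C / (1 - \<kappa>))\<^sup>2)\<^sup>2"
    using tilt(1)
    by (intro mult_left_mono power_mono sum_end_weight_le sum_nonneg)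
       (auto simp: end_weight_nonneg split: prod.splits)
  also have "\<dots> = 2 * (C / (1 - \<kappa>)) ^ 4 * (1 / tilt) ^ (2 * n)"
    by (simp flip: power_mult)
  finally show ?thesis .
qed

lemma annealed_sum_ge: "bridge_min * (1 / tilt) ^ n \<le> annealed_sum i h n"
proof -
  have "bridge_min * (1 / tilt) ^ n \<le> bridge_sum i tilted n * (1 / tilt) ^ n"
    using tilt(1) by (intro mult_right_mono bridge_min_le) auto
  also have "\<dots> = bridge_sum i (bridge_weight i h) n"
    using tilt(1) by (simp add: bridge_sum_tilted power_one_over)
  finally show ?thesis using bridge_sum_le_annealed[of i h n] by simp
qed

text \<open>The upper bound and the squared lower bound carry the same power of
  \<open>1 / tilt\<close>, which cancels.\<close>

theorem second_moment_sum_le_annealed: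
  assumes "\<epsilon> * pair_const \<le> 1 / 2"
  shows "second_moment_sum n \<le> 2 * (C / (1 - \<kappa>)) ^ 4 / bridge_min\<^sup>2 * (annealed_sum i h n)\<^sup>2"
proof -
  have "(bridge_min * (1 / tilt) ^ n)\<^sup>2 \<le> (annealed_sum i h n)\<^sup>2"
    using tilt(1) bridge_min_pos by (intro power_mono annealed_sum_ge) auto
  then have "bridge_min\<^sup>2 * (1 / tilt) ^ (2 * n) \<le> (annealed_sum i h n)\<^sup>2"
    unfolding power_mult_distrib power_even_eq .
  then have "(1 / tilt) ^ (2 * n) \<le> (annealed_sum i h n)\<^sup>2 / bridge_min\<^sup>2"
    using bridge_min_pos by (simp add: pos_le_divide_eq mult.commute)
  then have "2 * (C / (1 - \<kappa>)) ^ 4 * (1 / tilt) ^ (2 * n) \<le>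
      2 * (C / (1 - \<kappa>)) ^ 4 * ((annealed_sum i h n)\<^sup>2 / bridge_min\<^sup>2)"
    by (intro mult_left_mono) auto
  with second_moment_sum_le[OF assms, of n] show ?thesis by simp
qed

end

section \<open>Random potentials\<close>

lemma sum_mset_superset:
  fixes v :: "'a \<Rightarrow> real"
  assumes "finite F"
  shows "set_mset A \<subseteq> F \<Longrightarrow> (\<Sum>x\<in>#A. v x) = (\<Sum>x\<in>F. real (count A x) * v x)"
proof (induction A)
  case (add a A)
  have "(\<Sum>x\<in>F. real (count (add_mset a A) x) * v x) = (\<Sum>x\<in>F. real (count A x) * v x + (if a = x then v x else 0))"
    by (intro sum.cong) (auto simp: algebra_simps)
  also have "\<dots> = (\<Sum>x\<in>F. real (count A x) * v x) + v a"
    using assms add.prems by (simp add: sum.distrib)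
  finally show ?case using add by simp
qed simp

section \<open>The quenched partition function as a finite sum over words\<close>

lemma sum_path_Suc:
  fixes g :: "'v::ab_group_add \<Rightarrow> real"
  shows "(\<Sum>n=1..Suc N. g (\<Sum>k<n. case_nat s \<omega> k)) = g s + (\<Sum>n=1..N. g (s + (\<Sum>k<n. \<omega> k)))"
proof -
  have "(\<Sum>n=1..Suc N. g (\<Sum>k<n. case_nat s \<omega> k)) = (\<Sum>n=0..N. g (\<Sum>k<Suc n. case_nat s \<omega> k))"
    by (simp only: One_nat_def sum.shift_bounds_cl_Suc_ivl)
  also have "\<dots> = (\<Sum>n=0..N. g (s + (\<Sum>k<n. \<omega> k)))"
    by (simp only: sum.lessThan_Suc_shift nat.case)
  also have "\<dots> = g s + (\<Sum>n=1..N. g (s + (\<Sum>k<n. \<omega> k)))"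
    by (simp add: sum.atLeast_Suc_atMost)
  finally show ?thesis .
qed

lemma measurable_path_functional:
  fixes N :: nat and \<beta> :: real
  shows "(\<lambda>X. exp (- \<beta> * (\<Sum>n=1..N. v (\<Sum>k<n. X k)))) \<in> borel_measurable (\<Pi>\<^sub>M k\<in>UNIV. measure_pmf (step_pmf i h))"
proof -
  have "(\<lambda>X. partial_sums X n) \<in> (\<Pi>\<^sub>M k\<in>UNIV. measure_pmf (step_pmf i h)) \<rightarrow>\<^sub>M count_space UNIV" for n
    by (rule measurable_compose[OF measurable_partial_sums measurable_component_singleton]) simp
  then have "(\<lambda>X. v (partial_sums X n)) \<in> borel_measurable (\<Pi>\<^sub>M k\<in>UNIV. measure_pmf (step_pmf i h))" for n
    by (rule measurable_compose) simp
  then have "(\<lambda>X. v (\<Sum>k<n. X k)) \<in> borel_measurable (\<Pi>\<^sub>M k\<in>UNIV. measure_pmf (step_pmf i h))" for n :: nat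
    by (simp add: partial_sums_def)
  then show ?thesis
    by (intro borel_measurable_exp[THEN measurable_compose[rotated]] borel_measurable_times borel_measurable_sum) auto
qed

lemma nn_integral_step_pmf:
  "(\<integral>\<^sup>+e. f e \<partial>measure_pmf (step_pmf i h)) = (\<Sum>e\<in>unit_vectors. ennreal (step_weight i h e) * f e)"
  unfolding nn_integral_measure_pmf pmf_step
  by (rule nn_integral_count_space'[OF finite_unit_vectors]) (auto simp: step_weight_def)

text \<open>\<open>PiM_iter\<close> splits off the first increment \<open>s\<close>, after which the
  walk sees the potential shifted by \<open>s\<close>; hence the induction is over all
  \<open>v\<close>.\<close>

lemma nn_integral_path_functional:
  fixes N :: nat
  shows "(\<integral>\<^sup>+X. ennreal (exp (- \<beta> * (\<Sum>n=1..N. v (\<Sum>k<n. X k)))) \<partial>(\<Pi>\<^sub>M k\<in>UNIV. measure_pmf (step_pmf i h))) =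
     ennreal (\<Sum>w\<in>words N. word_weight i h w * exp (- \<beta> * (\<Sum>x\<in>#sites w. v x)))"
proof (induction N arbitrary: v)
  case 0
  interpret product_prob_space "\<lambda>_. measure_pmf (step_pmf i h)" "UNIV :: nat set" by unfold_locales
  show ?case by (simp add: emeasure_space_1)
next
  case (Suc N)
  interpret sequence_space "measure_pmf (step_pmf i h)" by unfold_locales
  let ?f = "\<lambda>N v X. ennreal (exp (- \<beta> * (\<Sum>n=1..N. v (\<Sum>k<n. X k))))"
  have meas: "?f N v \<in> borel_measurable S" for N v
    by (rule measurable_compose[OF measurable_path_functional measurable_ennreal])
  have split: "?f (Suc N) v (case_nat s \<omega>) = ennreal (exp (- \<beta> * v s)) * ?f N (\<lambda>x. v (s + x)) \<omega>" for s \<omega>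
    unfolding sum_path_Suc distrib_left exp_add by (rule ennreal_mult) auto
  have "(\<integral>\<^sup>+X. ?f (Suc N) v X \<partial>S) = (\<integral>\<^sup>+X. ?f (Suc N) v X \<partial>(distr (measure_pmf (step_pmf i h) \<Otimes>\<^sub>M S) S (\<lambda>(s, \<omega>). case_nat s \<omega>)))"
    by (simp only: PiM_iter)
  also have "\<dots> = (\<integral>\<^sup>+z. ?f (Suc N) v (case z of (s, \<omega>) \<Rightarrow> case_nat s \<omega>) \<partial>(measure_pmf (step_pmf i h) \<Otimes>\<^sub>M S))"
    by (rule nn_integral_distr) (simp, simp only: measurable_distr_eq1 meas)
  also have "\<dots> = (\<integral>\<^sup>+s. \<integral>\<^sup>+\<omega>. ?f (Suc N) v (case_nat s \<omega>) \<partial>S \<partial>measure_pmf (step_pmf i h))"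
    by (subst P.nn_integral_fst[symmetric]) (rule measurable_compose[OF _ meas], simp, simp only: prod.case)
  also have "\<dots> = (\<integral>\<^sup>+s. ennreal (exp (- \<beta> * v s)) * (\<integral>\<^sup>+\<omega>. ?f N (\<lambda>x. v (s + x)) \<omega> \<partial>S) \<partial>measure_pmf (step_pmf i h))"
    by (simp only: split, intro nn_integral_cong, rule nn_integral_cmult, rule meas)
  also have "\<dots> = (\<Sum>e\<in>unit_vectors. ennreal (step_weight i h e) * (ennreal (exp (- \<beta> * v e)) *
      ennreal (\<Sum>w\<in>words N. word_weight i h w * exp (- \<beta> * (\<Sum>x\<in>#sites w. v (e + x))))))"
    unfolding nn_integral_step_pmf
  proof (intro sum.cong refl)
    fix e
    show "ennreal (step_weight i h e) * (ennreal (exp (- \<beta> * v e)) * (\<integral>\<^sup>+\<omega>. ?f N (\<lambda>x. v (e + x)) \<omega> \<partial>S)) =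
        ennreal (step_weight i h e) * (ennreal (exp (- \<beta> * v e)) *
        ennreal (\<Sum>w\<in>words N. word_weight i h w * exp (- \<beta> * (\<Sum>x\<in>#sites w. v (e + x)))))"
      by (simp only: Suc.IH[of "\<lambda>x. v (e + x)"])
  qed
  also have "\<dots> = (\<Sum>e\<in>unit_vectors. ennreal (step_weight i h e * (exp (- \<beta> * v e) *
      (\<Sum>w\<in>words N. word_weight i h w * exp (- \<beta> * (\<Sum>x\<in>#sites w. v (e + x)))))))"
    by (intro sum.cong refl) (simp add: ennreal_mult step_weight_nonneg word_weight_nonneg sum_nonneg)
  also have "\<dots> = ennreal (\<Sum>e\<in>unit_vectors. step_weight i h e * (exp (- \<beta> * v e) *
      (\<Sum>w\<in>words N. word_weight i h w * exp (- \<beta> * (\<Sum>x\<in>#sites w. v (e + x))))))"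
    by (intro sum_ennreal mult_nonneg_nonneg step_weight_nonneg sum_nonneg word_weight_nonneg) auto
  also have "(\<Sum>e\<in>unit_vectors. step_weight i h e * (exp (- \<beta> * v e) *
      (\<Sum>w\<in>words N. word_weight i h w * exp (- \<beta> * (\<Sum>x\<in>#sites w. v (e + x)))))) =
      (\<Sum>w\<in>words (Suc N). word_weight i h w * exp (- \<beta> * (\<Sum>x\<in>#sites w. v x)))"
    by (simp add: sum_words_Suc sum_distrib_left multiset.map_comp o_def distrib_left exp_add mult_ac right_diff_distrib exp_diff divide_inverse exp_minus)
  finally show ?case .
qed

lemma quenched_Z_eq:
  "quenched_Z i h \<beta> N v = (\<Sum>w\<in>words N. word_weight i h w * exp (- (\<beta> * (\<Sum>x\<in>#sites w. v x))))"
proof -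
  have "quenched_Z i h \<beta> N v = enn2real (\<integral>\<^sup>+X. ennreal (exp (- \<beta> * (\<Sum>n=1..N. v (\<Sum>k<n. X k))))
      \<partial>(\<Pi>\<^sub>M k\<in>UNIV. measure_pmf (step_pmf i h)))"
    unfolding quenched_Z_increments by (rule integral_eq_nn_integral[OF measurable_path_functional]) simp
  then show ?thesis
    unfolding nn_integral_path_functional by (simp add: sum_nonneg word_weight_nonneg)
qed

text \<open>The definition as a supremum only yields lower bounds below 0, so each
  \<open>- 1 / real (Suc n)\<close> is treated first and then the limit is taken.\<close>

lemma essinf_0_nonneg:
  assumes "essinf M f = 0"
  shows "AE \<omega> in M. 0 \<le> f \<omega>"
proof -
  have "AE \<omega> in M. - 1 / real (Suc n) \<le> f \<omega>" for n
  proof -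
    have "ereal (- 1 / real (Suc n)) < essinf M f" by (simp add: assms)
    then obtain c where c: "AE \<omega> in M. c \<le> ereal (f \<omega>)" "ereal (- 1 / real (Suc n)) < c"
      unfolding essinf_def less_Sup_iff by auto
    from c(1) show ?thesis
      by eventually_elim (use c(2) in \<open>metis ereal_less_eq(3) less_imp_le order_trans\<close>)
  qed
  then have "AE \<omega> in M. \<forall>n. - 1 / real (Suc n) \<le> f \<omega>"
    by (simp add: AE_all_countable)
  then show ?thesis
  proof eventually_elim
    case (elim \<omega>)
    have "(\<lambda>n. - 1 / real (Suc n)) \<longlonglongrightarrow> 0"
      using tendsto_minus[OF LIMSEQ_inverse_real_of_nat] by (simp add: divide_inverse)
    then show ?case by (rule LIMSEQ_le_const2) (use elim in auto)
  qed
qed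

section \<open>Laplace transforms and moments under the potential\<close>

locale random_potential = prob_space M for M :: "'a measure" +
  fixes V :: "int ^ 'd::finite \<Rightarrow> 'a \<Rightarrow> real"
  assumes indep: "indep_vars (\<lambda>_. borel) V UNIV"
    and ident: "distr M borel (V x) = distr M borel (V y)"
    and nonneg: "AE \<omega> in M. 0 \<le> V x \<omega>"
    and integrable_V: "integrable M (V x)"
begin

lemma measurable_V [measurable]: "V x \<in> borel_measurable M"
  using integrable_V by simp

definition mean :: real where
  "mean = expectation (V 0)"

definition laplace :: "real \<Rightarrow> nat \<Rightarrow> real" where
  "laplace \<beta> k = expectation (\<lambda>\<omega>. exp (- (\<beta> * real k * V 0 \<omega>)))"

lemma mean_nonneg: "0 \<le> mean"
  unfolding mean_def using nonneg by (rule integral_nonneg_AE)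

lemma integrable_exp:
  assumes "0 \<le> c"
  shows "integrable M (\<lambda>\<omega>. exp (- (c * V x \<omega>)))"
proof (rule integrable_const_bound[of _ 1])
  show "AE \<omega> in M. norm (exp (- (c * V x \<omega>))) \<le> 1"
    using nonneg[of x] by eventually_elim (use assms in auto)
qed measurable

lemma laplace_eq: "expectation (\<lambda>\<omega>. exp (- (\<beta> * real k * V x \<omega>))) = laplace \<beta> k"
proof -
  have "expectation (\<lambda>\<omega>. exp (- (\<beta> * real k * V x \<omega>))) = (\<integral>t. exp (- (\<beta> * real k * t)) \<partial>distr M borel (V x))" for x
    by (subst integral_distr) auto
  then show ?thesis unfolding laplace_def using ident[of x 0] by simp
qed

lemma site_interaction_laplace:
  assumes \<beta>: "0 \<le> \<beta>"
  shows "site_interaction (laplace \<beta>) (\<beta> * mean)"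
proof
  show "laplace \<beta> 0 = 1" by (simp add: laplace_def prob_space)
  show "laplace \<beta> k \<le> laplace \<beta> j" if "j \<le> k" for j k
    unfolding laplace_def
  proof (rule integral_mono_AE)
    show "integrable M (\<lambda>\<omega>. exp (- (\<beta> * real k * V 0 \<omega>)))" "integrable M (\<lambda>\<omega>. exp (- (\<beta> * real j * V 0 \<omega>)))"
      using integrable_exp[of "\<beta> * real k" 0] integrable_exp[of "\<beta> * real j" 0] \<beta> by simp_all
    show "AE \<omega> in M. exp (- (\<beta> * real k * V 0 \<omega>)) \<le> exp (- (\<beta> * real j * V 0 \<omega>))"
      using nonneg[of 0] by eventually_elim (use that \<beta> in \<open>auto intro!: mult_right_mono mult_left_mono\<close>)
  qed
  show "exp (- (\<beta> * mean) * real k) \<le> laplace \<beta> k" for k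
  proof -
    let ?E = "exp (- (\<beta> * mean) * real k)"
    \<comment> \<open>Jensen's inequality through the tangent of the exponential at the
      mean.\<close>
    have int: "integrable M (\<lambda>\<omega>. ?E * (1 - \<beta> * real k * (V 0 \<omega> - mean)))"
      using integrable_V[of 0] by simp
    have "expectation (\<lambda>\<omega>. ?E * (1 - \<beta> * real k * (V 0 \<omega> - mean))) = ?E"
      using integrable_V[of 0] by (simp add: prob_space mean_def)
    moreover have "expectation (\<lambda>\<omega>. ?E * (1 - \<beta> * real k * (V 0 \<omega> - mean))) \<le> laplace \<beta> k"
      unfolding laplace_def
    proof (rule integral_mono[OF int])
      show "integrable M (\<lambda>\<omega>. exp (- (\<beta> * real k * V 0 \<omega>)))"
        using integrable_exp[of "\<beta> * real k" 0] \<beta> by simp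
      fix \<omega>
      have "?E * (1 + - (\<beta> * real k * (V 0 \<omega> - mean))) \<le> ?E * exp (- (\<beta> * real k * (V 0 \<omega> - mean)))"
        by (intro mult_left_mono exp_ge_add_one_self) auto
      also have "\<dots> = exp (- (\<beta> * real k * V 0 \<omega>))" by (simp add: algebra_simps flip: exp_add)
      finally show "?E * (1 - \<beta> * real k * (V 0 \<omega> - mean)) \<le> exp (- (\<beta> * real k * V 0 \<omega>))" by simp
    qed
    ultimately show ?thesis by simp
  qed
qed

text \<open>Collecting equal sites turns the exponential into a product over distinct sites, to
  which independence applies.\<close>

lemma
  assumes \<beta>: "0 \<le> \<beta>"
  shows expectation_sites: "expectation (\<lambda>\<omega>. exp (- (\<beta> * (\<Sum>x\<in>#A. V x \<omega>)))) = site_weight (laplace \<beta>) A"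
    and integrable_sites: "integrable M (\<lambda>\<omega>. exp (- (\<beta> * (\<Sum>x\<in>#A. V x \<omega>))))"
proof -
  have eq: "exp (- (\<beta> * (\<Sum>x\<in>#A. V x \<omega>))) = (\<Prod>x\<in>set_mset A. exp (- (\<beta> * real (count A x) * V x \<omega>)))" for \<omega>
    by (simp add: sum_mset_superset[of "set_mset A"] sum_distrib_left mult.assoc flip: exp_sum sum_negf)
  have "indep_vars (\<lambda>_. borel) (\<lambda>x \<omega>. exp (- (\<beta> * real (count A x) * V x \<omega>))) (set_mset A)"
    by (rule indep_vars_compose2[OF indep_vars_subset[OF indep]]) auto
  moreover have "integrable M (\<lambda>\<omega>. exp (- (\<beta> * real (count A x) * V x \<omega>)))" for x
    using integrable_exp[of "\<beta> * real (count A x)" x] \<beta> by simp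
  ultimately show "expectation (\<lambda>\<omega>. exp (- (\<beta> * (\<Sum>x\<in>#A. V x \<omega>)))) = site_weight (laplace \<beta>) A"
    and "integrable M (\<lambda>\<omega>. exp (- (\<beta> * (\<Sum>x\<in>#A. V x \<omega>))))"
    unfolding eq site_weight_def
    by (auto simp: indep_vars_lebesgue_integral laplace_eq intro: indep_vars_integrable)
qed

lemma annealed_Z_eq:
  assumes "0 \<le> \<beta>"
  shows "annealed_Z i h \<beta> N M V = site_interaction.annealed_sum (laplace \<beta>) i h N"
  unfolding annealed_Z_def quenched_Z_eq site_interaction.annealed_sum_def[OF site_interaction_laplace[OF assms]]
  by (simp add: integrable_sites[OF assms] expectation_sites[OF assms])

text \<open>Both words of a pair see the same potential, so their multisets of sites are added
  before the expectation is taken.\<close>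

lemma second_moment_eq:
  assumes "0 \<le> \<beta>"
  shows "(\<integral>\<omega>. (quenched_Z i h \<beta> N (\<lambda>x. V x \<omega>))\<^sup>2 \<partial>M) =
    (\<Sum>w\<in>words N. \<Sum>w'\<in>words N. word_weight i h w * word_weight i h w' *
       site_weight (laplace \<beta>) (sites w + sites w'))"
proof -
  have "(quenched_Z i h \<beta> N (\<lambda>x. V x \<omega>))\<^sup>2 = (\<Sum>w\<in>words N. \<Sum>w'\<in>words N. word_weight i h w * word_weight i h w' *
      exp (- (\<beta> * (\<Sum>x\<in>#sites w + sites w'. V x \<omega>))))" for \<omega>
    unfolding quenched_Z_eq power2_eq_square sum_product
    by (intro sum.cong refl) (simp add: distrib_left exp_minus exp_add exp_diff divide_inverse mult_ac)
  then have "(\<integral>\<omega>. (quenched_Z i h \<beta> N (\<lambda>x. V x \<omega>))\<^sup>2 \<partial>M) = (\<integral>\<omega>. (\<Sum>w\<in>words N. \<Sum>w'\<in>words N.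
      word_weight i h w * word_weight i h w' * exp (- (\<beta> * (\<Sum>x\<in>#sites w + sites w'. V x \<omega>)))) \<partial>M)"
    by (simp only:)
  then show ?thesis
    by (simp add: integrable_sites[OF assms] expectation_sites[OF assms] del: image_mset_union sum_mset.union)
qed

end

theorem theoremD:
  fixes M :: "'a measure"
    and V :: "int ^ 'd::finite \<Rightarrow> 'a \<Rightarrow> real"
    and i1 :: 'd
    and h :: real
  assumes "CARD('d) \<ge> 4"
    and "h > 0"
    and "prob_space M"
    and "prob_space.indep_vars M (\<lambda>_. borel) V UNIV"
    and "\<And>x y. distr M borel (V x) = distr M borel (V y)"
    and "\<And>x. essinf M (V x) = 0"
    and "\<And>x. integrable M (\<lambda>\<omega>. V x \<omega> ^ CARD('d))"
    and "\<And>x. measure M {\<omega> \<in> space M. V x \<omega> = 0} < 1"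
  shows "\<exists>\<beta>\<^sub>0>0. \<exists>K :: real. \<forall>N\<ge>1. \<forall>\<beta>. 0 \<le> \<beta> \<and> \<beta> \<le> \<beta>\<^sub>0 \<longrightarrow>
           (\<integral>\<omega>. (quenched_Z i1 h \<beta> N (\<lambda>x. V x \<omega>))\<^sup>2 \<partial>M) \<le> K * (annealed_Z i1 h \<beta> N M V)\<^sup>2"
proof -
  interpret prob_space M by fact
  have V_nonneg: "AE \<omega> in M. 0 \<le> V x \<omega>" for x
    using assms(6) by (rule essinf_0_nonneg)
  have V_meas: "V x \<in> borel_measurable M" for x
    using assms(4) by (auto simp: indep_vars_def)
  have "integrable M (V x)" for x
  proof (rule Bochner_Integration.integrable_bound)
    show "integrable M (\<lambda>\<omega>. 1 + V x \<omega> ^ CARD('d))"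
      using assms(7)[of x] by simp
    show "AE \<omega> in M. norm (V x \<omega>) \<le> norm (1 + V x \<omega> ^ CARD('d))"
      using V_nonneg[of x]
    proof eventually_elim
      case (elim \<omega>)
      have "V x \<omega> \<le> 1 + V x \<omega> ^ CARD('d)"
      proof (cases "V x \<omega> \<le> 1")
        case True
        then show ?thesis using elim by (simp add: add_increasing2)
      next
        case False
        then show ?thesis using power_increasing[of 1 "CARD('d)" "V x \<omega>"] by (simp add: Suc_leI)
      qed
      then show ?case using elim by simp
    qed
  qed (rule V_meas)
  then interpret random_potential M V
    using assms(4,5) V_nonneg by unfold_locales auto
  obtain C \<theta> :: real where C: "1 \<le> C" and \<theta>: "0 < \<theta>" "\<theta> < 1"
    and tail: "\<And>n. word_mass i1 h n (no_cut i1) \<le> C * \<theta> ^ n"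
    using no_cut_tail[OF assms(2), of i1] by blast
  \<comment> \<open>Halfway between \<theta> and 1: the room above \<theta> is for exp (2 *
    \<epsilon>), the room below 1 for convergence.\<close>
  define \<kappa> where "\<kappa> = (1 + \<theta>) / 2"
  have \<kappa>: "\<theta> < \<kappa>" "\<kappa> < 1" "0 < \<kappa>" using \<theta> by (auto simp: \<kappa>_def field_simps)
  have "(\<lambda>k. C * \<kappa> ^ k / (1 - \<kappa>)\<^sup>2) \<longlonglongrightarrow> C * 0 / (1 - \<kappa>)\<^sup>2"
    using \<kappa> by (intro tendsto_intros LIMSEQ_realpow_zero) auto
  then have "eventually (\<lambda>k. C * \<kappa> ^ k / (1 - \<kappa>)\<^sup>2 < 1 / 2) sequentially"
    by (rule order_tendstoD) simp
  then obtain k\<^sub>0 where k\<^sub>0: "C * \<kappa> ^ k\<^sub>0 / (1 - \<kappa>)\<^sup>2 < 1 / 2"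
    by (auto simp: eventually_sequentially)
  have "3 \<le> card (UNIV - {i1})" using assms(1) by (simp add: card_Diff_subset)
  then obtain T where T: "T \<subseteq> UNIV - {i1}" "card T = 3"
    by (meson obtain_subset_with_card_n)
  obtain ds where ds: "distinct ds" "set ds = T"
    using finite_distinct_list[of T] by auto
  \<comment> \<open>The three entries provide \<epsilon> \<le> 1, \<theta> * exp (2 * \<epsilon>)
    \<le> \<kappa> and \<epsilon> * pair_const \<le> 1 / 2. The choice is not circular:
    \<open>pair_const\<close> takes neither the Laplace transforms nor \<epsilon> as an
    argument.\<close>
  define \<epsilon>\<^sub>0 where "\<epsilon>\<^sub>0 = min 1 (min (ln (\<kappa> / \<theta>) / 2) (1 / (2 * (1 + \<bar>tilted_walk.pair_const i1 h C \<theta> \<kappa> ds\<bar>))))"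
  have \<epsilon>\<^sub>0: "0 < \<epsilon>\<^sub>0" using \<kappa> \<theta> by (simp add: \<epsilon>\<^sub>0_def add_pos_nonneg)
  define \<beta>\<^sub>0 where "\<beta>\<^sub>0 = \<epsilon>\<^sub>0 / (mean + 1)"
  have \<beta>\<^sub>0: "0 < \<beta>\<^sub>0" using \<epsilon>\<^sub>0 mean_nonneg by (simp add: \<beta>\<^sub>0_def)
  \<comment> \<open>Neither \<beta> nor \<open>N\<close> enters the constant, since
    \<open>bridge_min\<close> is built from the walk and the tail constants alone.\<close>
  have bound: "(\<integral>\<omega>. (quenched_Z i1 h \<beta> N (\<lambda>x. V x \<omega>))\<^sup>2 \<partial>M) \<le>
      2 * (C / (1 - \<kappa>)) ^ 4 / (tilted_walk.bridge_min i1 h C \<theta> k\<^sub>0)\<^sup>2 * (annealed_Z i1 h \<beta> N M V)\<^sup>2"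
    if \<beta>: "0 \<le> \<beta>" "\<beta> \<le> \<beta>\<^sub>0" for \<beta> N
  proof -
    have "\<beta> * mean \<le> \<beta>\<^sub>0 * (mean + 1)"
      using \<beta> mean_nonneg by (intro mult_mono) auto
    also have "\<dots> = \<epsilon>\<^sub>0" using mean_nonneg by (simp add: \<beta>\<^sub>0_def)
    finally have mean_le: "\<beta> * mean \<le> \<epsilon>\<^sub>0" .
    interpret site_interaction "laplace \<beta>" "\<beta> * mean"
      by (rule site_interaction_laplace[OF \<beta>(1)])
    interpret tilted_walk "laplace \<beta>" "\<beta> * mean" i1 h C \<theta> \<kappa> ds k\<^sub>0
    proof
      show "0 \<le> \<beta> * mean" using \<beta> mean_nonneg by simp
      show "\<beta> * mean \<le> 1" using mean_le by (simp add: \<epsilon>\<^sub>0_def)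
      have "2 * (\<beta> * mean) \<le> ln (\<kappa> / \<theta>)" using mean_le by (simp add: \<epsilon>\<^sub>0_def)
      then have "exp (2 * (\<beta> * mean)) \<le> exp (ln (\<kappa> / \<theta>))" by simp
      also have "\<dots> = \<kappa> / \<theta>" using \<kappa> \<theta> by simp
      finally show "\<theta> * exp (2 * (\<beta> * mean)) \<le> \<kappa>" using \<theta> by (simp add: pos_le_divide_eq mult.commute)
      show "length ds = 3" using ds T(2) distinct_card[of ds] by simp
      show "i1 \<notin> set ds" using ds T(1) by auto
    qed (use C \<theta> \<kappa> tail ds k\<^sub>0 in auto)
    have "\<beta> * mean * pair_const \<le> \<epsilon>\<^sub>0 * (1 + \<bar>pair_const\<bar>)"
      using mean_le \<beta> mean_nonneg by (intro order_trans[OF mult_left_mono mult_right_mono]) auto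
    also have "\<dots> \<le> 1 / (2 * (1 + \<bar>pair_const\<bar>)) * (1 + \<bar>pair_const\<bar>)"
      by (intro mult_right_mono) (auto simp: \<epsilon>\<^sub>0_def)
    also have "\<dots> = 1 / 2"
      using abs_ge_zero[of pair_const] by (simp add: divide_simps)
    finally show ?thesis
      using second_moment_sum_le_annealed[of N]
      by (simp only: second_moment_eq[OF \<beta>(1)] annealed_Z_eq[OF \<beta>(1)] second_moment_sum_def)
  qed
  show ?thesis
  proof (rule exI[of _ \<beta>\<^sub>0], rule conjI)
    show "0 < \<beta>\<^sub>0" by (rule \<beta>\<^sub>0)
  qed (rule exI, intro allI impI, rule bound, auto)
qed

end
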